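(* Let $\alpha_1,\alpha_2>-1$ with $\alpha_1-\alpha_2\notin\mathbb Z$, and let $\beta=0$. Let $\theta\in(0,1)$ be fixed, and let $\vec n=(n_1,n_2)$ run through multi-indices tending to infinity with $n_1+n_2=2n$ and $\frac{n_2}{n_1+n_2}=\frac\theta2$ (so $n_2=\theta n\in\mathbb Z$ and $n_1=(2-\theta)n$). Let $P_{\vec n}$ be the monic polynomial of degree $n_1+n_2$ satisfying $\int_0^1P_{\vec n}(x)x^kx^{\alpha_j}\,dx=0$ for $k=0,\dots,n_j-1$, $j=1,2$. Let $x^*=-\frac{27\theta^2(2-\theta)^2}{(2+\theta)^2(4-\theta)^2(1-\theta)^2}$. Then, uniformly for $z$ in a sufficiently small neighborhood $D_{x^*}$ of $x^*$, as $n\to\infty$, $$P_{\vec n}(z)=\frac{4^{\alpha_1}(\varphi_0(z)-\theta_1)}{[(2+\theta)(4-\theta)]^{\alpha_1}}\;\frac{(\varphi_0(z)-\theta_2)^{\alpha_2-\alpha_1+1}\,\varphi_0(z)^{2\alpha_1-\alpha_2}}{z^{\alpha_1}\sqrt{\mathcal D(\varphi_0(z))}}\;e^{n\tilde H_0(z)}\Big(1+O\Big(\frac1n\Big)\Big).$$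
   Context: Notation, for $\theta\in(0,1)$: $\theta_1=\frac{2-\theta}{4-\theta}$, $\theta_2=\frac{\theta}{2+\theta}$, $c_0=\frac{4}{(2+\theta)(4-\theta)}$, and $$R(s)=\frac{c_0s^3}{(s-\theta_1)(s-\theta_2)}.$$ $\varphi_0$ is the holomorphic function on $\mathbb C\setminus[0,1]$ with $R(\varphi_0(z))=z$ and $\varphi_0(z)=z/c_0+O(1)$ as $z\to\infty$. It maps the upper (lower) half-plane into the upper (lower) half-plane. $\mathcal D(s)=s^2(s-1)(s-3\theta_1\theta_2)$, and $\sqrt{\mathcal D(\varphi_0(z))}$ is the branch holomorphic in $\mathbb C\setminus[0,1]$ that is positive for large positive $z$. The powers $(\varphi_0(z)-\theta_2)^{\alpha_2-\alpha_1+1}$, $\varphi_0(z)^{2\alpha_1-\alpha_2}$, $z^{\alpha_1}$ are principal branches; their combination in the formula is continuous across $(-\infty,0)$ and is understood there by continuity. $H_0(z)=(2-\theta)\ln(\varphi_0(z)-\theta_1)+\theta\ln(\varphi_0(z)-\theta_2)+C$ (principal logarithms, $z\in\mathbb C\setminus(-\infty,1]$) with $C=(2-\theta)\ln\frac1{\theta_1}+\theta\ln\frac1{\theta_2}$; $C_0=C+2\ln\frac1{c_0}$; and $\tilde H_0=H_0-C_0$. For $n\in\mathbb N$ with $\theta n\in\mathbb Z$, $e^{n\tilde H_0(z)}=c_0^{2n}(\varphi_0(z)-\theta_1)^{(2-\theta)n}(\varphi_0(z)-\theta_2)^{\theta n}$ extends holomorphically to $\mathbb C\setminus[0,1]$.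 *)

theory Defs
  imports "HOL-Complex_Analysis.Complex_Analysis" "HOL-Library.Landau_Symbols"
begin

definition theta1 :: "real \<Rightarrow> real" where
  "theta1 \<theta> = (2 - \<theta>) / (4 - \<theta>)"

definition theta2 :: "real \<Rightarrow> real" where
  "theta2 \<theta> = \<theta> / (2 + \<theta>)"

definition c0 :: "real \<Rightarrow> real" where
  "c0 \<theta> = 4 / ((2 + \<theta>) * (4 - \<theta>))"

definition Rmap :: "real \<Rightarrow> complex \<Rightarrow> complex" where
  "Rmap \<theta> s = of_real (c0 \<theta>) * s ^ 3 / ((s - of_real (theta1 \<theta>)) * (s - of_real (theta2 \<theta>)))"

abbreviation cut01 :: "complex set" where
  "cut01 \<equiv> complex_of_real ` {0..1}"

(* These conditions determine phi uniquely off [0,1]; its values on [0,1] are irrelevant.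
   Since Rmap vanishes at its poles (division by zero), Rmap (phi z) = z with z \<noteq> 0
   also says that phi z is neither theta1 nor theta2. *)
definition is_phi0 :: "real \<Rightarrow> (complex \<Rightarrow> complex) \<Rightarrow> bool" where
  "is_phi0 \<theta> \<phi> \<longleftrightarrow>
     \<phi> holomorphic_on - cut01 \<and>
     (\<forall>z\<in>- cut01. Rmap \<theta> (\<phi> z) = z) \<and>
     (\<lambda>z. \<phi> z - z / of_real (c0 \<theta>)) \<in> O[at_infinity](\<lambda>_. 1)"

definition Dpoly :: "real \<Rightarrow> complex \<Rightarrow> complex" where
  "Dpoly \<theta> s = s ^ 2 * (s - 1) * (s - of_real (3 * theta1 \<theta> * theta2 \<theta>))"

definition is_sqrtD :: "real \<Rightarrow> (complex \<Rightarrow> complex) \<Rightarrow> (complex \<Rightarrow> complex) \<Rightarrow> bool" where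
  "is_sqrtD \<theta> \<phi> S \<longleftrightarrow>
     S holomorphic_on - cut01 \<and>
     (\<forall>z\<in>- cut01. (S z)\<^sup>2 = Dpoly \<theta> (\<phi> z)) \<and>
     (\<forall>\<^sub>F x in at_top. S (complex_of_real x) \<in> \<real> \<and> 0 < Re (S (complex_of_real x)))"

(* The value by continuity on the negative axis of a function given by principal branches:
   the two-sided limit from the slit plane. *)
definition across_neg :: "(complex \<Rightarrow> complex) \<Rightarrow> complex \<Rightarrow> complex" where
  "across_neg f z = (if z \<in> \<real>\<^sub>\<le>\<^sub>0 then Lim (at z within - \<real>\<^sub>\<le>\<^sub>0) f else f z)"

definition powers_comb :: "real \<Rightarrow> real \<Rightarrow> real \<Rightarrow> (complex \<Rightarrow> complex) \<Rightarrow> complex \<Rightarrow> complex" where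
  "powers_comb \<theta> \<alpha>1 \<alpha>2 \<phi> z =
     (\<phi> z - of_real (theta2 \<theta>)) powr of_real (\<alpha>2 - \<alpha>1 + 1) * \<phi> z powr of_real (2 * \<alpha>1 - \<alpha>2)
     / z powr of_real \<alpha>1"

definition Cconst :: "real \<Rightarrow> real" where
  "Cconst \<theta> = (2 - \<theta>) * ln (1 / theta1 \<theta>) + \<theta> * ln (1 / theta2 \<theta>)"

definition C0const :: "real \<Rightarrow> real" where
  "C0const \<theta> = Cconst \<theta> + 2 * ln (1 / c0 \<theta>)"

definition H0 :: "real \<Rightarrow> (complex \<Rightarrow> complex) \<Rightarrow> complex \<Rightarrow> complex" where
  "H0 \<theta> \<phi> z = of_real (2 - \<theta>) * Ln (\<phi> z - of_real (theta1 \<theta>))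
             + of_real \<theta> * Ln (\<phi> z - of_real (theta2 \<theta>)) + of_real (Cconst \<theta>)"

definition H0tilde :: "real \<Rightarrow> (complex \<Rightarrow> complex) \<Rightarrow> complex \<Rightarrow> complex" where
  "H0tilde \<theta> \<phi> z = H0 \<theta> \<phi> z - of_real (C0const \<theta>)"

(* The weight x powr \<alpha> is the Jacobi-Pineiro weight x powr \<alpha> * (1 - x) powr \<beta> for \<beta> = 0.
   For \<alpha> > -1 the integrand is integrable, and its value at 0 is immaterial. *)
definition is_JP_poly :: "real \<Rightarrow> real \<Rightarrow> nat \<Rightarrow> nat \<Rightarrow> complex poly \<Rightarrow> bool" where
  "is_JP_poly \<alpha>1 \<alpha>2 n1 n2 P \<longleftrightarrow>
     degree P = n1 + n2 \<and> lead_coeff P = 1 \<and>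
     (\<forall>k<n1. ((\<lambda>x::real. poly P (of_real x) * of_real (x ^ k * x powr \<alpha>1)) has_integral 0) {0..1}) \<and>
     (\<forall>k<n2. ((\<lambda>x::real. poly P (of_real x) * of_real (x ^ k * x powr \<alpha>2)) has_integral 0) {0..1})"

definition xstar :: "real \<Rightarrow> real" where
  "xstar \<theta> = - (27 * \<theta>\<^sup>2 * (2 - \<theta>)\<^sup>2 / ((2 + \<theta>)\<^sup>2 * (4 - \<theta>)\<^sup>2 * (1 - \<theta>)\<^sup>2))"

end

(* For beta = 0 the Mellin transform of P vanishes at the N = 2n points alpha_j + k, which determines
   it up to a constant; its residues give P explicitly.  So, up to a factor, P arises from (1 - x)^N
   by the operators x d/dx + alpha_j + 1 + k, and a weighted Gauss-Lucas argument keeps all zeros x_j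
   in [0,1].  The coefficients satisfy a two-term recurrence, i.e. P solves a third order
   differential equation.

   In the variable w = 1/z the function V(w) = (1/n) sum_j 1/(1 - x_j w) is bounded together with its
   derivatives on Re w < 1/2, uniformly in n.  Dividing the differential equation by n^3 gives
   F(w,V) + G1/n + G2/n^2 = 0 with the cubic F(w,v) = (v-2)(v+2-theta)(v+theta) - w v^3, whose root
   with value 2 at w = 0 is v0 = 2 phi/(phi-1), phi = phi_0(1/w).  This root is simple, so
   connectedness yields V = v0 + O(1/n), Cauchy's estimate gives the same for derivatives, and a
   second pass gives V = v0 + v1/n + O(1/n^2).  Integrating n(2-V)/w from w = 0, that is from
   z = infinity where P is normalized, gives the logarithm of P up to O(1/n).  The two resulting
   primitives are matched with the closed formula on each half-plane, by comparing logarithmic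
   derivatives and the limits at w = 0.  The argument works near every point of the negative axis. *)

theory Submission
  imports Defs "HOL-Computational_Algebra.Fundamental_Theorem_Algebra"
begin

section \<open>Explicit coefficients and location of the zeros\<close>

text \<open>With z = 1/w one has V(w) = z P'(z) / (n P(z)), so log P is n times an integral of V: an
  error O(1/n) in log P requires V up to O(1/n^2), which is why exactly one correction term v1 is
  computed. The location of the zeros enters through a priori bounds: as all x_j lie in [0,1], each
  |1 - x_j w| is at least 1/2 on Re w < 1/2, so V, V', V'' are bounded independently of n and the
  derivative terms may be treated as perturbations of an algebraic equation. That equation is R(s) =
  z in disguise, under the Moebius map v = 2s/(s - 1). The obstacle at the end is that the point of
  interest lies on the cut of the principal branches, where the formula is defined only by a limit.
  On the w side nothing is singular there. Hence the formula is compared with the w side off the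
  axis, on a convex set having w = 0 only as a boundary point, and is then extended by
  continuity.\<close>

lemma of_nat_add_of_real_nonzero:
  assumes "s > -1"
  shows "of_nat k + 1 + complex_of_real s \<noteq> 0"
proof
  assume "of_nat k + 1 + complex_of_real s = 0"
  then have "Re (of_nat k + 1 + complex_of_real s) = 0" by simp
  then show False using assms by simp
qed

text \<open>The operator x d/dx + c. It is diagonal on monomials, so a multiplier acting on
  coefficients becomes a differential operator whose effect on zeros can be controlled.\<close>

definition euler_shift :: "'a::idom \<Rightarrow> 'a poly \<Rightarrow> 'a poly" where
  "euler_shift c p = pCons 0 (pderiv p) + smult c p"

lemma coeff_euler_shift: "coeff (euler_shift c p) k = (of_nat k + c) * coeff p k"
  by (cases k) (simp_all add: euler_shift_def coeff_pderiv algebra_simps)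

lemma poly_euler_shift: "poly (euler_shift c p) z = z * poly (pderiv p) z + c * poly p z"
  by (simp add: euler_shift_def)

lemma pderiv_prod_linear:
  fixes a b :: "nat \<Rightarrow> 'a::field"
  assumes "\<And>i. i < d \<Longrightarrow> a i + z * b i \<noteq> 0"
  shows "poly (pderiv (\<Prod>i<d. [:a i, b i:])) z
       = (\<Sum>i<d. b i / (a i + z * b i)) * poly (\<Prod>i<d. [:a i, b i:]) z"
  using assms
proof (induction d)
  case (Suc d)
  have "a d + z * b d \<noteq> 0" using Suc.prems by simp
  then show ?case
    using Suc by (simp add: pderiv_mult pderiv_pCons field_simps del: mult_pCons_left mult_pCons_right)
qed simp

text \<open>Gauss-Lucas with one extra weighted point: dividing z p' + c p = 0 by z p(z) gives sum_i
  1/(z - r_i) + c/z = 0, an equilibrium of positive charges at the roots r_i and of a charge c > 0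
  at 0. All charges sit on the segment [0,1], so no equilibrium lies off it.\<close>

lemma euler_shift_roots:
  fixes p :: "complex poly" and c :: real
  assumes c: "c > 0" and p: "p \<noteq> 0" and roots: "\<And>z. poly p z = 0 \<Longrightarrow> z \<in> cut01"
    and z: "poly (euler_shift (of_real c) p) z = 0"
  shows "z \<in> cut01"
proof (rule ccontr)
  assume nz: "z \<notin> cut01"
  obtain r where r: "smult (lead_coeff p) (\<Prod>i<degree p. [:-r i, 1:]) = p"
    by (rule complex_poly_decompose')
  define d where "d = degree p"
  define q where "q = (\<Prod>i<d. [:-r i, 1:])"
  have pq: "p = smult (lead_coeff p) q" using r by (simp add: q_def d_def)
  have "r i \<in> cut01" if "i < d" for i
  proof -
    have "poly q (r i) = 0"
      using that by (auto simp: q_def poly_prod)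
    then have "poly p (r i) = 0" by (subst pq) simp
    then show ?thesis by (rule roots)
  qed
  then have r01: "\<exists>x. r i = of_real x \<and> 0 \<le> x \<and> x \<le> 1" if "i < d" for i
    using \<open>\<And>i. i < d \<Longrightarrow> r i \<in> cut01\<close>[OF that] by auto
  define m where "m = (\<lambda>i. (Re (z - r i))\<^sup>2 + (Im (z - r i))\<^sup>2)"
  have zr: "z \<noteq> r i" if "i < d" for i using nz \<open>\<And>i. i < d \<Longrightarrow> r i \<in> cut01\<close> that by auto
  have m_pos: "m i > 0" if "i < d" for i
    using zr[OF that] by (auto simp: m_def complex_eq_iff sum_power2_gt_zero_iff)
  have z0: "z \<noteq> 0" using nz by (auto simp: image_iff)
  have "poly p z \<noteq> 0" using nz roots by blast
  then have q0: "poly q z \<noteq> 0" using pq by (metis mult_zero_right poly_smult)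
  have "poly (pderiv q) z = (\<Sum>i<d. 1 / (- r i + z * 1)) * poly q z"
    unfolding q_def by (rule pderiv_prod_linear) (use zr in auto)
  moreover have "z * poly (pderiv q) z + of_real c * poly q z = 0"
  proof -
    have "lead_coeff p * (z * poly (pderiv q) z + of_real c * poly q z) = 0"
      using z by (subst (asm) pq) (simp add: poly_euler_shift pderiv_smult algebra_simps)
    then show ?thesis using p by simp
  qed
  ultimately have "(z * (\<Sum>i<d. 1 / (z - r i)) + of_real c) * poly q z = 0"
    by (simp add: algebra_simps)
  then have "z * (\<Sum>i<d. 1 / (z - r i)) + of_real c = 0" using q0 by simp
  then have eq: "(\<Sum>i<d. inverse (z - r i)) + of_real c * inverse z = 0"
    using z0 by (simp add: field_simps)
  define M where "M = (Re z)\<^sup>2 + (Im z)\<^sup>2"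
  have Mpos: "M > 0" using z0 by (auto simp: M_def complex_eq_iff sum_power2_gt_zero_iff)
  \<comment> \<open>The charges are real, so the imaginary part is - Im z times a positive number,
    and z must be real. On either side of [0,1] the real terms then all have one sign, strictly so
    because of c/z.\<close>
  have "Im ((\<Sum>i<d. inverse (z - r i)) + of_real c * inverse z)
      = - Im z * ((\<Sum>i<d. 1 / m i) + c / M)"
  proof -
    have "Im (inverse (z - r i)) = - Im z * (1 / m i)" if "i < d" for i
      using r01[OF that] by (auto simp: m_def)
    then show ?thesis by (simp add: M_def sum_distrib_left algebra_simps Im_sum)
  qed
  moreover have "(\<Sum>i<d. 1 / m i) + c / M > 0"
    using m_pos Mpos c by (intro add_nonneg_pos sum_nonneg) (auto simp: less_imp_le)
  ultimately have Im0: "Im z = 0" using eq by simp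
  have "Re ((\<Sum>i<d. inverse (z - r i)) + of_real c * inverse z)
      = (\<Sum>i<d. Re (z - r i) / m i) + c * Re z / M"
    by (simp add: M_def m_def Re_sum)
  then have re: "(\<Sum>i<d. Re (z - r i) / m i) + c * Re z / M = 0" using eq by simp
  have "Re z < 0 \<or> Re z > 1"
    using nz Im0 by (auto simp: image_iff complex_eq_iff)
  then show False
  proof
    assume neg: "Re z < 0"
    have "Re (z - r i) / m i \<le> 0" if "i < d" for i
      using r01[OF that] m_pos[OF that] neg by (auto simp: divide_nonpos_pos)
    then have "(\<Sum>i<d. Re (z - r i) / m i) \<le> 0" by (intro sum_nonpos) auto
    moreover have "c * Re z / M < 0" using neg c Mpos by (simp add: divide_neg_pos mult_pos_neg)
    ultimately show False using re by linarith
  next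
    assume pos: "Re z > 1"
    have "Re (z - r i) / m i \<ge> 0" if "i < d" for i
      using r01[OF that] m_pos[OF that] pos by auto
    then have "(\<Sum>i<d. Re (z - r i) / m i) \<ge> 0" by (intro sum_nonneg) auto
    moreover have "c * Re z / M > 0" using pos c Mpos by simp
    ultimately show False using re by linarith
  qed
qed

text \<open>Each factor k + 1 + s is one application of the Euler operator with c = s + 1 > 0; the
  polynomial stays nonzero because no such factor vanishes.\<close>

lemma multiplier_roots:
  fixes p :: "complex poly" and Z :: "real set"
  assumes "finite Z" "\<And>s. s \<in> Z \<Longrightarrow> s > -1" and p: "p \<noteq> 0" "\<And>z. poly p z = 0 \<Longrightarrow> z \<in> cut01"
  shows "\<exists>q. q \<noteq> 0 \<and> (\<forall>z. poly q z = 0 \<longrightarrow> z \<in> cut01) \<and>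
      (\<forall>k. coeff q k = coeff p k * (\<Prod>s\<in>Z. of_nat k + 1 + of_real s))"
  using assms(1,2)
proof (induction Z rule: finite_induct)
  case empty
  then show ?case using p by auto
next
  case (insert s Z)
  then obtain q where q: "q \<noteq> 0" "\<And>z. poly q z = 0 \<Longrightarrow> z \<in> cut01"
    "\<And>k. coeff q k = coeff p k * (\<Prod>s\<in>Z. of_nat k + 1 + of_real s)" by auto
  have s: "s + 1 > 0" using insert.prems[of s] by simp
  define q' where "q' = euler_shift (of_real (s + 1)) q"
  have nz: "of_nat k + (1 + complex_of_real s) \<noteq> 0" for k
    using of_nat_add_of_real_nonzero[of s k] s by (simp add: add.assoc add.commute add.left_commute)
  have "q' \<noteq> 0"
  proof
    assume "q' = 0"
    then have "coeff q' (degree q) = 0" by simp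
    then have "(of_nat (degree q) + (1 + complex_of_real s)) * lead_coeff q = 0"
      by (simp add: q'_def coeff_euler_shift add_ac)
    then show False using q(1) nz[of "degree q"] by simp
  qed
  moreover have "z \<in> cut01" if "poly q' z = 0" for z
    using euler_shift_roots[OF s q(1) q(2)] that by (simp add: q'_def)
  moreover have "coeff q' k = coeff p k * (\<Prod>s\<in>insert s Z. of_nat k + 1 + of_real s)" for k
    using insert.hyps by (simp add: q'_def coeff_euler_shift q(3) algebra_simps)
  ultimately show ?case by blast
qed

text \<open>Integrating monomials turns orthogonality into a zero, at s =
  \<open>\<alpha> + real k\<close>, of the Mellin transform sum_i c_i / (i + 1 + s).\<close>

lemma moment_condition:
  fixes P :: "complex poly"
  assumes \<alpha>: "\<alpha> > -1" and deg: "degree P \<le> N"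
    and int: "((\<lambda>x::real. poly P (of_real x) * of_real (x ^ k * x powr \<alpha>)) has_integral 0) {0..1}"
  shows "(\<Sum>i\<le>N. coeff P i / (of_nat i + 1 + of_real (\<alpha> + real k))) = 0"
proof -
  have "((\<lambda>x::real. \<Sum>i\<le>N. coeff P i * complex_of_real (x powr (\<alpha> + real (i + k)))) has_integral
         (\<Sum>i\<le>N. coeff P i * complex_of_real (1 powr ((\<alpha> + real (i + k)) + 1) / ((\<alpha> + real (i + k)) + 1)))) {0..1}"
    using \<alpha> by (intro has_integral_sum has_integral_mult_right has_integral_of_real has_integral_powr_from_0) auto
  moreover have "(\<Sum>i\<le>N. coeff P i * complex_of_real (x powr (\<alpha> + real (i + k))))
      = poly P (of_real x) * of_real (x ^ k * x powr \<alpha>)" if "x \<in> {0..1}" for x :: real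
  proof (cases "x = 0")
    \<comment> \<open>At x = 0 both sides are 0, since \<open>0 powr a = 0\<close> for every
      exponent a, also for a = 0 and a < 0.\<close>
    case True
    then show ?thesis by simp
  next
    case False
    then have x: "x > 0" using that by simp
    have "poly P (of_real x) = (\<Sum>i\<le>N. coeff P i * of_real x ^ i)"
      using poly_as_sum_of_monoms'[OF deg] by (metis (no_types, lifting) poly_sum poly_monom sum.cong)
    then show ?thesis
      using x by (simp add: sum_distrib_left powr_add powr_realpow power_add mult_ac)
  qed
  ultimately have "((\<lambda>x::real. poly P (of_real x) * of_real (x ^ k * x powr \<alpha>)) has_integral
         (\<Sum>i\<le>N. coeff P i * complex_of_real (1 powr ((\<alpha> + real (i + k)) + 1) / ((\<alpha> + real (i + k)) + 1)))) {0..1}"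
    by (rule has_integral_eq[rotated])
  from has_integral_unique[OF int this]
  show ?thesis by (simp add: algebra_simps)
qed

text \<open>The product over l <> k of s + l + 1 at the pole s = -(k + 1); combined with N! it
  produces the signed binomial coefficient.\<close>

lemma prod_differences:
  assumes "k \<le> N"
  shows "(\<Prod>l\<in>{..N} - {k}. of_nat l - (of_nat k :: complex)) = (-1) ^ k * fact k * fact (N - k)"
proof -
  have split: "{..N} - {k} = {..<k} \<union> {k<..N}" using assms by auto
  have 1: "(\<Prod>l<k. of_nat l - (of_nat k :: complex)) = (-1) ^ k * fact k"
  proof -
    have "(\<Prod>l<k. of_nat l - (of_nat k :: complex)) = (\<Prod>l<k. (-1) * of_nat (k - l))"
      by (intro prod.cong) (auto simp: of_nat_diff)
    also have "\<dots> = (-1) ^ k * (\<Prod>l<k. of_nat (k - l))"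
      unfolding prod.distrib by simp
    also have "(\<Prod>l<k. of_nat (k - l) :: complex) = fact k"
      unfolding fact_prod of_nat_prod
      by (rule prod.reindex_bij_witness[of _ "\<lambda>j. k - j" "\<lambda>l. k - l"]) auto
    finally show ?thesis .
  qed
  have 2: "(\<Prod>l\<in>{k<..N}. of_nat l - (of_nat k :: complex)) = fact (N - k)"
  proof -
    have "(\<Prod>l\<in>{k<..N}. of_nat l - (of_nat k :: complex)) = (\<Prod>j\<in>{1..N-k}. of_nat j)"
      by (rule prod.reindex_bij_witness[of _ "\<lambda>j. j + k" "\<lambda>l. l - k"]) (use assms in \<open>auto simp: of_nat_diff\<close>)
    then show ?thesis by (simp add: fact_prod)
  qed
  show ?thesis unfolding split by (subst prod.union_disjoint) (auto simp: 1 2)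
qed

text \<open>Over the common denominator, the product of all s + l + 1, the Mellin transform has a
  numerator \<open>M\<close> of degree at most N. Its N zeros \<open>Z\<close> determine it up to a
  constant, and the residue at s = -(k + 1) isolates \<open>coeff P k\<close>.\<close>

lemma coeffs_from_moments:
  fixes P :: "complex poly" and Z :: "real set"
  assumes fin: "finite Z" and card: "card Z = N" and Z: "\<And>s. s \<in> Z \<Longrightarrow> s > -1"
    and mom: "\<And>s. s \<in> Z \<Longrightarrow> (\<Sum>i\<le>N. coeff P i / (of_nat i + 1 + of_real s)) = 0"
  shows "\<exists>C. \<forall>k\<le>N. coeff P k = C * ((-1) ^ k * of_nat (N choose k)) * (\<Prod>s\<in>Z. of_nat k + 1 + of_real s)"
proof -
  define L where "L = (\<lambda>k. \<Prod>l\<in>{..N} - {k}. [:of_nat l + 1, 1 :: complex:])"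
  define M where "M = (\<Sum>i\<le>N. smult (coeff P i) (L i))"
  define W where "W = (\<Prod>s\<in>Z. [:- complex_of_real s, 1:])"
  have degL: "degree (L k) \<le> N" if "k \<le> N" for k
  proof -
    have "degree (L k) \<le> sum (degree \<circ> (\<lambda>l. [:of_nat l + 1, 1 :: complex:])) ({..N} - {k})"
      unfolding L_def by (rule degree_prod_sum_le) simp
    also have "\<dots> = N" using that by (simp add: card_Diff_singleton)
    finally show ?thesis .
  qed
  have degM: "degree M \<le> N"
    unfolding M_def by (intro degree_sum_le order.trans[OF degree_smult_le] degL) auto
  have degW: "degree W = N"
    unfolding W_def by (subst degree_prod_sum_eq) (auto simp: card)
  have lcW: "coeff W N = 1"
    using degW lead_coeff_prod[of "\<lambda>s. [:- complex_of_real s, 1:]" Z] by (simp add: W_def)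
  have M0: "poly M (of_real s) = 0" if s: "s \<in> Z" for s
  proof -
    have nz: "of_nat i + 1 + complex_of_real s \<noteq> 0" for i
      using of_nat_add_of_real_nonzero[OF Z[OF s]] .
    define U where "U = (\<Prod>l\<le>N. of_nat l + 1 + complex_of_real s)"
    have "poly (smult (coeff P i) (L i)) (of_real s) = U * (coeff P i / (of_nat i + 1 + of_real s))"
      if "i \<le> N" for i
    proof -
      have "U = (of_nat i + 1 + complex_of_real s) * poly (L i) (of_real s)"
        unfolding U_def L_def poly_prod using that by (subst prod.remove[of _ i]) auto
      then show ?thesis using nz by (simp add: field_simps)
    qed
    then have "poly M (of_real s) = (\<Sum>i\<le>N. U * (coeff P i / (of_nat i + 1 + of_real s)))"
      unfolding M_def poly_sum by (intro sum.cong) auto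
    also have "\<dots> = 0" unfolding sum_distrib_left[symmetric] mom[OF s] by simp
    finally show ?thesis .
  qed
  have MW: "M = smult (coeff M N) W"
  proof (rule poly_eqI_degree_lead_coeff[where n = N and A = "complex_of_real ` Z"])
    show "N \<le> card (complex_of_real ` Z)" using card by (simp add: card_image inj_on_def)
    show "poly M z = poly (smult (coeff M N) W) z" if "z \<in> complex_of_real ` Z" for z
      using that M0 fin by (auto simp: W_def poly_prod intro!: prod_zero)
  qed (use lcW degM degW order.trans[OF degree_smult_le] in auto)
  have main: "coeff P k * ((-1) ^ k * fact k * fact (N - k))
      = coeff M N * ((-1) ^ N * (\<Prod>s\<in>Z. of_nat k + 1 + of_real s))" if k: "k \<le> N" for k
  proof -
    \<comment> \<open>For i <> k the product \<open>L i\<close> contains the factor l = k, which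
      vanishes at s = -(k + 1).\<close>
    have "poly (L i) (- (of_nat k + 1)) = 0" if "i \<noteq> k" "i \<le> N" for i
      using that k by (auto simp: L_def poly_prod intro!: prod_zero)
    then have "poly M (- (of_nat k + 1)) = (\<Sum>i\<le>N. if i = k then coeff P k * poly (L k) (- (of_nat k + 1)) else 0)"
      unfolding M_def poly_sum by (intro sum.cong) auto
    also have "\<dots> = coeff P k * poly (L k) (- (of_nat k + 1))" using k by simp
    also have "poly (L k) (- (of_nat k + 1)) = (-1) ^ k * fact k * fact (N - k)"
      by (simp add: L_def poly_prod prod_differences[OF k])
    finally have 1: "poly M (- (of_nat k + 1)) = coeff P k * ((-1) ^ k * fact k * fact (N - k))" .
    have "poly W (- (of_nat k + 1)) = (\<Prod>s\<in>Z. - 1 * (of_nat k + 1 + complex_of_real s))"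
      unfolding W_def poly_prod by (intro prod.cong) (auto simp: algebra_simps)
    also have "\<dots> = (-1) ^ N * (\<Prod>s\<in>Z. of_nat k + 1 + of_real s)"
      unfolding prod.distrib by (simp add: card)
    finally show ?thesis using 1 MW by (metis poly_smult)
  qed
  have "coeff P k = coeff M N * (-1) ^ N / fact N * ((-1) ^ k * of_nat (N choose k)) *
      (\<Prod>s\<in>Z. of_nat k + 1 + of_real s)" if "k \<le> N" for k
  proof -
    have alg: "X = m / F * (e * (F / (f * g))) * w"
      if "X * (e * f * g) = m * w" "e * e = 1" "f \<noteq> 0" "g \<noteq> 0" "F \<noteq> 0"
      for X m F e f g w :: complex
    proof -
      have "X * (e * f * g) * e = X * f * g" using that(2) by (simp add: mult_ac)
      then have "X * f * g = m * w * e" using that(1) by simp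
      then show ?thesis using that(3-) by (simp add: field_simps)
    qed
    show ?thesis
      unfolding binomial_fact[OF that]
      by (rule alg) (use main[OF that] in \<open>simp_all add: mult.assoc power_mult_distrib[symmetric]\<close>)
  qed
  then show ?thesis by blast
qed

text \<open>Telescoping: passing from k to k + 1 changes the product belonging to one weight only by
  the quotient (b + n)/b. This is why a two-term recurrence arises.\<close>

lemma rising_product_shift:
  fixes b :: "'a::comm_ring_1"
  shows "b * (\<Prod>j<n. b + 1 + of_nat j) = (b + of_nat n) * (\<Prod>j<n. b + of_nat j)"
proof -
  have "b * (\<Prod>j<n. b + 1 + of_nat j) = (\<Prod>j<Suc n. b + of_nat j)"
    by (subst prod.lessThan_Suc_shift) (simp add: add_ac)
  then show ?thesis by (simp add: mult.commute)
qed

text \<open>Since alpha_1 - alpha_2 is not an integer, the exponents of the two weights never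
  coincide, so the Mellin transform has n1 + n2 distinct known zeros. Hence P is a multiple of the
  image of (1 - x)^N under Euler operators, which locates its zeros; quotients of neighbouring
  coefficients give the recurrence.\<close>

lemma JP_poly_structure:
  assumes \<alpha>: "\<alpha>1 > -1" "\<alpha>2 > -1" "\<alpha>1 - \<alpha>2 \<notin> \<int>" and JP: "is_JP_poly \<alpha>1 \<alpha>2 n1 n2 P"
  obtains x :: "nat \<Rightarrow> real"
  where "\<And>j. j < n1 + n2 \<Longrightarrow> x j \<in> {0..1}" "P = (\<Prod>j<n1 + n2. [:- of_real (x j), 1:])"
    "\<And>k. (of_nat k + 1) * (of_nat k + 1 + of_real \<alpha>1) * (of_nat k + 1 + of_real \<alpha>2) * coeff P (Suc k)
      = (of_nat k - of_nat (n1 + n2)) * (of_nat k + 1 + of_real \<alpha>1 + of_nat n1)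
        * (of_nat k + 1 + of_real \<alpha>2 + of_nat n2) * coeff P k"
proof -
  define N where "N = n1 + n2"
  have deg: "degree P = N" and lc: "lead_coeff P = 1"
    and int1: "\<And>k. k < n1 \<Longrightarrow> ((\<lambda>x::real. poly P (of_real x) * of_real (x ^ k * x powr \<alpha>1)) has_integral 0) {0..1}"
    and int2: "\<And>k. k < n2 \<Longrightarrow> ((\<lambda>x::real. poly P (of_real x) * of_real (x ^ k * x powr \<alpha>2)) has_integral 0) {0..1}"
    using JP by (auto simp: is_JP_poly_def N_def)
  have P0: "P \<noteq> 0" using lc by auto
  define Z1 where "Z1 = (\<lambda>j. \<alpha>1 + real j) ` {..<n1}"
  define Z2 where "Z2 = (\<lambda>j. \<alpha>2 + real j) ` {..<n2}"
  have inj: "inj_on (\<lambda>j. \<alpha>1 + real j) {..<n1}" "inj_on (\<lambda>j. \<alpha>2 + real j) {..<n2}"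
    by (auto simp: inj_on_def)
  have disj: "Z1 \<inter> Z2 = {}"
  proof (rule ccontr)
    assume "Z1 \<inter> Z2 \<noteq> {}"
    then obtain i j where "\<alpha>1 + real i = \<alpha>2 + real j" by (auto simp: Z1_def Z2_def)
    then have "\<alpha>1 - \<alpha>2 = of_int (int j - int i)" by simp
    then show False using \<alpha>(3) by (metis Ints_of_int)
  qed
  have fin: "finite (Z1 \<union> Z2)" and card: "card (Z1 \<union> Z2) = N"
    using disj by (auto simp: Z1_def Z2_def N_def card_Un_disjoint card_image inj)
  have Z: "s > -1" if "s \<in> Z1 \<union> Z2" for s using that \<alpha> by (auto simp: Z1_def Z2_def)
  have mom: "(\<Sum>i\<le>N. coeff P i / (of_nat i + 1 + of_real s)) = 0" if "s \<in> Z1 \<union> Z2" for s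
    using that moment_condition[OF \<alpha>(1) _ int1, of N] moment_condition[OF \<alpha>(2) _ int2, of N] deg
    by (auto simp: Z1_def Z2_def)
  define W where "W = (\<lambda>k. \<Prod>s\<in>Z1 \<union> Z2. of_nat k + 1 + complex_of_real s)"
  obtain C where C: "\<And>k. k \<le> N \<Longrightarrow> coeff P k = C * ((-1) ^ k * of_nat (N choose k)) * W k"
    using coeffs_from_moments[OF fin card Z mom] unfolding W_def by blast
  have coeff_base: "coeff ([:1, -1 :: complex:] ^ N) k = (-1) ^ k * of_nat (N choose k)" for k
  proof (cases "k \<le> N")
    case True
    then show ?thesis by (simp add: coeff_linear_poly_power)
  next
    case False
    moreover have "degree ([:1, -1 :: complex:] ^ N) \<le> N"
      using degree_power_le[of "[:1, -1 :: complex:]" N] by simp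
    ultimately show ?thesis by (simp add: coeff_eq_0)
  qed
  have base_roots: "z \<in> cut01" if "poly ([:1, -1 :: complex:] ^ N) z = 0" for z
  proof -
    have "z = of_real 1" using that by (auto simp: poly_power)
    then show ?thesis by (metis atLeastAtMost_iff image_eqI order_refl zero_le_one)
  qed
  obtain q where q: "q \<noteq> 0" "\<And>z. poly q z = 0 \<Longrightarrow> z \<in> cut01"
    "\<And>k. coeff q k = coeff ([:1, -1 :: complex:] ^ N) k * W k"
  proof -
    have "[:1, -1 :: complex:] ^ N \<noteq> 0" by simp
    from multiplier_roots[OF fin Z this base_roots] obtain q where
      "q \<noteq> 0" "\<forall>z. poly q z = 0 \<longrightarrow> z \<in> cut01"
      "\<forall>k. coeff q k = coeff ([:1, -1 :: complex:] ^ N) k * (\<Prod>s\<in>Z1 \<union> Z2. of_nat k + 1 + complex_of_real s)"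
      by auto
    then show ?thesis using that[of q] by (simp add: W_def)
  qed
  have "P = smult C q"
  proof (rule poly_eqI)
    fix k show "coeff P k = coeff (smult C q) k"
    proof (cases "k \<le> N")
      case True
      then show ?thesis by (simp add: q(3) coeff_base C)
    next
      case False
      then show ?thesis by (simp add: q(3) coeff_base coeff_eq_0 deg)
    qed
  qed
  then have roots: "z \<in> cut01" if "poly P z = 0" for z
    using that q(2) P0 by auto
  obtain r where r: "smult (lead_coeff P) (\<Prod>i<degree P. [:-r i, 1:]) = P"
    by (rule complex_poly_decompose')
  then have Pr: "P = (\<Prod>i<N. [:-r i, 1:])" using lc deg by simp
  have r01: "r i \<in> cut01" if "i < N" for i
  proof -
    have "poly P (r i) = 0" unfolding Pr poly_prod using that by auto
    then show ?thesis by (rule roots)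
  qed
  define x where "x = (\<lambda>i. Re (r i))"
  have rx: "r i = of_real (x i)" "x i \<in> {0..1}" if "i < N" for i
    using r01[OF that] by (auto simp: x_def)
  have W: "W k = (\<Prod>j<n1. of_nat k + 1 + of_real \<alpha>1 + of_nat j) * (\<Prod>j<n2. of_nat k + 1 + of_real \<alpha>2 + of_nat j)" for k
    unfolding W_def using disj
    by (subst prod.union_disjoint) (auto simp: Z1_def Z2_def prod.reindex inj add_ac)
  have W_Suc: "(of_nat k + 1 + of_real \<alpha>1) * (of_nat k + 1 + of_real \<alpha>2) * W (Suc k)
      = (of_nat k + 1 + of_real \<alpha>1 + of_nat n1) * (of_nat k + 1 + of_real \<alpha>2 + of_nat n2) * W k" for k
  proof -
    define b1 where "b1 = of_nat k + 1 + complex_of_real \<alpha>1"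
    define b2 where "b2 = of_nat k + 1 + complex_of_real \<alpha>2"
    have "W (Suc k) = (\<Prod>j<n1. b1 + 1 + of_nat j) * (\<Prod>j<n2. b2 + 1 + of_nat j)"
      unfolding W b1_def b2_def by (simp add: add_ac)
    then have "b1 * b2 * W (Suc k) = (b1 * (\<Prod>j<n1. b1 + 1 + of_nat j)) * (b2 * (\<Prod>j<n2. b2 + 1 + of_nat j))"
      by simp
    also have "\<dots> = (b1 + of_nat n1) * (b2 + of_nat n2) * W k"
      unfolding rising_product_shift by (simp add: W b1_def b2_def)
    finally show ?thesis by (simp only: b1_def b2_def)
  qed
  have rec: "(of_nat k + 1) * (of_nat k + 1 + of_real \<alpha>1) * (of_nat k + 1 + of_real \<alpha>2) * coeff P (Suc k)
      = (of_nat k - of_nat N) * (of_nat k + 1 + of_real \<alpha>1 + of_nat n1)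
        * (of_nat k + 1 + of_real \<alpha>2 + of_nat n2) * coeff P k" for k
  proof (cases "k < N")
    case True
    have algebra: "- C * e * ((M - d) * b) * (x * y * w) = (d - M) * x * y * (C * (e * b) * w)"
      for e M d b x y w :: complex by (simp add: algebra_simps)
    have "Suc k * (N choose Suc k) = (N - k) * (N choose k)"
      by (metis binomial_absorb_comp binomial_absorption)
    then have "of_nat (Suc k * (N choose Suc k)) = (of_nat ((N - k) * (N choose k)) :: complex)" by simp
    then have b: "(of_nat k + 1) * of_nat (N choose Suc k) = (of_nat N - of_nat k) * (of_nat (N choose k) :: complex)"
      using True by (simp add: of_nat_diff algebra_simps)
    have "(of_nat k + 1) * (of_nat k + 1 + of_real \<alpha>1) * (of_nat k + 1 + of_real \<alpha>2) * coeff P (Suc k)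
       = - C * (-1) ^ k * ((of_nat k + 1) * of_nat (N choose Suc k)) * ((of_nat k + 1 + of_real \<alpha>1) * (of_nat k + 1 + of_real \<alpha>2) * W (Suc k))"
      using True C[of "Suc k"] by simp
    also have "\<dots> = (of_nat k - of_nat N) * (of_nat k + 1 + of_real \<alpha>1 + of_nat n1)
        * (of_nat k + 1 + of_real \<alpha>2 + of_nat n2) * (C * ((-1) ^ k * of_nat (N choose k)) * W k)"
      unfolding b W_Suc by (rule algebra)
    finally show ?thesis using True by (simp add: C)
  next
    case False
    \<comment> \<open>At k = N the factor k - N is 0 on the right and \<open>coeff P (Suc N)\<close>
      is 0 on the left; beyond N all coefficients vanish. So the recurrence holds for every
      k.\<close>
    then show ?thesis by (cases "k = N") (auto simp: coeff_eq_0 deg)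
  qed
  show thesis
    by (rule that[of x]) (use rx Pr rec in \<open>auto simp: N_def\<close>)
qed

section \<open>The differential equation for the logarithmic derivative\<close>

lemma reflect_poly_root_prod:
  fixes x :: "nat \<Rightarrow> 'a::field"
  shows "reflect_poly (\<Prod>j<N. [:- x j, 1:]) = (\<Prod>j<N. [:1, - x j:])"
proof -
  have "reflect_poly [:- c, 1:] = [:1, - c:]" for c :: 'a
    by (cases "c = 0") (simp_all add: reflect_poly_def)
  then show ?thesis by (simp add: reflect_poly_prod)
qed

text \<open>The trivial shifts \<open>- 0\<close> and \<open>- (- of_nat N)\<close> make both sides instances of
  \<open>triple_euler_shift_Qpoly\<close>.\<close>
lemma reflected_euler_equation:
  fixes P :: "complex poly" and A1 A2 B1 B2 :: complex
  assumes deg: "degree P = N"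
    and rec: "\<And>k. (of_nat k + 1) * (of_nat k + 1 + A1) * (of_nat k + 1 + A2) * coeff P (Suc k)
      = (of_nat k - of_nat N) * (of_nat k + B1) * (of_nat k + B2) * coeff P k"
  defines "Q \<equiv> reflect_poly P"
  shows "pCons 0 (euler_shift (- of_nat N - 0) (euler_shift (- of_nat N - A1) (euler_shift (- of_nat N - A2) Q)))
       = euler_shift (- of_nat N - (- of_nat N)) (euler_shift (- of_nat N - B1) (euler_shift (- of_nat N - B2) Q))"
proof (rule poly_eqI)
  fix i
  show "coeff (pCons 0 (euler_shift (- of_nat N - 0) (euler_shift (- of_nat N - A1) (euler_shift (- of_nat N - A2) Q)))) i
       = coeff (euler_shift (- of_nat N - (- of_nat N)) (euler_shift (- of_nat N - B1) (euler_shift (- of_nat N - B2) Q))) i"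
  proof (cases i)
    case 0
    then show ?thesis by (simp add: coeff_euler_shift)
  next
    case (Suc k)
    show ?thesis
    proof (cases "k < N")
      case True
      \<comment> \<open>Coefficients k and k + 1 of \<open>Q\<close> are coefficients j + 1 and j of
        \<open>P\<close>. Each of the three Euler factors on either side changes its sign under this
        reversal, so the signs cancel.\<close>
      define j where "j = N - Suc k"
      have k: "of_nat k = of_nat N - (of_nat j :: complex) - 1"
        using True by (simp add: j_def of_nat_diff)
      have q: "coeff Q k = coeff P (Suc j)" "coeff Q (Suc k) = coeff P j"
        using True by (auto simp: Q_def coeff_reflect_poly deg j_def Suc_diff_Suc)
      have e: "of_nat k + (- of_nat N - A) = - (of_nat j + 1 + A)"
        "of_nat (Suc k) + (- of_nat N - A) = - (of_nat j + A)" for A :: complex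
        by (simp_all add: k)
      show ?thesis
        using rec[of j] unfolding Suc coeff_pCons_Suc coeff_euler_shift e q
        by (simp add: algebra_simps)
    next
      case False
      then show ?thesis
        by (cases "k = N") (auto simp: Suc coeff_euler_shift Q_def coeff_reflect_poly deg)
    qed
  qed
qed

lemma DERIV_inverse_square:
  fixes c w :: complex
  assumes "1 - c * w \<noteq> 0"
  shows "((\<lambda>w. c / (1 - c * w)\<^sup>2) has_field_derivative 2 * c\<^sup>2 / (1 - c * w) ^ 3) (at w)"
proof -
  obtain u where u: "1 - c * w = u" by simp
  have "((\<lambda>w. c / (1 - c * w)\<^sup>2) has_field_derivative
      (0 * u\<^sup>2 - c * (2 * u * - c)) / (u\<^sup>2 * u\<^sup>2)) (at w)"
    using assms by (auto intro!: derivative_eq_intros simp: u)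
  also have "(0 * u\<^sup>2 - c * (2 * u * - c)) / (u\<^sup>2 * u\<^sup>2) = 2 * c\<^sup>2 / u ^ 3"
    using assms u by (simp add: field_simps eval_nat_numeral)
  finally show ?thesis unfolding u .
qed

context
  fixes x :: "nat \<Rightarrow> real" and N :: nat
  assumes x01: "\<And>j. j < N \<Longrightarrow> x j \<in> {0..1}"
begin

text \<open>In the variable z = 1/w this is z P'(z)/P(z) for the monic polynomial P with zeros
  x_j.\<close>

definition Ysum :: "complex \<Rightarrow> complex" where
  "Ysum w = (\<Sum>j<N. 1 / (1 - of_real (x j) * w))"

definition Ysum1 :: "complex \<Rightarrow> complex" where
  "Ysum1 w = (\<Sum>j<N. of_real (x j) / (1 - of_real (x j) * w)\<^sup>2)"

definition Ysum2 :: "complex \<Rightarrow> complex" where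
  "Ysum2 w = (\<Sum>j<N. 2 * (of_real (x j))\<^sup>2 / (1 - of_real (x j) * w) ^ 3)"

definition Qpoly :: "complex poly" where
  "Qpoly = (\<Prod>j<N. [:1, - of_real (x j):])"

text \<open>The real part of 1 - x w is 1 - x Re w, which is at least 1/2 for x in [0,1]. All bounds
  uniform in n stem from here.\<close>

lemma norm_factor_ge:
  assumes "j < N" "Re w < 1/2"
  shows "norm (1 - of_real (x j) * w) \<ge> 1/2"
proof -
  have "x j * Re w \<le> 1/2"
  proof (cases "Re w \<ge> 0")
    case True
    then have "x j * Re w \<le> 1 * Re w" using x01[OF assms(1)] by (intro mult_right_mono) auto
    then show ?thesis using assms by simp
  next
    case False
    then have "x j * Re w \<le> 0" using x01[OF assms(1)] by (simp add: mult_nonneg_nonpos)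
    then show ?thesis by simp
  qed
  then have "1/2 \<le> Re (1 - of_real (x j) * w)" by simp
  also have "\<dots> \<le> norm (1 - of_real (x j) * w)" by (rule complex_Re_le_cmod)
  finally show ?thesis .
qed

lemma factor_nonzero: "j < N \<Longrightarrow> Re w < 1/2 \<Longrightarrow> 1 - of_real (x j) * w \<noteq> 0"
  using norm_factor_ge[of j w] by auto

lemma factor_nonzero': "j < N \<Longrightarrow> Re w < 1/2 \<Longrightarrow> of_real (x j) * w \<noteq> 1"
  using factor_nonzero[of j w] by auto

lemma DERIV_Ysum:
  assumes "Re w < 1/2"
  shows "(Ysum has_field_derivative Ysum1 w) (at w)"
  unfolding Ysum_def[abs_def] Ysum1_def
  by (auto intro!: derivative_eq_intros sum.cong dest: factor_nonzero'[OF _ assms] simp: power2_eq_square)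

lemma DERIV_Ysum1:
  assumes "Re w < 1/2"
  shows "(Ysum1 has_field_derivative Ysum2 w) (at w)"
  unfolding Ysum1_def[abs_def] Ysum2_def
proof (rule DERIV_sum)
  fix j assume "j \<in> {..<N}"
  then have nz: "1 - of_real (x j) * w \<noteq> 0" using factor_nonzero assms by simp
  show "((\<lambda>w. of_real (x j) / (1 - of_real (x j) * w)\<^sup>2) has_field_derivative
      2 * (of_real (x j))\<^sup>2 / (1 - of_real (x j) * w) ^ 3) (at w)"
    using nz by (rule DERIV_inverse_square)
qed

lemma norm_Ysum_le:
  assumes "Re w < 1/2"
  shows "norm (Ysum w) \<le> 2 * real N" "norm (Ysum1 w) \<le> 4 * real N" "norm (Ysum2 w) \<le> 16 * real N"
proof -
  have inv: "1 / norm (1 - of_real (x j) * w) \<le> 2" if "j < N" for j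
    using frac_le[of 1 1 "1/2", OF _ _ _ norm_factor_ge[OF that assms]] by simp
  have x1: "\<bar>x j\<bar> \<le> 1" if "j < N" for j using x01[OF that] by auto
  have "norm (Ysum w) \<le> (\<Sum>j<N. 2)"
    unfolding Ysum_def by (intro sum_norm_le) (use inv in \<open>auto simp: norm_divide\<close>)
  then show "norm (Ysum w) \<le> 2 * real N" by (simp add: mult.commute)
  have "norm (Ysum1 w) \<le> (\<Sum>j<N. 4)"
    unfolding Ysum1_def
  proof (intro sum_norm_le)
    fix j assume "j \<in> {..<N}"
    then have j: "j < N" by simp
    have "norm (of_real (x j) / (1 - of_real (x j) * w)\<^sup>2)
        = \<bar>x j\<bar> * (1 / norm (1 - of_real (x j) * w)) ^ 2"
      by (simp add: norm_divide norm_power power_divide)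
    also have "\<dots> \<le> 1 * 2 ^ 2" by (intro mult_mono power_mono inv x1 j) auto
    finally show "norm (of_real (x j) / (1 - of_real (x j) * w)\<^sup>2) \<le> 4" by simp
  qed
  then show "norm (Ysum1 w) \<le> 4 * real N" by (simp add: mult.commute)
  have "norm (Ysum2 w) \<le> (\<Sum>j<N. 16)"
    unfolding Ysum2_def
  proof (intro sum_norm_le)
    fix j assume "j \<in> {..<N}"
    then have j: "j < N" by simp
    have "norm (2 * (of_real (x j))\<^sup>2 / (1 - of_real (x j) * w) ^ 3)
        = 2 * \<bar>x j\<bar>\<^sup>2 * (1 / norm (1 - of_real (x j) * w)) ^ 3"
      by (simp add: norm_divide norm_mult norm_power power_divide)
    also have "\<dots> \<le> 2 * 1\<^sup>2 * 2 ^ 3" by (intro mult_mono power_mono inv x1 j) auto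
    finally show "norm (2 * (of_real (x j))\<^sup>2 / (1 - of_real (x j) * w) ^ 3) \<le> 16" by simp
  qed
  then show "norm (Ysum2 w) \<le> 16 * real N" by (simp add: mult.commute)
qed

lemma poly_Qpoly_nonzero: "Re w < 1/2 \<Longrightarrow> poly Qpoly w \<noteq> 0"
  using factor_nonzero[of _ w] by (auto simp: Qpoly_def poly_prod mult.commute)

lemma pderiv_Qpoly:
  assumes "Re w < 1/2"
  shows "w * poly (pderiv Qpoly) w = (of_nat N - Ysum w) * poly Qpoly w"
proof -
  have "poly (pderiv Qpoly) w = (\<Sum>j<N. - of_real (x j) / (1 + w * - of_real (x j))) * poly Qpoly w"
    unfolding Qpoly_def
    by (rule pderiv_prod_linear) (use factor_nonzero[OF _ assms] in \<open>auto simp: mult.commute\<close>)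
  moreover have "w * (\<Sum>j<N. - of_real (x j) / (1 + w * - of_real (x j))) = of_nat N - Ysum w"
  proof -
    have "w * (- of_real (x j) / (1 + w * - of_real (x j))) = 1 - 1 / (1 - of_real (x j) * w)"
      if "j < N" for j using factor_nonzero[OF that assms] by (simp add: field_simps)
    then show ?thesis by (simp add: sum_distrib_left Ysum_def sum_subtractf)
  qed
  ultimately show ?thesis by (simp flip: mult.assoc)
qed

text \<open>Since w Q' = (N - Y) Q, conjugation by Q turns w d/dw - N - e into w d/dw - Y - e.
  Writing the shift as - N - e makes N disappear.\<close>

lemma euler_shift_times_Qpoly:
  assumes p: "\<And>u. Re u < 1/2 \<Longrightarrow> poly p u = f u * poly Qpoly u"
    and f: "(f has_field_derivative f') (at w)" and w: "Re w < 1/2"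
  shows "poly (euler_shift (- of_nat N - e) p) w = (w * f' - (Ysum w + e) * f w) * poly Qpoly w"
proof -
  have op: "open {u. Re u < 1/2}" by (rule open_halfspace_Re_lt)
  have "((\<lambda>u. f u * poly Qpoly u) has_field_derivative (f' * poly Qpoly w + f w * poly (pderiv Qpoly) w)) (at w)"
    by (auto intro!: derivative_eq_intros f poly_DERIV)
  then have "(poly p has_field_derivative (f' * poly Qpoly w + f w * poly (pderiv Qpoly) w)) (at w)"
    by (rule has_field_derivative_transform_within_open[OF _ op]) (use w p in auto)
  then have "poly (pderiv p) w = f' * poly Qpoly w + f w * poly (pderiv Qpoly) w"
    using poly_DERIV DERIV_unique by blast
  then have "poly (euler_shift (- of_nat N - e) p) w
     = w * f' * poly Qpoly w + f w * (w * poly (pderiv Qpoly) w) + (- of_nat N - e) * f w * poly Qpoly w"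
    by (simp add: poly_euler_shift p[OF w] algebra_simps)
  then show ?thesis unfolding pderiv_Qpoly[OF w] by (simp add: algebra_simps)
qed

text \<open>Three conjugated operators w d/dw - Y - e applied to the constant 1. The result is
  symmetric in the three shifts.\<close>

lemma triple_euler_shift_Qpoly:
  assumes w: "Re w < 1/2"
  shows "poly (euler_shift (- of_nat N - e3) (euler_shift (- of_nat N - e2) (euler_shift (- of_nat N - e1) Qpoly))) w
    = - ((Ysum w + e1) * (Ysum w + e2) * (Ysum w + e3) + (w * Ysum1 w + w\<^sup>2 * Ysum2 w)
        - w * Ysum1 w * (3 * Ysum w + e1 + e2 + e3)) * poly Qpoly w"
proof -
  have 1: "poly (euler_shift (- of_nat N - e1) Qpoly) u = - (Ysum u + e1) * poly Qpoly u"
    if "Re u < 1/2" for u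
    by (subst euler_shift_times_Qpoly[of _ "\<lambda>_. 1" 0]) (use that in auto)
  have 2: "poly (euler_shift (- of_nat N - e2) (euler_shift (- of_nat N - e1) Qpoly)) u
     = (- u * Ysum1 u + (Ysum u + e2) * (Ysum u + e1)) * poly Qpoly u" if "Re u < 1/2" for u
  proof -
    have "poly (euler_shift (- of_nat N - e2) (euler_shift (- of_nat N - e1) Qpoly)) u
     = (u * - Ysum1 u - (Ysum u + e2) * - (Ysum u + e1)) * poly Qpoly u"
      by (rule euler_shift_times_Qpoly[OF 1])
        (use that in \<open>auto intro!: derivative_eq_intros DERIV_Ysum\<close>)
    then show ?thesis by (simp add: algebra_simps)
  qed
  have 3: "((\<lambda>u. - u * Ysum1 u + (Ysum u + e2) * (Ysum u + e1)) has_field_derivative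
      (- Ysum1 w - w * Ysum2 w + Ysum1 w * (Ysum w + e1) + Ysum1 w * (Ysum w + e2))) (at w)"
    by (auto intro!: derivative_eq_intros DERIV_Ysum DERIV_Ysum1 w simp: algebra_simps)
  show ?thesis
    by (subst euler_shift_times_Qpoly[OF 2 3 w]) (simp_all add: algebra_simps power2_eq_square)
qed

lemma Ysum_equation:
  assumes P: "P = (\<Prod>j<N. [:- of_real (x j), 1:])"
    and rec: "\<And>k. (of_nat k + 1) * (of_nat k + 1 + A1) * (of_nat k + 1 + A2) * coeff P (Suc k)
      = (of_nat k - of_nat N) * (of_nat k + B1) * (of_nat k + B2) * coeff P k"
    and w: "Re w < 1/2"
  shows "w * (Ysum w * (Ysum w + A1) * (Ysum w + A2) + (w * Ysum1 w + w\<^sup>2 * Ysum2 w)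
        - w * Ysum1 w * (3 * Ysum w + A1 + A2))
     = (Ysum w - of_nat N) * (Ysum w + B1) * (Ysum w + B2) + (w * Ysum1 w + w\<^sup>2 * Ysum2 w)
        - w * Ysum1 w * (3 * Ysum w + B1 + B2 - of_nat N)"
proof -
  have Q: "reflect_poly P = Qpoly" unfolding P Qpoly_def by (rule reflect_poly_root_prod)
  have "degree P = N" unfolding P by (subst degree_prod_sum_eq) auto
  from arg_cong[OF reflected_euler_equation[OF this rec, unfolded Q], of "\<lambda>p. poly p w"]
  have eq: "w * (- ((Ysum w + A2) * (Ysum w + A1) * (Ysum w + 0) + (w * Ysum1 w + w\<^sup>2 * Ysum2 w)
        - w * Ysum1 w * (3 * Ysum w + A2 + A1 + 0)) * poly Qpoly w)
     = - ((Ysum w + B2) * (Ysum w + B1) * (Ysum w + - of_nat N) + (w * Ysum1 w + w\<^sup>2 * Ysum2 w)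
        - w * Ysum1 w * (3 * Ysum w + B2 + B1 + - of_nat N)) * poly Qpoly w"
    unfolding poly_pCons triple_euler_shift_Qpoly[OF w] by simp
  have cancel: "w * a = b" if "w * (- a * q) = - b * q" "q \<noteq> 0" for a b q :: complex
    using that by simp
  have perm: "(y + A2) * (y + A1) * (y + 0) = y * (y + A1) * (y + A2)"
    "3 * y + A2 + A1 + 0 = 3 * y + A1 + A2"
    "(y + B2) * (y + B1) * (y + - c) = (y - c) * (y + B1) * (y + B2)"
    "3 * y + B2 + B1 + - c = 3 * y + B1 + B2 - c" for y c :: complex
    by simp_all
  show ?thesis using cancel[OF eq poly_Qpoly_nonzero[OF w]] unfolding perm .
qed

end

section \<open>The scaled equation in powers of 1/n\<close>

definition Fcub :: "complex \<Rightarrow> complex \<Rightarrow> complex \<Rightarrow> complex" where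
  "Fcub t w v = (v - 2) * (v + (2 - t)) * (v + t) - w * v ^ 3"

text \<open>\<open>G1\<close> and \<open>G2\<close> are the coefficients of 1/n and 1/n^2 once the
  equation for Y = n V is divided by n^3. The argument d stands for w V', and in \<open>G2\<close>
  the argument e stands for (w d/dw)^2 V = w V' + w^2 V''.\<close>

definition G1 :: "complex \<Rightarrow> complex \<Rightarrow> complex \<Rightarrow> complex \<Rightarrow> complex \<Rightarrow> complex \<Rightarrow> complex" where
  "G1 t a1 a2 w v d = (v - 2) * ((a1 + 1) * (v + t) + (a2 + 1) * (v + (2 - t)))
     - w * (a1 + a2) * v\<^sup>2 - 3 * (1 - w) * v * d"

definition G2 :: "complex \<Rightarrow> complex \<Rightarrow> complex \<Rightarrow> complex \<Rightarrow> complex \<Rightarrow> complex \<Rightarrow> complex" where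
  "G2 a1 a2 w v d e = (1 - w) * e - (a1 + a2 + 2 - w * (a1 + a2)) * d
     + (v - 2) * (a1 + 1) * (a2 + 1) - w * a1 * a2 * v"

text \<open>Everything the perturbation argument has to know about V. The bounds 4, 8, 32 are 2N,
  4N, 16N divided by n, with N = 2n; the value 2 = N/n at w = 0 selects the branch of the
  cubic.\<close>

definition riccati_sol ::
  "complex \<Rightarrow> complex \<Rightarrow> complex \<Rightarrow> nat \<Rightarrow> (complex \<Rightarrow> complex) \<Rightarrow> (complex \<Rightarrow> complex) \<Rightarrow> (complex \<Rightarrow> complex) \<Rightarrow> bool"
where
  "riccati_sol t a1 a2 n V V1 V2 \<longleftrightarrow> V 0 = 2 \<and> (\<forall>w. Re w < 1/2 \<longrightarrow>
     (V has_field_derivative V1 w) (at w) \<and> (V1 has_field_derivative V2 w) (at w) \<and>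
     norm (V w) \<le> 4 \<and> norm (V1 w) \<le> 8 \<and> norm (V2 w) \<le> 32 \<and>
     Fcub t w (V w) + G1 t a1 a2 w (V w) (w * V1 w) / of_nat n
       + G2 a1 a2 w (V w) (w * V1 w) (w * V1 w + w\<^sup>2 * V2 w) / of_nat n ^ 2 = 0)"

text \<open>\<open>Q\<close> is the reversed polynomial w^N P(1/w), equal to 1 at w = 0 because P is
  monic; w Q'/Q = N - Y then reads n (2 - V). The ratio condition gives n1 = (2 - theta) n and n2 =
  theta n, so the equation depends on the multi-index through n alone.\<close>

lemma JP_riccati:
  assumes \<alpha>: "\<alpha>1 > -1" "\<alpha>2 > -1" "\<alpha>1 - \<alpha>2 \<notin> \<int>"
    and n: "n1 + n2 = 2 * n" "n > 0" "real n2 / real (n1 + n2) = \<theta> / 2"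
    and JP: "is_JP_poly \<alpha>1 \<alpha>2 n1 n2 P"
  obtains V V1 V2 Q Q' where "riccati_sol (of_real \<theta>) (of_real \<alpha>1) (of_real \<alpha>2) n V V1 V2"
    "\<And>w. Re w < 1/2 \<Longrightarrow> (Q has_field_derivative Q' w) (at w)"
    "\<And>w. Re w < 1/2 \<Longrightarrow> w * Q' w = of_nat n * (2 - V w) * Q w"
    "\<And>w. Re w < 1/2 \<Longrightarrow> Q w \<noteq> 0" "Q 0 = 1"
    "\<And>z. z \<noteq> 0 \<Longrightarrow> poly P z = z ^ (2 * n) * Q (1 / z)"
proof -
  define t where "t = complex_of_real \<theta>"
  define a1 where "a1 = complex_of_real \<alpha>1"
  define a2 where "a2 = complex_of_real \<alpha>2"
  define N where "N = 2 * n"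
  have n2: "real n2 = \<theta> * real n" using n by (simp add: field_simps)
  have n1: "real n1 = (2 - \<theta>) * real n"
    using arg_cong[OF n(1), of real] n2 by (simp add: algebra_simps)
  have n2c: "of_nat n2 = t * of_nat n" and n1c: "of_nat n1 = (2 - t) * of_nat n"
    using arg_cong[OF n2, of complex_of_real] arg_cong[OF n1, of complex_of_real] by (simp_all add: t_def)
  obtain x where x: "\<And>j. j < N \<Longrightarrow> x j \<in> {0..1}" and P: "P = (\<Prod>j<N. [:- of_real (x j), 1:])"
    and rec: "\<And>k. (of_nat k + 1) * (of_nat k + 1 + a1) * (of_nat k + 1 + a2) * coeff P (Suc k)
      = (of_nat k - of_nat N) * (of_nat k + 1 + a1 + of_nat n1)
        * (of_nat k + 1 + a2 + of_nat n2) * coeff P k"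
    using JP_poly_structure[OF \<alpha> JP] unfolding n(1) N_def a1_def a2_def by metis
  define B1 where "B1 = 1 + a1 + of_nat n1"
  define B2 where "B2 = 1 + a2 + of_nat n2"
  have rec': "(of_nat k + 1) * (of_nat k + 1 + a1) * (of_nat k + 1 + a2) * coeff P (Suc k)
      = (of_nat k - of_nat N) * (of_nat k + B1) * (of_nat k + B2) * coeff P k" for k
    using rec[of k] by (simp add: B1_def B2_def add_ac)
  define c where "c = (of_nat n :: complex)"
  have c: "c \<noteq> 0" using n by (simp add: c_def)
  define Y Y1 Y2 q where "Y = Ysum x N" and "Y1 = Ysum1 x N" and "Y2 = Ysum2 x N" and "q = Qpoly x N"
  define V where "V = (\<lambda>w. Y w / c)"
  define V1 where "V1 = (\<lambda>w. Y1 w / c)"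
  define V2 where "V2 = (\<lambda>w. Y2 w / c)"
  have Y: "Y w = c * V w" "Y1 w = c * V1 w" "Y2 w = c * V2 w" for w
    using c by (auto simp: V_def V1_def V2_def)
  have sol: "riccati_sol t a1 a2 n V V1 V2"
    unfolding riccati_sol_def
  proof (intro conjI allI impI)
    have "Y 0 = 2 * c" by (simp add: Y_def Ysum_def[OF x] N_def c_def)
    then show "V 0 = 2" using c by (simp add: V_def)
    fix w :: complex assume w: "Re w < 1/2"
    show "(V has_field_derivative V1 w) (at w)"
      unfolding V_def V1_def Y_def Y1_def by (intro DERIV_cdivide DERIV_Ysum x w)
    show "(V1 has_field_derivative V2 w) (at w)"
      unfolding V1_def V2_def Y1_def Y2_def by (intro DERIV_cdivide DERIV_Ysum1 x w)
    show "norm (V w) \<le> 4" "norm (V1 w) \<le> 8" "norm (V2 w) \<le> 32"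
      using norm_Ysum_le[of N x w, OF x w] n(2)
      by (simp_all add: V_def V1_def V2_def Y_def Y1_def Y2_def norm_divide c_def N_def field_simps)
    define v v1 v2 where "v = V w" and "v1 = V1 w" and "v2 = V2 w"
    have eq: "w * (c * v * (c * v + a1) * (c * v + a2) + (w * (c * v1) + w\<^sup>2 * (c * v2))
        - w * (c * v1) * (3 * (c * v) + a1 + a2))
     = (c * v - 2 * c) * (c * v + (1 + a1 + (2 - t) * c)) * (c * v + (1 + a2 + t * c))
        + (w * (c * v1) + w\<^sup>2 * (c * v2))
        - w * (c * v1) * (3 * (c * v) + (1 + a1 + (2 - t) * c) + (1 + a2 + t * c) - 2 * c)"
      using Ysum_equation[OF x P rec' w]
      unfolding Y_def[symmetric] Y1_def[symmetric] Y2_def[symmetric] Y B1_def B2_def n1c n2c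
        c_def[symmetric] v_def[symmetric] v1_def[symmetric] v2_def[symmetric]
      by (simp add: N_def c_def)
    have "c ^ 3 * Fcub t w v + c ^ 2 * G1 t a1 a2 w v (w * v1) + c * G2 a1 a2 w v (w * v1) (w * v1 + w\<^sup>2 * v2) = 0"
      using eq unfolding Fcub_def G1_def G2_def
      by (simp add: algebra_simps power2_eq_square power3_eq_cube)
    then have "c ^ 3 * (Fcub t w v + G1 t a1 a2 w v (w * v1) / c + G2 a1 a2 w v (w * v1) (w * v1 + w\<^sup>2 * v2) / c ^ 2) = 0"
      using c by (simp add: field_simps power2_eq_square power3_eq_cube)
    then show "Fcub t w (V w) + G1 t a1 a2 w (V w) (w * V1 w) / of_nat n
       + G2 a1 a2 w (V w) (w * V1 w) (w * V1 w + w\<^sup>2 * V2 w) / of_nat n ^ 2 = 0"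
      using c by (simp add: v_def v1_def v2_def c_def)
  qed
  have q0: "poly q 0 = 1" by (simp add: q_def Qpoly_def[OF x] poly_prod)
  have Pz: "poly P z = z ^ (2 * n) * poly q (1 / z)" if "z \<noteq> 0" for z
  proof -
    have "poly P z = (\<Prod>j<N. z * (1 - of_real (x j) * (1 / z)))"
      unfolding P poly_prod using that by (intro prod.cong) (auto simp: field_simps)
    also have "\<dots> = z ^ (2 * n) * poly q (1 / z)"
      unfolding prod.distrib by (simp add: q_def Qpoly_def[OF x] poly_prod N_def mult.commute)
    finally show ?thesis .
  qed
  show thesis
  proof (rule that[of V V1 V2 "poly q" "poly (pderiv q)"])
    show "w * poly (pderiv q) w = of_nat n * (2 - V w) * poly q w" if "Re w < 1/2" for w
      using pderiv_Qpoly[of N x w, OF x that] Y(1)[of w]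
      by (simp add: q_def Y_def N_def c_def algebra_simps)
    show "poly q w \<noteq> 0" if "Re w < 1/2" for w
      unfolding q_def by (rule poly_Qpoly_nonzero[OF x that])
  qed (use sol q0 Pz in \<open>auto simp: t_def a1_def a2_def poly_DERIV\<close>)
qed

section \<open>Asymptotic solution of the Riccati equation\<close>

lemma bounded_on_polydisc:
  fixes g :: "complex \<Rightarrow> complex \<Rightarrow> complex \<Rightarrow> complex \<Rightarrow> complex"
  assumes "continuous_on UNIV (\<lambda>(a, b, c, d). g a b c d)"
  obtains K where "K > 0"
    "\<And>a b c d. norm a \<le> r \<Longrightarrow> norm b \<le> r \<Longrightarrow> norm c \<le> r \<Longrightarrow> norm d \<le> r \<Longrightarrow> norm (g a b c d) \<le> K"
proof -
  define S where "S = cball (0::complex) r \<times> cball (0::complex) r \<times> cball (0::complex) r \<times> cball (0::complex) r"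
  have "compact S" unfolding S_def by (intro compact_Times compact_cball)
  moreover have "continuous_on S (\<lambda>(a, b, c, d). g a b c d)" using assms continuous_on_subset by blast
  ultimately have "bounded ((\<lambda>(a, b, c, d). g a b c d) ` S)"
    by (intro compact_imp_bounded compact_continuous_image)
  then obtain K where K: "K > 0" "\<forall>y\<in>(\<lambda>(a, b, c, d). g a b c d) ` S. norm y \<le> K"
    unfolding bounded_pos by blast
  show thesis
  proof (rule that[OF K(1)])
    fix a b c d :: complex
    assume "norm a \<le> r" "norm b \<le> r" "norm c \<le> r" "norm d \<le> r"
    then have "(a, b, c, d) \<in> S" by (simp add: S_def)
    from bspec[OF K(2) imageI[OF this]] show "norm (g a b c d) \<le> K" by simp
  qed
qed

text \<open>The values of |h| on S form an interval containing 0, and the gap condition excludes the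
  value \<open>\<epsilon>\<close>; hence they never pass it. This upgrades an estimate valid near a
  branch to all of S.\<close>

lemma gap_connected:
  fixes h :: "complex \<Rightarrow> complex"
  assumes "connected S" "continuous_on S h" "a \<in> S" "h a = 0" "\<epsilon> > 0"
    and gap: "\<And>w. w \<in> S \<Longrightarrow> norm (h w) \<le> \<epsilon> \<Longrightarrow> norm (h w) \<le> \<epsilon> / 2"
    and "w \<in> S"
  shows "norm (h w) \<le> \<epsilon>"
proof (rule ccontr)
  assume "\<not> norm (h w) \<le> \<epsilon>"
  have "connected ((\<lambda>w. norm (h w)) ` S)"
    by (intro connected_continuous_image continuous_intros assms)
  then have "\<epsilon> \<in> (\<lambda>w. norm (h w)) ` S"
    using connected_contains_Icc[of _ "norm (h a)" "norm (h w)"] assms \<open>\<not> norm (h w) \<le> \<epsilon>\<close>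
    by force
  then obtain u where "u \<in> S" "norm (h u) = \<epsilon>" by auto
  then show False using gap[of u] \<open>\<epsilon> > 0\<close> by simp
qed

lemma norm_exp_minus_one_le:
  fixes u :: complex
  assumes "norm u \<le> 1"
  shows "norm (exp u - 1) \<le> exp 1 * norm u"
proof -
  have "norm (exp u - exp 0) \<le> exp 1 * norm (u - 0)"
  proof (rule field_differentiable_bound[of "cball 0 1"])
    fix z :: complex assume "z \<in> cball 0 1"
    then show "norm (exp z) \<le> exp 1"
      using norm_exp[of z] by (metis dist_0_norm exp_le_cancel_iff mem_cball order_trans)
  qed (use assms in \<open>auto intro!: derivative_eq_intros\<close>)
  then show ?thesis by simp
qed

section \<open>Perturbation of a simple root of the cubic\<close>

definition Fv :: "complex \<Rightarrow> complex \<Rightarrow> complex \<Rightarrow> complex" where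
  "Fv t w v = 3 * (1 - w) * v\<^sup>2 - (4 - t * (2 - t))"

text \<open>An exact Taylor expansion. The cubic has no v^2 term: it equals (1 - w) v^3 - (4 - t(2 -
  t)) v - 2t(2 - t), so \<open>Fv\<close> is its v-derivative.\<close>

lemma Fcub_diff:
  "Fcub t w (v + h) - Fcub t w v = h * (Fv t w v + h * (1 - w) * (3 * v + h))"
  unfolding Fcub_def Fv_def by (simp add: algebra_simps power2_eq_square power3_eq_cube)

text \<open>The divided difference of \<open>G1\<close> in its argument v, with increment h.\<close>

definition G1v :: "complex \<Rightarrow> complex \<Rightarrow> complex \<Rightarrow> complex \<Rightarrow> complex \<Rightarrow> complex \<Rightarrow> complex \<Rightarrow> complex" where
  "G1v t a1 a2 w v h d = (a1 + 1) * (2 * v + h + t - 2) + (a2 + 1) * (2 * v + h - t)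
     - w * (a1 + a2) * (2 * v + h) - 3 * (1 - w) * d"

lemma G1_diff:
  "G1 t a1 a2 w (v + h) d - G1 t a1 a2 w v d0 = h * G1v t a1 a2 w v h d - 3 * (1 - w) * v * (d - d0)"
  unfolding G1_def G1v_def by (simp add: algebra_simps power2_eq_square)

lemma continuous_G1: "continuous_on UNIV (\<lambda>(w, v, d, e :: complex). G1 t a1 a2 w v d)"
  unfolding G1_def case_prod_unfold by (intro continuous_intros)

lemma continuous_G2: "continuous_on UNIV (\<lambda>(w, v, d, e). G2 a1 a2 w v d e)"
  unfolding G2_def case_prod_unfold by (intro continuous_intros)

lemma continuous_G1v: "continuous_on UNIV (\<lambda>(w, v, h, d). G1v t a1 a2 w v h d)"
  unfolding G1v_def case_prod_unfold by (intro continuous_intros)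

locale principal_branch =
  fixes t a1 a2 :: complex and v0 v0' :: "complex \<Rightarrow> complex"
  assumes t: "t * (2 - t) \<noteq> 0"
    and deriv_v0: "\<And>w. Re w < 1/2 \<Longrightarrow> (v0 has_field_derivative v0' w) (at w)"
    and F_v0: "\<And>w. Re w < 1/2 \<Longrightarrow> Fcub t w (v0 w) = 0"
    and v0_0: "v0 0 = 2"
begin

text \<open>Solves F_v v1 + G1 = 0, the equation of order 1/n that results from inserting V = v0 +
  v1/n.\<close>

definition v1 :: "complex \<Rightarrow> complex" where
  "v1 w = - G1 t a1 a2 w (v0 w) (w * v0' w) / Fv t w (v0 w)"

lemma v0_nonzero: "Re w < 1/2 \<Longrightarrow> v0 w \<noteq> 0"
  using F_v0[of w] t by (auto simp: Fcub_def algebra_simps)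

text \<open>Differentiating \<open>F(w, v0(w)) = 0\<close>: the branch \<open>v0\<close> never meets another root of the cubic,
  because a double root would have to be \<open>0\<close>.\<close>
lemma Fv_v0':
  assumes w: "Re w < 1/2"
  shows "Fv t w (v0 w) * v0' w = v0 w ^ 3"
proof -
  have op: "open {u. Re u < 1/2}" by (rule open_halfspace_Re_lt)
  have "((\<lambda>u. Fcub t u (v0 u)) has_field_derivative (Fv t w (v0 w) * v0' w - v0 w ^ 3)) (at w)"
    unfolding Fcub_def Fv_def
    by (auto intro!: derivative_eq_intros deriv_v0 w simp: algebra_simps power2_eq_square power3_eq_cube)
  moreover have "((\<lambda>u. Fcub t u (v0 u)) has_field_derivative 0) (at w)"
    by (rule has_field_derivative_transform_within_open[OF DERIV_const[of 0] op])
      (use w F_v0 in auto)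
  ultimately show ?thesis using DERIV_unique by fastforce
qed

lemma Fv_nonzero: "Re w < 1/2 \<Longrightarrow> Fv t w (v0 w) \<noteq> 0"
  using Fv_v0'[of w] v0_nonzero[of w] by auto

lemma holomorphic_v0: "v0 holomorphic_on {w. Re w < 1/2}"
  unfolding holomorphic_on_open[OF open_halfspace_Re_lt] using deriv_v0 by blast

lemma v0'_eq: "Re w < 1/2 \<Longrightarrow> v0' w = v0 w ^ 3 / Fv t w (v0 w)"
  using Fv_v0'[of w] Fv_nonzero[of w] by (simp add: field_simps)

lemma holomorphic_v0': "v0' holomorphic_on {w. Re w < 1/2}"
proof -
  have "(\<lambda>w. v0 w ^ 3 / Fv t w (v0 w)) holomorphic_on {w. Re w < 1/2}"
    using Fv_nonzero unfolding Fv_def by (intro holomorphic_intros holomorphic_v0) auto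
  then show ?thesis by (rule holomorphic_transform) (simp add: v0'_eq)
qed

lemma holomorphic_v1: "v1 holomorphic_on {w. Re w < 1/2}"
  unfolding v1_def[abs_def] G1_def Fv_def
  using Fv_nonzero unfolding Fv_def by (intro holomorphic_intros holomorphic_v0 holomorphic_v0') auto

text \<open>Each term of \<open>G1\<close> carries a factor v0 - 2 or w here. The vanishing makes
  v1/w regular at w = 0, so it can be integrated from there.\<close>

lemma v1_0: "v1 0 = 0"
  by (simp add: v1_def v0_0 G1_def)

text \<open>Compact convex pieces of the half-plane. The abscissas 1/4, 1/8 and 1/16 used below
  leave room for one Cauchy estimate between consecutive ones.\<close>

definition slab :: "real \<Rightarrow> real \<Rightarrow> complex set" where
  "slab s r = {w. Re w \<le> s \<and> norm w \<le> r}"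

lemma compact_slab: "compact (slab s r)"
proof -
  have "slab s r = cball 0 r \<inter> {w. Re w \<le> s}" by (auto simp: slab_def)
  then show ?thesis by (simp add: compact_Int_closed closed_halfspace_Re_le)
qed

lemma convex_slab: "convex (slab s r)"
proof -
  have "slab s r = cball 0 r \<inter> {w. Re w \<le> s}" by (auto simp: slab_def)
  then show ?thesis by (simp add: convex_Int convex_halfspace_Re_le)
qed

lemma cball_subset_slab:
  assumes "w \<in> slab s r"
  shows "cball w \<delta> \<subseteq> slab (s + \<delta>) (r + \<delta>)"
proof
  fix u assume "u \<in> cball w \<delta>"
  then have d: "norm (u - w) \<le> \<delta>" by (simp add: dist_norm norm_minus_commute)
  have "Re u = Re w + Re (u - w)" by simp
  also have "\<dots> \<le> s + \<delta>" using assms d complex_Re_le_cmod[of "u - w"] by (simp add: slab_def)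
  finally have 1: "Re u \<le> s + \<delta>" .
  have "norm u \<le> norm w + norm (u - w)" by (metis add_diff_cancel_left' norm_triangle_ineq diff_add_cancel add.commute)
  then have "norm u \<le> r + \<delta>" using assms d by (simp add: slab_def)
  with 1 show "u \<in> slab (s + \<delta>) (r + \<delta>)" by (simp add: slab_def)
qed

lemma deriv_bound_slab:
  assumes hol: "h holomorphic_on {w. Re w < 1/2}" and w: "w \<in> slab s r" and s: "s + \<delta> < 1/2" "\<delta> > 0"
    and bd: "\<And>u. u \<in> slab (s + \<delta>) (r + \<delta>) \<Longrightarrow> norm (h u) \<le> M"
    and d: "(h has_field_derivative h') (at w)"
  shows "norm h' \<le> M / \<delta>"
proof -
  have sub: "cball w \<delta> \<subseteq> {w. Re w < 1/2}"
    using cball_subset_slab[OF w, of \<delta>] s by (auto simp: slab_def)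
  have "norm ((deriv ^^ 1) h w) \<le> fact 1 * M / \<delta> ^ 1"
  proof (rule Cauchy_inequality)
    show "h holomorphic_on ball w \<delta>"
      using hol sub by (meson ball_subset_cball holomorphic_on_subset order_trans)
    show "continuous_on (cball w \<delta>) h"
      using hol sub holomorphic_on_imp_continuous_on holomorphic_on_subset by blast
    show "norm (h u) \<le> M" if "norm (w - u) = \<delta>" for u
      using bd cball_subset_slab[OF w, of \<delta>] that by (auto simp: dist_norm)
  qed (use s in auto)
  then show ?thesis using DERIV_imp_deriv[OF d] by simp
qed

lemma slab_bounds:
  "\<exists>\<mu>>0. \<exists>M>0. \<forall>w\<in>slab (1/4) r. \<mu> \<le> norm (Fv t w (v0 w)) \<and> norm (v0 w) \<le> M"
proof -
  define S where "S = slab (1/4) r"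
  have S: "Re w < 1/2" if "w \<in> S" for w using that by (auto simp: S_def slab_def)
  have S_sub: "S \<subseteq> {w. Re w < 1/2}" using S by auto
  have cont0: "continuous_on S v0"
    using holomorphic_v0 S_sub holomorphic_on_imp_continuous_on holomorphic_on_subset by blast
  have cpt: "compact S" by (simp add: S_def compact_slab)
  have "compact ((\<lambda>w. Fv t w (v0 w)) ` S)"
    unfolding Fv_def by (intro compact_continuous_image continuous_intros cont0 cpt)
  moreover have "0 \<notin> (\<lambda>w. Fv t w (v0 w)) ` S" using Fv_nonzero S by force
  ultimately have "\<exists>\<mu>>0. \<forall>x\<in>(\<lambda>w. Fv t w (v0 w)) ` S. \<mu> \<le> dist 0 x"
    by (intro separate_point_closed compact_imp_closed)
  then obtain \<mu> where \<mu>: "\<mu> > 0" "\<And>w. w \<in> S \<Longrightarrow> \<mu> \<le> norm (Fv t w (v0 w))"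
    by auto
  have "compact (v0 ` S)" by (intro compact_continuous_image cont0 cpt)
  then obtain M where M: "M > 0" "\<And>w. w \<in> S \<Longrightarrow> norm (v0 w) \<le> M"
    using compact_imp_bounded bounded_pos by (metis image_eqI)
  from \<mu> M show ?thesis unfolding S_def by blast
qed

text \<open>Let h = V - v0. While |h| is at most \<open>\<epsilon>\<close>, the Taylor remainder
  factor is at most half of |F_v|, so F(w,V) = O(1/n) forces |h| <= C/n. For large n this is at most
  \<open>\<epsilon>\<close>/2, and the gap argument started at h(0) = 0 removes the proviso.\<close>

lemma first_order:
  fixes r :: real
  assumes r: "r > 0"
  shows "\<exists>C>0. \<exists>N>0. \<forall>n\<ge>N. \<forall>V V1 V2. riccati_sol t a1 a2 n V V1 V2 \<longrightarrow>
    (\<forall>w\<in>slab (1/4) r. norm (V w - v0 w) \<le> C / real n)"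
proof -
  define S where "S = slab (1/4) r"
  have S: "Re w < 1/2" "norm w \<le> r" if "w \<in> S" for w using that by (auto simp: S_def slab_def)
  have S_sub: "S \<subseteq> {w. Re w < 1/2}" using S by auto
  have cpt: "compact S" and conn: "connected S" and S0: "0 \<in> S"
    using r compact_slab convex_connected[OF convex_slab] by (auto simp: S_def) (simp add: slab_def)
  have cont0: "continuous_on S v0"
    using holomorphic_v0 S_sub holomorphic_on_imp_continuous_on holomorphic_on_subset by blast
  obtain \<mu> M where \<mu>: "\<mu> > 0" "\<And>w. w \<in> S \<Longrightarrow> \<mu> \<le> norm (Fv t w (v0 w))"
    and M: "M > 0" "\<And>w. w \<in> S \<Longrightarrow> norm (v0 w) \<le> M"
    using slab_bounds[of r] unfolding S_def by blast
  \<comment> \<open>One radius dominating all arguments inserted below: w, V, w V', w V' + w^2 V'',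
    v0, and h with |h| at most 1.\<close>
  define \<rho> where "\<rho> = max (max 32 (8 * r)) (max (8 * r + 32 * r\<^sup>2) (max r (max M 1)))"
  have \<rho>: "4 \<le> \<rho>" "8 * r \<le> \<rho>" "8 * r + 32 * r\<^sup>2 \<le> \<rho>" "r \<le> \<rho>" "M \<le> \<rho>" "1 \<le> \<rho>"
    by (auto simp: \<rho>_def)
  obtain K1 where K1: "K1 > 0" and K1': "\<And>w v d e :: complex. norm w \<le> \<rho> \<Longrightarrow> norm v \<le> \<rho> \<Longrightarrow> norm d \<le> \<rho> \<Longrightarrow> norm e \<le> \<rho> \<Longrightarrow> norm (G1 t a1 a2 w v d) \<le> K1"
    using bounded_on_polydisc[OF continuous_G1, of \<rho>] by blast
  obtain K2 where K2: "K2 > 0" "\<And>w v d e. norm w \<le> \<rho> \<Longrightarrow> norm v \<le> \<rho> \<Longrightarrow> norm d \<le> \<rho> \<Longrightarrow> norm e \<le> \<rho> \<Longrightarrow> norm (G2 a1 a2 w v d e) \<le> K2"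
    using bounded_on_polydisc[OF continuous_G2, of \<rho>] by blast
  define c where "c = (1 + \<rho>) * (4 * \<rho>)"
  have c: "c > 0" using \<rho>(1) by (simp add: c_def)
  have c': "norm ((1 - w) * (3 * v + h)) \<le> c" if "norm w \<le> \<rho>" "norm v \<le> \<rho>" "norm h \<le> \<rho>" for w v h :: complex
  proof -
    have "norm (1 - w) \<le> 1 + \<rho>" using norm_triangle_ineq4[of 1 w] that(1) by simp
    moreover have "norm (3 * v + h) \<le> 4 * \<rho>" using norm_triangle_ineq[of "3 * v" h] that by (simp add: norm_mult)
    ultimately show ?thesis
      unfolding c_def norm_mult using \<rho>(1) by (intro mult_mono) auto
  qed
  \<comment> \<open>Keeps the remainder factor, bounded by \<open>\<epsilon> * c\<close>, below half
    of the lower bound \<open>\<mu>\<close> for |F_v|.\<close>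
  define \<epsilon> where "\<epsilon> = min 1 (\<mu> / (2 * c))"
  have \<epsilon>: "\<epsilon> > 0" "\<epsilon> \<le> 1" "\<epsilon> * c \<le> \<mu> / 2"
    using \<mu>(1) c by (auto simp: \<epsilon>_def min_def field_simps)
  define C where "C = 2 * (K1 + K2) / \<mu>"
  have C: "C > 0" using K1 K2 \<mu> by (simp add: C_def)
  \<comment> \<open>From here on C/n is at most \<open>\<epsilon>\<close>/2, as the gap argument
    demands.\<close>
  define N where "N = nat \<lceil>2 * C / \<epsilon>\<rceil> + 1"
  have "norm (V w - v0 w) \<le> C / real n"
    if n: "n \<ge> N" and sol: "riccati_sol t a1 a2 n V V1 V2" and w: "w \<in> S" for n V V1 V2 w
  proof -
    have n1: "real n \<ge> 1" using n by (simp add: N_def)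
    have "2 * C / \<epsilon> \<le> real n" using n by (simp add: N_def) linarith
    then have small: "C / real n \<le> \<epsilon> / 2" using \<epsilon>(1) n1 by (simp add: field_simps)
    have dV: "(V has_field_derivative V1 w) (at w)" if "w \<in> S" for w
      using sol S(1)[OF that] unfolding riccati_sol_def by blast
    have bound: "norm (V w - v0 w) \<le> C / real n" if w: "w \<in> S" and h: "norm (V w - v0 w) \<le> \<epsilon>" for w
    proof -
      define h where "h = V w - v0 w"
      have Vb: "norm (V w) \<le> 4" "norm (V1 w) \<le> 8" "norm (V2 w) \<le> 32"
        and eq: "Fcub t w (V w) + G1 t a1 a2 w (V w) (w * V1 w) / of_nat n
       + G2 a1 a2 w (V w) (w * V1 w) (w * V1 w + w\<^sup>2 * V2 w) / of_nat n ^ 2 = 0"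
        using sol S(1)[OF w] unfolding riccati_sol_def by blast+
      have b1: "norm (w * V1 w) \<le> 8 * r"
        using mult_mono[OF S(2)[OF w] Vb(2)] r by (simp add: norm_mult mult.commute)
      have "norm (w\<^sup>2 * V2 w) \<le> r\<^sup>2 * 32"
        unfolding norm_mult norm_power using S(2)[OF w] Vb(3) by (intro mult_mono power_mono) auto
      then have b2: "norm (w * V1 w + w\<^sup>2 * V2 w) \<le> 8 * r + 32 * r\<^sup>2"
        using b1 norm_triangle_ineq[of "w * V1 w" "w\<^sup>2 * V2 w"] by simp
      have g1: "norm (G1 t a1 a2 w (V w) (w * V1 w)) \<le> K1"
        using S(2)[OF w] Vb b1 \<rho> by (intro K1'[of _ _ _ 0]) auto
      have g2: "norm (G2 a1 a2 w (V w) (w * V1 w) (w * V1 w + w\<^sup>2 * V2 w)) \<le> K2"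
        by (rule K2) (use S(2)[OF w] Vb b1 b2 \<rho> in linarith)+
      have "h * (Fv t w (v0 w) + h * (1 - w) * (3 * v0 w + h)) = Fcub t w (V w)"
        using Fcub_diff[of t w "v0 w" h] F_v0[OF S(1)[OF w]] by (simp add: h_def)
      also have "\<dots> = - (G1 t a1 a2 w (V w) (w * V1 w) / of_nat n
       + G2 a1 a2 w (V w) (w * V1 w) (w * V1 w + w\<^sup>2 * V2 w) / of_nat n ^ 2)"
        using eq by (simp add: add_eq_0_iff2 add.assoc)
      also have "norm \<dots> \<le> K1 / real n + K2 / (real n)\<^sup>2"
        unfolding norm_minus_cancel
        by (rule order.trans[OF norm_triangle_ineq])
          (use g1 g2 in \<open>auto simp: norm_divide norm_power intro!: add_mono divide_right_mono\<close>)
      also have "\<dots> \<le> (K1 + K2) / real n"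
        using n1 K2(1) by (simp add: field_simps power2_eq_square)
      finally have 1: "norm h * norm (Fv t w (v0 w) + h * (1 - w) * (3 * v0 w + h)) \<le> (K1 + K2) / real n"
        by (simp only: norm_mult)
      have "norm ((1 - w) * (3 * v0 w + h)) \<le> c"
        by (rule c') (use S(2)[OF w] M(2)[OF w] h \<epsilon> \<rho> in \<open>auto simp: h_def\<close>)
      then have "norm (h * ((1 - w) * (3 * v0 w + h))) \<le> \<epsilon> * c"
        unfolding norm_mult[of h] using h \<epsilon>(1) by (intro mult_mono) (auto simp: h_def)
      then have "norm (h * (1 - w) * (3 * v0 w + h)) \<le> \<mu> / 2" using \<epsilon>(3) by (simp add: mult.assoc)
      then have "norm (Fv t w (v0 w) + h * (1 - w) * (3 * v0 w + h)) \<ge> \<mu> / 2"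
        using \<mu>(2)[OF w] norm_diff_ineq[of "Fv t w (v0 w)" "h * (1 - w) * (3 * v0 w + h)"] by linarith
      then have "norm h * (\<mu> / 2) \<le> norm h * norm (Fv t w (v0 w) + h * (1 - w) * (3 * v0 w + h))"
        by (intro mult_left_mono) auto
      then have "norm h * (\<mu> / 2) \<le> (K1 + K2) / real n" using 1 by linarith
      then have "norm h \<le> C / real n" using \<mu>(1) n1 by (simp add: C_def field_simps)
      then show ?thesis by (simp add: h_def)
    qed
    have "norm (V w - v0 w) \<le> \<epsilon>"
    proof (rule gap_connected[OF conn _ S0 _ \<epsilon>(1) _ w, of "\<lambda>w. V w - v0 w"])
      have "continuous_on S V"
        by (rule DERIV_continuous_on) (rule has_field_derivative_at_within[OF dV])
      then show "continuous_on S (\<lambda>w. V w - v0 w)" by (intro continuous_intros cont0)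
      show "V 0 - v0 0 = 0" using sol by (simp add: riccati_sol_def v0_0)
      show "norm (V u - v0 u) \<le> \<epsilon> / 2" if "u \<in> S" "norm (V u - v0 u) \<le> \<epsilon>" for u
        using bound[OF that] small by linarith
    qed
    from bound[OF w this] show ?thesis .
  qed
  moreover have "N > 0" by (simp add: N_def)
  ultimately show ?thesis using C unfolding S_def by blast
qed

lemma holomorphic_difference:
  assumes "riccati_sol t a1 a2 n V V1 V2"
  shows "(\<lambda>w. V w - v0 w) holomorphic_on {w. Re w < 1/2}"
proof -
  have "V holomorphic_on {w. Re w < 1/2}"
    unfolding holomorphic_on_open[OF open_halfspace_Re_lt]
    using assms unfolding riccati_sol_def by blast
  then show ?thesis by (intro holomorphic_intros holomorphic_v0)
qed

lemma first_order_deriv: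
  fixes r :: real
  assumes r: "r > 0"
  shows "\<exists>C>0. \<exists>N>0. \<forall>n\<ge>N. \<forall>V V1 V2. riccati_sol t a1 a2 n V V1 V2 \<longrightarrow>
    (\<forall>w\<in>slab (1/8) r. norm (V1 w - v0' w) \<le> C / real n)"
proof -
  obtain C N where C: "C > 0" "N > 0" and bd: "\<And>n V V1 V2 w. n \<ge> N \<Longrightarrow> riccati_sol t a1 a2 n V V1 V2 \<Longrightarrow>
      w \<in> slab (1/4) (r + 1/8) \<Longrightarrow> norm (V w - v0 w) \<le> C / real n"
  proof -
    have "r + 1/8 > 0" using r by simp
    from first_order[OF this] show ?thesis using that by blast
  qed
  have "norm (V1 w - v0' w) \<le> 8 * C / real n"
    if n: "n \<ge> N" and sol: "riccati_sol t a1 a2 n V V1 V2" and w: "w \<in> slab (1/8) r" for n V V1 V2 w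
  proof -
    have w2: "Re w < 1/2" using w by (simp add: slab_def)
    have "norm (V1 w - v0' w) \<le> (C / real n) / (1/8)"
    proof (rule deriv_bound_slab[OF holomorphic_difference[OF sol] w])
      show "norm (V u - v0 u) \<le> C / real n" if "u \<in> slab (1/8 + 1/8) (r + 1/8)" for u
        using bd[OF n sol] that by simp
      show "((\<lambda>w. V w - v0 w) has_field_derivative V1 w - v0' w) (at w)"
        using sol w2 by (auto intro!: derivative_intros deriv_v0 simp: riccati_sol_def)
    qed auto
    then show ?thesis by (simp add: mult.commute)
  qed
  then show ?thesis using C by (intro exI[of _ "8 * C"] conjI exI[of _ N]) auto
qed

text \<open>With h = V - v0, multiplying the equation by n expresses F_v (n h - v1) through terms
  that are each O(1/n): the change of \<open>G1\<close> caused by h and by V' - v0', the term G2/n,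
  and the quadratic remainder n h^2 q.\<close>

lemma second_order:
  fixes r :: real
  assumes r: "r > 0"
  shows "\<exists>C>0. \<exists>N>0. \<forall>n\<ge>N. \<forall>V V1 V2. riccati_sol t a1 a2 n V V1 V2 \<longrightarrow>
    (\<forall>w\<in>slab (1/8) r. norm (of_nat n * (V w - v0 w) - v1 w) \<le> C / real n)"
proof -
  obtain C0 N0 where C0: "C0 > 0" "N0 > 0" and bd0: "\<And>n V V1 V2 w. n \<ge> N0 \<Longrightarrow> riccati_sol t a1 a2 n V V1 V2 \<Longrightarrow>
      w \<in> slab (1/4) r \<Longrightarrow> norm (V w - v0 w) \<le> C0 / real n"
    using first_order[OF r] by blast
  obtain C1 N1 where C1: "C1 > 0" "N1 > 0" and bd1: "\<And>n V V1 V2 w. n \<ge> N1 \<Longrightarrow> riccati_sol t a1 a2 n V V1 V2 \<Longrightarrow>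
      w \<in> slab (1/8) r \<Longrightarrow> norm (V1 w - v0' w) \<le> C1 / real n"
    using first_order_deriv[OF r] by blast
  obtain \<mu> M where \<mu>: "\<mu> > 0" "\<And>w. w \<in> slab (1/4) r \<Longrightarrow> \<mu> \<le> norm (Fv t w (v0 w))"
    and M: "M > 0" "\<And>w. w \<in> slab (1/4) r \<Longrightarrow> norm (v0 w) \<le> M"
    using slab_bounds[of r] by blast
  define \<rho> where "\<rho> = Max {32, 8 * r, 8 * r + 32 * r\<^sup>2, r, M, C0}"
  have \<rho>: "4 \<le> \<rho>" "8 * r \<le> \<rho>" "8 * r + 32 * r\<^sup>2 \<le> \<rho>" "r \<le> \<rho>" "M \<le> \<rho>" "C0 \<le> \<rho>" "0 \<le> \<rho>"
    by (auto simp: \<rho>_def)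
  obtain K2 where K2: "K2 > 0" "\<And>w v d e. norm w \<le> \<rho> \<Longrightarrow> norm v \<le> \<rho> \<Longrightarrow> norm d \<le> \<rho> \<Longrightarrow> norm e \<le> \<rho> \<Longrightarrow> norm (G2 a1 a2 w v d e) \<le> K2"
    using bounded_on_polydisc[OF continuous_G2, of \<rho>] by blast
  obtain K3 where K3: "K3 > 0" "\<And>w v h d. norm w \<le> \<rho> \<Longrightarrow> norm v \<le> \<rho> \<Longrightarrow> norm h \<le> \<rho> \<Longrightarrow> norm d \<le> \<rho> \<Longrightarrow> norm (G1v t a1 a2 w v h d) \<le> K3"
    using bounded_on_polydisc[OF continuous_G1v, of \<rho>] by blast
  define K4 where "K4 = 3 * (1 + \<rho>) * \<rho> * \<rho>"
  have K4: "K4 > 0" using \<rho>(1) by (simp add: K4_def)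
  have K4': "norm (3 * (1 - w) * v * w) \<le> K4" if "norm w \<le> \<rho>" "norm v \<le> \<rho>" for w v :: complex
  proof -
    have "norm (1 - w) \<le> 1 + \<rho>" using norm_triangle_ineq4[of 1 w] that(1) by simp
    then show ?thesis
      unfolding K4_def norm_mult using that \<rho>(1) by (intro mult_mono) auto
  qed
  define c where "c = (1 + \<rho>) * (4 * \<rho>)"
  have c: "c > 0" using \<rho>(1) by (simp add: c_def)
  have c': "norm ((1 - w) * (3 * v + h)) \<le> c" if "norm w \<le> \<rho>" "norm v \<le> \<rho>" "norm h \<le> \<rho>" for w v h :: complex
  proof -
    have "norm (1 - w) \<le> 1 + \<rho>" using norm_triangle_ineq4[of 1 w] that(1) by simp
    moreover have "norm (3 * v + h) \<le> 4 * \<rho>" using norm_triangle_ineq[of "3 * v" h] that by (simp add: norm_mult)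
    ultimately show ?thesis
      unfolding c_def norm_mult using \<rho>(1) by (intro mult_mono) auto
  qed
  define C where "C = (C0 * K3 + K4 * C1 + K2 + C0\<^sup>2 * c) / \<mu>"
  have "norm (of_nat n * (V w - v0 w) - v1 w) \<le> C / real n"
    if n: "n \<ge> max N0 N1" and sol: "riccati_sol t a1 a2 n V V1 V2" and w: "w \<in> slab (1/8) r" for n V V1 V2 w
  proof -
    have n1: "real n \<ge> 1" and n0: "of_nat n \<noteq> (0::complex)" using n C0(2) by auto
    have w': "w \<in> slab (1/4) r" and w2: "Re w < 1/2" and wr: "norm w \<le> r" using w by (auto simp: slab_def)
    define h where "h = V w - v0 w"
    define Fw where "Fw = Fv t w (v0 w)"
    define q where "q = (1 - w) * (3 * v0 w + h)"
    have h: "norm h \<le> C0 / real n" using bd0[OF _ sol w'] n by (simp add: h_def)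
    have "C0 / real n \<le> C0" using n1 C0(1) by (simp add: field_simps)
    then have h\<rho>: "norm h \<le> \<rho>" using h \<rho> by linarith
    have d: "norm (V1 w - v0' w) \<le> C1 / real n" using bd1[OF _ sol w] n by simp
    have Vb: "norm (V w) \<le> 4" "norm (V1 w) \<le> 8" "norm (V2 w) \<le> 32"
      and eq: "Fcub t w (V w) + G1 t a1 a2 w (V w) (w * V1 w) / of_nat n
       + G2 a1 a2 w (V w) (w * V1 w) (w * V1 w + w\<^sup>2 * V2 w) / of_nat n ^ 2 = 0"
      using sol w2 unfolding riccati_sol_def by blast+
    have b1: "norm (w * V1 w) \<le> 8 * r"
      using mult_mono[OF wr Vb(2)] r by (simp add: norm_mult mult.commute)
    have "norm (w\<^sup>2 * V2 w) \<le> r\<^sup>2 * 32"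
      unfolding norm_mult norm_power using wr Vb(3) by (intro mult_mono power_mono) auto
    then have b2: "norm (w * V1 w + w\<^sup>2 * V2 w) \<le> 8 * r + 32 * r\<^sup>2"
      using b1 norm_triangle_ineq[of "w * V1 w" "w\<^sup>2 * V2 w"] by simp
    have v0b: "norm (v0 w) \<le> \<rho>" using M(2)[OF w'] \<rho> by linarith
    have w\<rho>: "norm w \<le> \<rho>" using wr \<rho> by linarith
    define g2 where "g2 = G2 a1 a2 w (V w) (w * V1 w) (w * V1 w + w\<^sup>2 * V2 w)"
    have g2: "norm g2 \<le> K2"
      unfolding g2_def by (rule K2) (use w\<rho> Vb b1 b2 \<rho> in linarith)+
    define gv where "gv = G1v t a1 a2 w (v0 w) h (w * V1 w)"
    have gv: "norm gv \<le> K3"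
      unfolding gv_def by (rule K3) (use w\<rho> v0b h\<rho> b1 \<rho> in linarith)+
    have q: "norm q \<le> c" unfolding q_def by (rule c') (use w\<rho> v0b h\<rho> in auto)
    define k where "k = 3 * (1 - w) * v0 w * w"
    have k: "norm k \<le> K4" unfolding k_def by (rule K4') (use w\<rho> v0b in auto)
    have Fw0: "Fw \<noteq> 0" using Fv_nonzero[OF w2] by (simp add: Fw_def)
    have e1: "Fcub t w (V w) = h * (Fw + h * q)"
      using Fcub_diff[of t w "v0 w" h] F_v0[OF w2] by (simp add: h_def Fw_def q_def mult.assoc)
    have e2: "G1 t a1 a2 w (V w) (w * V1 w) = G1 t a1 a2 w (v0 w) (w * v0' w) + h * gv - k * (V1 w - v0' w)"
      using G1_diff[of t a1 a2 w "v0 w" h "w * V1 w" "w * v0' w"]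
      by (simp add: h_def gv_def k_def algebra_simps)
    have e3: "Fw * v1 w = - G1 t a1 a2 w (v0 w) (w * v0' w)"
      using Fw0 by (simp add: v1_def Fw_def)
    have alg: "Fw * (m * h - x) = - (h * gv - k * y) - g2 / m - m * h\<^sup>2 * q"
      if "h * (Fw + h * q) + (G + h * gv - k * y) / m + g2 / m ^ 2 = 0" "Fw * x = - G" "m \<noteq> 0" for m x y G :: complex
    proof -
      have "m * (A + X / m + g / m ^ 2) = m * A + X + g / m" for A X g :: complex
        using that(3) by (simp add: field_simps power2_eq_square)
      from this[of "h * (Fw + h * q)" "G + h * gv - k * y" g2]
      have "m * (h * (Fw + h * q)) + (G + h * gv - k * y) + g2 / m = 0" using that(1) by simp
      then have "m * h * Fw = - G - (h * gv - k * y) - g2 / m - m * h\<^sup>2 * q"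
        by (simp add: algebra_simps power2_eq_square add_eq_0_iff2 eq_neg_iff_add_eq_0)
      then show ?thesis using that(2) by (simp add: algebra_simps)
    qed
    have "Fw * (of_nat n * h - v1 w) = - (h * gv - k * (V1 w - v0' w)) - g2 / of_nat n - of_nat n * h\<^sup>2 * q"
      by (rule alg[OF _ e3 n0]) (use eq in \<open>simp only: e1 e2 g2_def\<close>)
    also have "norm \<dots> \<le> norm h * norm gv + norm k * norm (V1 w - v0' w) + norm g2 / real n + real n * (norm h)\<^sup>2 * norm q"
    proof -
      have tri: "norm (- (a - b) - c - d) \<le> norm a + norm b + norm c + norm d" for a b c d :: complex
        using norm_triangle_ineq4[of "- (a - b) - c" d] norm_triangle_ineq4[of "- (a - b)" c]
          norm_triangle_ineq4[of a b] norm_minus_cancel[of "a - b"] by linarith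
      show ?thesis
        by (rule order.trans[OF tri]) (simp add: norm_mult norm_divide norm_power)
    qed
    also have "\<dots> \<le> (C0 / real n) * K3 + K4 * (C1 / real n) + K2 / real n + real n * (C0 / real n)\<^sup>2 * c"
      using h gv k d g2 q C0(1) K4 n1
      by (intro add_mono mult_mono divide_right_mono power_mono) (auto intro: order.trans[OF norm_ge_zero])
    also have "\<dots> = (C0 * K3 + K4 * C1 + K2 + C0\<^sup>2 * c) / real n"
      using n1 by (simp add: field_simps power2_eq_square)
    finally have 1: "norm Fw * norm (of_nat n * h - v1 w) \<le> (C0 * K3 + K4 * C1 + K2 + C0\<^sup>2 * c) / real n"
      by (simp only: norm_mult)
    have "\<mu> * norm (of_nat n * h - v1 w) \<le> norm Fw * norm (of_nat n * h - v1 w)"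
      using \<mu>(2)[OF w'] by (intro mult_right_mono) (auto simp: Fw_def)
    with 1 have "\<mu> * norm (of_nat n * h - v1 w) \<le> (C0 * K3 + K4 * C1 + K2 + C0\<^sup>2 * c) / real n" by linarith
    then show ?thesis using \<mu>(1) n1 by (simp add: C_def h_def field_simps)
  qed
  moreover have "C > 0"
    unfolding C_def using C0 C1 K2 K3 K4 c \<mu> by (intro divide_pos_pos add_pos_pos mult_pos_pos) auto
  moreover have "max N0 N1 > 0" using C0 by simp
  ultimately show ?thesis by blast
qed

text \<open>The quotient f of \<open>Q\<close> by exp(n g0 + g1) has a logarithmic derivative k with
  w k = -eta, where eta = n (V - v0) - v1 = O(1/n). As eta(0) = 0, a bound on eta' yields k = O(1/n)
  up to w = 0; integrating from f(0) = 1 gives f = 1 + O(1/n).\<close>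

lemma ratio_asymptotics:
  fixes r :: real
  assumes r: "r > 0"
  defines "T \<equiv> {w. Re w < 1/16 \<and> norm w < r}"
  assumes g0: "\<And>w. w \<in> T \<Longrightarrow> (g0 has_field_derivative g0' w) (at w)" "\<And>w. w \<in> T \<Longrightarrow> w * g0' w = 2 - v0 w" "g0 0 = 0"
    and g1: "\<And>w. w \<in> T \<Longrightarrow> (g1 has_field_derivative g1' w) (at w)" "\<And>w. w \<in> T \<Longrightarrow> w * g1' w = - v1 w" "g1 0 = 0"
  shows "\<exists>C>0. \<exists>N>0. \<forall>n\<ge>N. \<forall>V V1 V2 Q Q'. riccati_sol t a1 a2 n V V1 V2 \<longrightarrow>
    (\<forall>w. Re w < 1/2 \<longrightarrow> (Q has_field_derivative Q' w) (at w) \<and> w * Q' w = of_nat n * (2 - V w) * Q w \<and> Q w \<noteq> 0) \<longrightarrow>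
    Q 0 = 1 \<longrightarrow>
    (\<forall>w\<in>T. \<exists>\<epsilon>. norm \<epsilon> \<le> C / real n \<and> Q w = exp (of_nat n * g0 w + g1 w) * (1 + \<epsilon>))"
proof -
  obtain C N where C: "C > 0" "N > 0" and bd: "\<And>n V V1 V2 w. n \<ge> N \<Longrightarrow> riccati_sol t a1 a2 n V V1 V2 \<Longrightarrow>
      w \<in> slab (1/8) (r + 1/16) \<Longrightarrow> norm (of_nat n * (V w - v0 w) - v1 w) \<le> C / real n"
  proof -
    have "r + 1/16 > 0" using r by simp
    from second_order[OF this] show ?thesis using that by blast
  qed
  have T_eq: "T = ball 0 r \<inter> {w. Re w < 1/16}" by (auto simp: T_def)
  have opT: "open T" unfolding T_eq by (intro open_Int open_ball open_halfspace_Re_lt)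
  have cvT: "convex T" unfolding T_eq by (intro convex_Int convex_ball convex_halfspace_Re_lt)
  have T0: "0 \<in> T" using r by (simp add: T_def)
  have T2: "Re w < 1/2" "norm w < r" "w \<in> slab (1/16) r" if "w \<in> T" for w using that by (auto simp: T_def slab_def)
  \<comment> \<open>Makes the exponent at most 1 in modulus, so that
    \<open>norm_exp_minus_one_le\<close> applies.\<close>
  define M where "M = nat \<lceil>16 * C * r\<rceil>"
  have "\<exists>\<epsilon>. norm \<epsilon> \<le> exp 1 * (16 * C * r) / real n \<and> Q w = exp (of_nat n * g0 w + g1 w) * (1 + \<epsilon>)"
    if n: "n \<ge> max N M" and sol: "riccati_sol t a1 a2 n V V1 V2"
    and Q: "\<forall>w. Re w < 1/2 \<longrightarrow> (Q has_field_derivative Q' w) (at w) \<and> w * Q' w = of_nat n * (2 - V w) * Q w \<and> Q w \<noteq> 0"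
    and Q0: "Q 0 = 1" and w: "w \<in> T" for n V V1 V2 Q Q' w
  proof -
    have n1: "real n \<ge> 1" using n C(2) by auto
    define \<eta> where "\<eta> = (\<lambda>w. of_nat n * (V w - v0 w) - v1 w)"
    have hol_\<eta>: "\<eta> holomorphic_on {w. Re w < 1/2}"
      unfolding \<eta>_def by (intro holomorphic_intros holomorphic_difference[OF sol] holomorphic_v1)
    have \<eta>0: "\<eta> 0 = 0" using sol by (simp add: \<eta>_def v0_0 v1_0 riccati_sol_def)
    have op2: "open {w. Re w < (1/2 :: real)}" by (rule open_halfspace_Re_lt)
    have d\<eta>: "(\<eta> has_field_derivative deriv \<eta> u) (at u)" if "u \<in> T" for u
      using holomorphic_derivI[OF hol_\<eta> op2] T2(1)[OF that] by simp
    have "norm (deriv \<eta> u) \<le> (C / real n) / (1/16)" if "u \<in> T" for u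
    proof (rule deriv_bound_slab[OF hol_\<eta> T2(3)[OF that] _ _ _ d\<eta>[OF that]])
      show "norm (\<eta> x) \<le> C / real n" if "x \<in> slab (1/16 + 1/16) (r + 1/16)" for x
        using bd[OF _ sol, of x] n that by (simp add: \<eta>_def)
    qed auto
    then have "norm (\<eta> u - \<eta> 0) \<le> (C / real n) / (1/16) * norm (u - 0)" if "u \<in> T" for u
      by (intro field_differentiable_bound[OF cvT _ _ that T0])
        (use d\<eta> has_field_derivative_at_within in blast)+
    then have \<eta>_bound: "norm (\<eta> u) \<le> 16 * C / real n * norm u" if "u \<in> T" for u
      using that \<eta>0 by (simp add: mult.commute)
    define f where "f = (\<lambda>w. Q w * exp (- (of_nat n * g0 w + g1 w)))"
    define k where "k = (\<lambda>w. Q' w / Q w - (of_nat n * g0' w + g1' w))"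
    have Q': "(Q has_field_derivative Q' u) (at u)" "u * Q' u = of_nat n * (2 - V u) * Q u" "Q u \<noteq> 0" if "u \<in> T" for u
      using Q T2(1)[OF that] by blast+
    have df: "(f has_field_derivative k u * f u) (at u)" if "u \<in> T" for u
      unfolding f_def k_def using that Q'[OF that]
      by (auto intro!: derivative_eq_intros Q' g0 g1 simp: field_simps)
    have f_nz: "f u \<noteq> 0" if "u \<in> T" for u using Q'(3)[OF that] by (simp add: f_def)
    have hol_f: "f holomorphic_on T" unfolding holomorphic_on_open[OF opT] using df by blast
    have "(\<lambda>u. deriv f u / f u) holomorphic_on T"
      by (intro holomorphic_intros holomorphic_deriv hol_f opT f_nz)
    then have hol_k: "k holomorphic_on T"
      by (rule holomorphic_transform) (use DERIV_imp_deriv[OF df] f_nz in simp)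
    have uk: "u * k u = - \<eta> u" if "u \<in> T" for u
    proof -
      have "u * k u = u * Q' u / Q u - (of_nat n * (u * g0' u) + u * g1' u)"
        by (simp add: k_def algebra_simps)
      moreover have "u * Q' u / Q u = of_nat n * (2 - V u)" using Q'(2,3)[OF that] by simp
      ultimately show ?thesis using g0(2)[OF that] g1(2)[OF that]
        by (simp add: \<eta>_def algebra_simps)
    qed
    have k_bound': "norm (k u) \<le> 16 * C / real n" if "u \<in> T" "u \<noteq> 0" for u
    proof -
      have "norm u * norm (k u) \<le> norm u * (16 * C / real n)"
        using \<eta>_bound[OF that(1)] uk[OF that(1)] by (metis norm_minus_cancel norm_mult mult.commute)
      then show ?thesis by (rule mult_left_le_imp_le) (use that(2) in simp)
    qed
    \<comment> \<open>Dividing by w is impossible at w = 0; the bound passes there by continuity of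
      \<open>k\<close>.\<close>
    have "norm (k 0) \<le> 16 * C / real n"
    proof (rule tendsto_upperbound)
      have "isCont k 0" using hol_k opT T0 by (meson continuous_on_eq_continuous_at holomorphic_on_imp_continuous_on)
      then show "((\<lambda>u. norm (k u)) \<longlongrightarrow> norm (k 0)) (at 0)" by (intro tendsto_norm) (simp add: isCont_def)
      have "eventually (\<lambda>u. u \<in> T) (at 0)" using eventually_at_topological opT T0 by blast
      then show "eventually (\<lambda>u. norm (k u) \<le> 16 * C / real n) (at 0)"
        using eventually_neq_at_within[of 0] by eventually_elim (rule k_bound')
    qed simp
    then have k_bound: "norm (k u) \<le> 16 * C / real n" if "u \<in> T" for u using k_bound' that by blast
    obtain \<kappa> where \<kappa>: "\<And>u. u \<in> T \<Longrightarrow> (\<kappa> has_field_derivative k u) (at u within T)"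
      using holomorphic_convex_primitive'[OF cvT opT hol_k] by blast
    have "norm (\<kappa> w - \<kappa> 0) \<le> 16 * C / real n * norm (w - 0)"
      by (rule field_differentiable_bound[OF cvT \<kappa> k_bound w T0])
    also have "\<dots> \<le> 16 * C / real n * r" using T2(2)[OF w] C n1 by (intro mult_left_mono) auto
    finally have \<kappa>_bound: "norm (\<kappa> w - \<kappa> 0) \<le> 16 * C * r / real n" by simp
    have "16 * C * r \<le> real n" using n by (simp add: M_def)
    then have "16 * C * r / real n \<le> 1" using n1 by simp
    then have \<kappa>1: "norm (\<kappa> w - \<kappa> 0) \<le> 1" using \<kappa>_bound by linarith
    have "\<exists>c. \<forall>u\<in>T. f u * exp (- \<kappa> u) = c"
    proof (rule has_field_derivative_zero_constant[OF cvT])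
      fix u assume u: "u \<in> T"
      show "((\<lambda>u. f u * exp (- \<kappa> u)) has_field_derivative 0) (at u within T)"
        by (auto intro!: derivative_eq_intros \<kappa> u has_field_derivative_at_within[OF df])
    qed
    then have "f w * exp (- \<kappa> w) = f 0 * exp (- \<kappa> 0)" using w T0 by metis
    then have "f w = exp (\<kappa> w - \<kappa> 0)"
      by (simp add: f_def Q0 g0(3) g1(3) exp_minus exp_diff field_simps)
    then have "norm (f w - 1) \<le> exp 1 * norm (\<kappa> w - \<kappa> 0)" using norm_exp_minus_one_le[OF \<kappa>1] by simp
    also have "\<dots> \<le> exp 1 * (16 * C * r / real n)" using \<kappa>_bound by (intro mult_left_mono) auto
    finally have "norm (f w - 1) \<le> exp 1 * (16 * C * r) / real n" by simp
    moreover have "Q w = exp (of_nat n * g0 w + g1 w) * (1 + (f w - 1))"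
      by (simp add: f_def mult.left_commute[of "exp _" "Q w"] exp_minus_inverse del: minus_add_distrib)
    ultimately show ?thesis by blast
  qed
  moreover have "exp 1 * (16 * C * r) > 0" using C r by simp
  moreover have "max N M > 0" using C by simp
  ultimately show ?thesis by blast
qed

end

text \<open>(f w - f 0)/w has a removable singularity at 0, and holomorphic functions on convex open
  sets have primitives.\<close>

lemma primitive_of_quotient:
  assumes "f holomorphic_on S" "open S" "convex S" "0 \<in> S"
  shows "\<exists>g g'. (\<forall>w\<in>S. (g has_field_derivative g' w) (at w) \<and> w * g' w = f w - f 0) \<and> g 0 = (0::complex)"
proof -
  define k where "k = (\<lambda>z. if z = 0 then deriv f 0 else (f z - f 0) / (z - 0))"
  have "k holomorphic_on S" unfolding k_def by (rule pole_lemma_open[OF assms(1,2)])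
  then obtain g where g: "\<And>u. u \<in> S \<Longrightarrow> (g has_field_derivative k u) (at u within S)"
    using holomorphic_convex_primitive'[OF assms(3,2)] by blast
  have "((\<lambda>w. g w - g 0) has_field_derivative k w) (at w) \<and> w * k w = f w - f 0" if "w \<in> S" for w
    using g[OF that] at_within_open[OF that assms(2)] by (auto intro!: derivative_eq_intros simp: k_def)
  then show ?thesis by (intro exI[of _ "\<lambda>w. g w - g 0"] exI[of _ k]) auto
qed

section \<open>The conformal map\<close>

text \<open>Every point of the cut is a limit of points of the slit plane, so a continuous function
  agreeing with f off the cut supplies the limit in \<open>across_neg\<close>.\<close>

lemma across_neg_eq:
  assumes "open D" "continuous_on D M" "\<And>w. w \<in> D \<Longrightarrow> w \<notin> \<real>\<^sub>\<le>\<^sub>0 \<Longrightarrow> f w = M w" "z \<in> D"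
  shows "across_neg f z = M z"
proof (cases "z \<in> \<real>\<^sub>\<le>\<^sub>0")
  case False
  then show ?thesis using assms(3,4) by (simp add: across_neg_def)
next
  case True
  have "z islimpt - \<real>\<^sub>\<le>\<^sub>0"
    unfolding islimpt_approachable
  proof (intro allI impI)
    fix e :: real assume e: "e > 0"
    let ?u = "z + \<i> * of_real (e / 2)"
    have "?u \<in> - \<real>\<^sub>\<le>\<^sub>0" using True e by (auto simp: complex_nonpos_Reals_iff)
    moreover have "?u \<noteq> z" "dist ?u z < e" using e by (auto simp: dist_norm norm_mult)
    ultimately show "\<exists>x'\<in>- \<real>\<^sub>\<le>\<^sub>0. x' \<noteq> z \<and> dist x' z < e" by blast
  qed
  then have nt: "at z within - \<real>\<^sub>\<le>\<^sub>0 \<noteq> bot" by (simp add: trivial_limit_within)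
  have "isCont M z" using assms by (simp add: continuous_on_eq_continuous_at)
  then have "(M \<longlongrightarrow> M z) (at z within - \<real>\<^sub>\<le>\<^sub>0)" unfolding isCont_def by (rule tendsto_within_subset) simp
  moreover have "eventually (\<lambda>w. w \<in> D) (at z within - \<real>\<^sub>\<le>\<^sub>0)"
    using assms(1,4) eventually_at_topological by blast
  then have "eventually (\<lambda>w. M w = f w) (at z within - \<real>\<^sub>\<le>\<^sub>0)"
    using eventually_at_filter[of "\<lambda>w. w \<notin> \<real>\<^sub>\<le>\<^sub>0" z "- \<real>\<^sub>\<le>\<^sub>0"]
    by (auto simp: eventually_at_filter assms(3) elim!: eventually_mono)
  ultimately have "(f \<longlongrightarrow> M z) (at z within - \<real>\<^sub>\<le>\<^sub>0)" by (rule Lim_transform_eventually)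
  then show ?thesis using True nt by (simp add: across_neg_def tendsto_Lim)
qed

text \<open>Both arguments lie in (0, pi), or both in (-pi, 0); their difference stays in (-pi, pi),
  so no multiple of 2 pi i appears.\<close>

lemma Ln_diff_same_half_plane:
  assumes \<sigma>: "\<sigma> * Im a > 0" "\<sigma> * Im b > 0"
  shows "Ln a - Ln b = Ln (a / b)"
proof -
  have ab: "a \<noteq> 0" "b \<noteq> 0" using assms by auto
  have nb: "b \<notin> \<real>\<^sub>\<le>\<^sub>0" using assms by (auto simp: complex_nonpos_Reals_iff)
  have same: "(Im a > 0 \<and> Im b > 0) \<or> (Im a < 0 \<and> Im b < 0)"
    using assms by (auto simp: zero_less_mult_iff)
  have "- pi < Im (Ln a) - Im (Ln b) \<and> Im (Ln a) - Im (Ln b) < pi"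
    using same
  proof
    assume "Im a > 0 \<and> Im b > 0"
    then show ?thesis using Im_Ln_pos_lt[OF ab(1)] Im_Ln_pos_lt[OF ab(2)] by linarith
  next
    assume "Im a < 0 \<and> Im b < 0"
    then have "Im (Ln a) < 0" "Im (Ln b) < 0"
      using Im_Ln_pos_le[OF ab(1)] Im_Ln_pos_le[OF ab(2)] Im_Ln_le_pi ab by (meson not_less)+
    then show ?thesis using mpi_less_Im_Ln[OF ab(1)] mpi_less_Im_Ln[OF ab(2)] by linarith
  qed
  then show ?thesis using Ln_times_simple[of a "inverse b"] Ln_inverse[OF nb] ab
    by (simp add: divide_inverse)
qed

lemma one_of_zero_derivative:
  fixes k :: "complex \<Rightarrow> complex"
  assumes "convex H" "open H" "\<And>w. w \<in> H \<Longrightarrow> (k has_field_derivative 0) (at w)"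
    and "(k \<longlongrightarrow> 1) (at a within H)" "at a within H \<noteq> bot" "w \<in> H"
  shows "k w = 1"
proof -
  have "\<exists>c. \<forall>u\<in>H. k u = c"
    by (rule has_field_derivative_zero_constant[OF assms(1)])
      (use assms(3) has_field_derivative_at_within in blast)
  then obtain c where c: "\<forall>u\<in>H. k u = c" by blast
  have "eventually (\<lambda>u. u \<in> H) (at a within H)" by (simp add: eventually_at_filter)
  then have "eventually (\<lambda>u. k u = c) (at a within H)" by eventually_elim (use c in auto)
  then have "((\<lambda>_. c) \<longlongrightarrow> 1) (at a within H)"
    by (rule Lim_transform_eventually[OF assms(4)])
  then have "c = 1" using assms(5) tendsto_const tendsto_unique by blast
  then show ?thesis using c assms(6) by blast
qed

lemma inverse_notin_cut01:
  assumes "w \<noteq> 0" "Re w < 1"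
  shows "1 / w \<in> - cut01"
proof
  assume "1 / w \<in> cut01"
  then obtain x where x: "1 / w = of_real x" "0 \<le> x" "x \<le> 1" by auto
  have "w = 1 / (1 / w)" by simp
  also have "\<dots> = of_real (1 / x)" unfolding x(1) by simp
  finally have w: "w = of_real (1 / x)" .
  have "x > 0" using x assms(1) by (cases "x = 0") auto
  then have "1 / x \<ge> 1" using x(3) by simp
  then show False using assms(2) unfolding w by simp
qed

section \<open>The map phi_0 in the coordinate w = 1/z\<close>

locale jp_map =
  fixes \<theta> :: real and \<phi> :: "complex \<Rightarrow> complex"
  assumes \<theta>: "0 < \<theta>" "\<theta> < 1" and phi: "is_phi0 \<theta> \<phi>"
begin

abbreviation "t \<equiv> complex_of_real \<theta>"

lemma theta1_complex: "complex_of_real (theta1 \<theta>) = (2 - t) / (4 - t)"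
  and theta2_complex: "complex_of_real (theta2 \<theta>) = t / (2 + t)"
  and c0_complex: "complex_of_real (c0 \<theta>) = 4 / ((2 + t) * (4 - t))"
  by (simp_all add: theta1_def theta2_def c0_def)

lemma t_nonzero: "t \<noteq> 0" "2 - t \<noteq> 0" "4 - t \<noteq> 0" "2 + t \<noteq> 0"
proof -
  have "Re (2 - t) \<noteq> 0" "Re (4 - t) \<noteq> 0" "Re (2 + t) \<noteq> 0" using \<theta> by auto
  then show "t \<noteq> 0" "2 - t \<noteq> 0" "4 - t \<noteq> 0" "2 + t \<noteq> 0" using \<theta> by fastforce+
qed

lemma theta_factors:
  "s - of_real (theta1 \<theta>) = ((4 - t) * s - (2 - t)) / (4 - t)"
  "s - of_real (theta2 \<theta>) = ((2 + t) * s - t) / (2 + t)"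
  using t_nonzero by (simp_all add: theta1_complex theta2_complex field_simps)

lemma c0_pos: "c0 \<theta> > 0"
  using \<theta> by (simp add: c0_def)

text \<open>The value 0 and, by the convention for division by 0, the two poles would give R = 0;
  the value 1 gives R(1) = 1. Neither 0 nor 1 is an admissible z.\<close>

lemma phi_eq:
  assumes z: "z \<in> - cut01"
  shows "\<phi> z \<noteq> 0" "\<phi> z \<noteq> 1" "\<phi> z \<noteq> of_real (theta1 \<theta>)" "\<phi> z \<noteq> of_real (theta2 \<theta>)"
    "of_real (c0 \<theta>) * \<phi> z ^ 3 = z * ((\<phi> z - of_real (theta1 \<theta>)) * (\<phi> z - of_real (theta2 \<theta>)))"
proof -
  have z0: "z \<noteq> 0" "z \<noteq> 1" using z by (auto simp: image_iff)
  have R: "Rmap \<theta> (\<phi> z) = z" using phi z by (simp add: is_phi0_def)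
  show "\<phi> z \<noteq> 0" "\<phi> z \<noteq> of_real (theta1 \<theta>)" "\<phi> z \<noteq> of_real (theta2 \<theta>)"
    using R z0 by (auto simp: Rmap_def)
  then show "of_real (c0 \<theta>) * \<phi> z ^ 3 = z * ((\<phi> z - of_real (theta1 \<theta>)) * (\<phi> z - of_real (theta2 \<theta>)))"
    using R unfolding Rmap_def by (subst (asm) nonzero_divide_eq_eq) simp_all
  have "Rmap \<theta> 1 = 1"
  proof -
    have "4 / (a * b) * 1 ^ 3 / (2 / b * (2 / a)) = 1" if "a \<noteq> 0" "b \<noteq> 0" for a b :: complex
      using that by simp
    moreover have "1 - complex_of_real (theta1 \<theta>) = 2 / (4 - t)" "1 - complex_of_real (theta2 \<theta>) = 2 / (2 + t)"
      unfolding theta_factors by simp_all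
    ultimately show ?thesis using t_nonzero by (simp only: Rmap_def c0_complex)
  qed
  then show "\<phi> z \<noteq> 1" using R z0 by auto
qed

lemma phi_bound: obtains B b where "\<And>z. norm z \<ge> b \<Longrightarrow> norm (\<phi> z - z / of_real (c0 \<theta>)) \<le> B"
proof -
  have "(\<lambda>z. \<phi> z - z / of_real (c0 \<theta>)) \<in> O[at_infinity](\<lambda>_. 1)" using phi by (simp add: is_phi0_def)
  then obtain B where "eventually (\<lambda>z. norm (\<phi> z - z / of_real (c0 \<theta>)) \<le> B) at_infinity"
    by (auto elim!: landau_o.bigE)
  then show thesis using that unfolding eventually_at_infinity by blast
qed

lemma phi_tendsto: "((\<lambda>w. w * \<phi> (1 / w)) \<longlongrightarrow> 1 / of_real (c0 \<theta>)) (at 0)"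
proof -
  obtain B b where B: "\<And>z. norm z \<ge> b \<Longrightarrow> norm (\<phi> z - z / of_real (c0 \<theta>)) \<le> B" by (rule phi_bound) blast
  have "((\<lambda>w. w * \<phi> (1 / w) - 1 / of_real (c0 \<theta>)) \<longlongrightarrow> 0) (at 0)"
  proof (rule tendsto_0_le[where K = B])
    show "((\<lambda>w :: complex. w) \<longlongrightarrow> 0) (at 0)" by (rule tendsto_ident_at)
    define m where "m = max b 1"
    have m: "m > 0" "m \<ge> b" by (auto simp: m_def)
    have "eventually (\<lambda>w :: complex. norm w < 1 / m) (at 0)"
      unfolding eventually_at by (rule exI[of _ "1 / m"]) (use m in auto)
    then show "eventually (\<lambda>w. norm (w * \<phi> (1 / w) - 1 / of_real (c0 \<theta>)) \<le> norm w * B) (at 0)"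
      using eventually_neq_at_within[of 0]
    proof eventually_elim
      case (elim w)
      have "norm (1 / w) \<ge> m" using elim m by (simp add: norm_divide field_simps)
      then have "norm (\<phi> (1 / w) - (1 / w) / of_real (c0 \<theta>)) \<le> B" using m by (intro B) simp
      moreover have "w * \<phi> (1 / w) - 1 / of_real (c0 \<theta>) = w * (\<phi> (1 / w) - (1 / w) / of_real (c0 \<theta>))"
        using elim by (simp add: algebra_simps)
      ultimately show ?case by (simp add: norm_mult mult_left_mono)
    qed
  qed
  then show ?thesis by (simp add: LIM_zero_iff)
qed

text \<open>R has real coefficients, so a real value of phi forces z to be real. Hence Im phi has
  constant sign on each half-plane, read off far out on the imaginary axis from phi(z) = z/c0 +
  O(1). The sign of \<open>\<sigma>\<close> encodes the half-plane.\<close>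

lemma Im_phi:
  assumes z: "\<sigma> * Im z > 0"
  shows "\<sigma> * Im (\<phi> z) > 0"
proof (rule ccontr)
  assume neg: "\<not> \<sigma> * Im (\<phi> z) > 0"
  define H where "H = {z. \<sigma> * Im z > 0}"
  have \<sigma>0: "\<sigma> \<noteq> 0" using z by auto
  have "H = {z. inner (\<i> * of_real \<sigma>) z > 0}" by (auto simp: H_def inner_complex_def)
  then have "convex H" by (simp add: convex_halfspace_gt)
  then have conn: "connected H" by (rule convex_connected)
  have H_cut: "u \<in> - cut01" if "u \<in> H" for u using that by (auto simp: H_def)
  have "continuous_on H \<phi>"
    using phi H_cut unfolding is_phi0_def by (meson holomorphic_on_imp_continuous_on continuous_on_subset subsetI)
  then have "continuous_on H (\<lambda>u. \<sigma> * Im (\<phi> u))" by (intro continuous_intros)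
  then have cI: "connected ((\<lambda>u. \<sigma> * Im (\<phi> u)) ` H)" using conn by (rule connected_continuous_image)
  have nz: "\<sigma> * Im (\<phi> u) \<noteq> 0" if "u \<in> H" for u
  proof
    assume "\<sigma> * Im (\<phi> u) = 0"
    then obtain x where x: "\<phi> u = of_real x" using \<sigma>0 by (metis complex_is_Real_iff Reals_cases mult_eq_0_iff)
    have "u * of_real ((x - theta1 \<theta>) * (x - theta2 \<theta>)) = of_real (c0 \<theta> * x ^ 3)"
      "x \<noteq> theta1 \<theta>" "x \<noteq> theta2 \<theta>"
      using phi_eq(3-5)[OF H_cut[OF that]] unfolding x by auto
    then have "u = of_real (c0 \<theta> * x ^ 3) / of_real ((x - theta1 \<theta>) * (x - theta2 \<theta>))"
      by (metis nonzero_mult_div_cancel_right of_real_eq_0_iff mult_eq_0_iff right_minus_eq)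
    then have "u = of_real (c0 \<theta> * x ^ 3 / ((x - theta1 \<theta>) * (x - theta2 \<theta>)))" by simp
    then have "Im u = 0" by (metis Im_complex_of_real)
    then show False using that by (simp add: H_def)
  qed
  obtain B b where B: "\<And>z. norm z \<ge> b \<Longrightarrow> norm (\<phi> z - z / of_real (c0 \<theta>)) \<le> B" by (rule phi_bound) blast
  \<comment> \<open>Far enough out that |Im (u/c0)| exceeds |B| + 1, while the error term is at most
    |B|.\<close>
  define y where "y = max \<bar>b\<bar> (c0 \<theta> * (\<bar>B\<bar> + 1)) + 1"
  define u where "u = \<i> * of_real (sgn \<sigma> * y)"
  have y: "y > 0" "y \<ge> b" "y > c0 \<theta> * (\<bar>B\<bar> + 1)" by (auto simp: y_def)
  have uH: "u \<in> H" using y \<sigma>0 by (simp add: H_def u_def) (metis abs_sgn mult.assoc mult_pos_pos mult.commute zero_less_abs_iff)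
  have nu: "norm u = y" using y \<sigma>0 by (simp add: u_def norm_mult abs_mult)
  have "\<bar>Im (\<phi> u - u / of_real (c0 \<theta>))\<bar> \<le> \<bar>B\<bar>"
    using B[of u] abs_Im_le_cmod[of "\<phi> u - u / of_real (c0 \<theta>)"] nu y by linarith
  moreover have "Im (u / of_real (c0 \<theta>)) = sgn \<sigma> * (y / c0 \<theta>)" by (simp add: u_def)
  moreover have "y / c0 \<theta> > \<bar>B\<bar> + 1" using y(3) c0_pos by (simp add: field_simps)
  ultimately have pos: "\<sigma> * Im (\<phi> u) > 0"
    using \<sigma>0 by (cases "\<sigma> > 0") (auto simp: sgn_if zero_less_mult_iff)
  have "0 \<in> (\<lambda>u. \<sigma> * Im (\<phi> u)) ` H"
    using connected_contains_Icc[OF cI, of "\<sigma> * Im (\<phi> z)" "\<sigma> * Im (\<phi> u)"] uH z neg pos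
    by (force simp: H_def)
  then show False using nz by force
qed

definition \<psi> :: "complex \<Rightarrow> complex" where
  "\<psi> w = \<phi> (1 / w)"

definition v0 :: "complex \<Rightarrow> complex" where
  "v0 w = (if w = 0 then 2 else 2 * \<psi> w / (\<psi> w - 1))"

lemma psi_eq:
  assumes "w \<noteq> 0" "Re w < 1"
  shows "\<psi> w \<noteq> 0" "\<psi> w \<noteq> 1" "\<psi> w \<noteq> of_real (theta1 \<theta>)" "\<psi> w \<noteq> of_real (theta2 \<theta>)"
    "w * (of_real (c0 \<theta>) * \<psi> w ^ 3) = (\<psi> w - of_real (theta1 \<theta>)) * (\<psi> w - of_real (theta2 \<theta>))"
  using phi_eq[OF inverse_notin_cut01[OF assms]] assms by (auto simp: \<psi>_def)

lemma holomorphic_psi: "\<psi> holomorphic_on {w. Re w < 1} - {0}"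
proof -
  have "(\<phi> \<circ> (\<lambda>w. 1 / w)) holomorphic_on {w. Re w < 1} - {0}"
  proof (rule holomorphic_on_compose_gen[where t = "- cut01"])
    show "\<phi> holomorphic_on - cut01" using phi by (simp add: is_phi0_def)
    show "(\<lambda>w. 1 / w) ` ({w. Re w < 1} - {0}) \<subseteq> - cut01"
      by (rule image_subsetI, rule inverse_notin_cut01) simp_all
    show "(\<lambda>w. 1 / w) holomorphic_on {w. Re w < 1} - {0}"
      by (intro holomorphic_on_divide holomorphic_on_const holomorphic_on_ident) simp
  qed
  then show ?thesis by (simp add: \<psi>_def[abs_def] o_def)
qed

lemma v0_tendsto: "(v0 \<longlongrightarrow> 2) (at 0)"
proof -
  have c: "1 / complex_of_real (c0 \<theta>) \<noteq> 0" using c0_pos by simp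
  have "((\<lambda>w. 2 * (w * \<phi> (1 / w)) / (w * \<phi> (1 / w) - w)) \<longlongrightarrow> 2 * (1 / of_real (c0 \<theta>)) / (1 / of_real (c0 \<theta>) - 0)) (at 0)"
    by (intro tendsto_intros phi_tendsto) (use c in simp)
  then have "((\<lambda>w. 2 * (w * \<phi> (1 / w)) / (w * \<phi> (1 / w) - w)) \<longlongrightarrow> 2) (at 0)" using c0_pos by simp
  moreover have "eventually (\<lambda>w. 2 * (w * \<phi> (1 / w)) / (w * \<phi> (1 / w) - w) = v0 w) (at 0)"
    using eventually_neq_at_within[of 0]
  proof eventually_elim
    case (elim w)
    have "2 * (w * \<phi> (1 / w)) / (w * \<phi> (1 / w) - w) = (w * (2 * \<phi> (1 / w))) / (w * (\<phi> (1 / w) - 1))"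
      by (simp add: algebra_simps)
    then show ?case using elim by (simp add: v0_def \<psi>_def)
  qed
  ultimately show ?thesis by (rule Lim_transform_eventually)
qed

lemma holomorphic_v0: "v0 holomorphic_on {w. Re w < 1/2}"
proof (rule no_isolated_singularity')
  show "(v0 \<longlongrightarrow> v0 z) (at z within {w. Re w < 1/2})" if "z \<in> {0}" for z
    using that v0_tendsto by (auto simp: v0_def intro: tendsto_within_subset)
  have "(\<lambda>w. 2 * \<psi> w / (\<psi> w - 1)) holomorphic_on {w. Re w < 1/2} - {0}"
    by (intro holomorphic_intros holomorphic_on_subset[OF holomorphic_psi]) (auto simp: psi_eq(2))
  then show "v0 holomorphic_on {w. Re w < 1/2} - {0}"
    by (rule holomorphic_transform) (simp add: v0_def)
  show "open {w. Re w < 1/2}" by (rule open_halfspace_Re_lt)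
qed simp

text \<open>For v = 2s/(s - 1) the factors v - 2, v + 2 - theta, v + theta are constant multiples of
  1, s - theta_1, s - theta_2, each divided by s - 1. So the cubic is the equation R(s) = 1/w
  cleared of denominators.\<close>

lemma Fcub_v0:
  assumes "Re w < 1/2"
  shows "Fcub t w (v0 w) = 0"
proof (cases "w = 0")
  case True
  then show ?thesis by (simp add: v0_def Fcub_def)
next
  case False
  define s where "s = \<psi> w"
  have s1: "s - 1 \<noteq> 0" using psi_eq(2)[of w] False assms by (simp add: s_def)
  have "w * (of_real (c0 \<theta>) * s ^ 3) = (s - of_real (theta1 \<theta>)) * (s - of_real (theta2 \<theta>))"
    using psi_eq(5)[of w] False assms by (simp add: s_def)
  then have eq: "4 * w * s ^ 3 = ((4 - t) * s - (2 - t)) * ((2 + t) * s - t)"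
  proof -
    assume "w * (of_real (c0 \<theta>) * s ^ 3) = (s - of_real (theta1 \<theta>)) * (s - of_real (theta2 \<theta>))"
    then have "(4 * w * s ^ 3) / ((2 + t) * (4 - t)) = (((4 - t) * s - (2 - t)) * ((2 + t) * s - t)) / ((2 + t) * (4 - t))"
      unfolding theta_factors c0_complex by (simp add: mult_ac)
    then show ?thesis using t_nonzero by simp
  qed
  have e: "2 * s / (s - 1) - 2 = 2 / (s - 1)"
    "2 * s / (s - 1) + (2 - t) = ((4 - t) * s - (2 - t)) / (s - 1)"
    "2 * s / (s - 1) + t = ((2 + t) * s - t) / (s - 1)"
    using s1 by (simp_all add: field_simps)
  have alg: "2 / d * (A / d) * (B / d) - w * (X / d) ^ 3 = (2 * (A * B) - w * X ^ 3) / d ^ 3" for A B d X :: complex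
    by (simp add: power_divide diff_divide_distrib power3_eq_cube mult_ac)
  have "Fcub t w (v0 w) = (2 * (((4 - t) * s - (2 - t)) * ((2 + t) * s - t)) - w * (2 * s) ^ 3) / (s - 1) ^ 3"
    using False unfolding Fcub_def v0_def s_def[symmetric]
    by (simp only: if_False e alg)
  also have "\<dots> = 0" by (simp add: eq[symmetric] power_mult_distrib)
  finally show ?thesis .
qed

end

section \<open>Logarithmic derivatives as rational functions of the branch\<close>

locale jp_setup = jp_map +
  fixes \<alpha>1 \<alpha>2 :: real and S :: "complex \<Rightarrow> complex"
  assumes sqrtD: "is_sqrtD \<theta> \<phi> S"
begin

abbreviation "a1 \<equiv> complex_of_real \<alpha>1"
abbreviation "a2 \<equiv> complex_of_real \<alpha>2"

sublocale pb: principal_branch t a1 a2 v0 "deriv v0"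
proof
  show "t * (2 - t) \<noteq> 0" using t_nonzero by simp
  show "(v0 has_field_derivative deriv v0 w) (at w)" if "Re w < 1/2" for w
    by (rule holomorphic_derivI[OF holomorphic_v0 open_halfspace_Re_lt]) (use that in simp)
  show "Fcub t w (v0 w) = 0" if "Re w < 1/2" for w by (rule Fcub_v0[OF that])
  show "v0 0 = 2" by (simp add: v0_def)
qed

text \<open>Half of v0 F_v on the branch, and up to a constant factor also the numerator of psi - 3
  theta_1 theta_2. It, or its square, is the common denominator of the logarithmic derivatives
  below.\<close>

definition qq :: "complex \<Rightarrow> complex" where
  "qq w = (4 - t * (2 - t)) * v0 w + 3 * (t * (2 - t))"

context
  fixes w :: complex
  assumes w: "w \<noteq> 0" "Re w < 1/2"
begin

lemma v0_neq_2: "v0 w - 2 \<noteq> 0"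
  using pb.F_v0[OF w(2)] pb.v0_nonzero[OF w(2)] w(1) by (auto simp: Fcub_def)

lemma psi_v0: "\<psi> w = v0 w / (v0 w - 2)"
proof -
  have s1: "\<psi> w - 1 \<noteq> 0" using psi_eq(2)[of w] w by simp
  have e: "v0 w - 2 = 2 / (\<psi> w - 1)" using w s1 by (simp add: v0_def field_simps)
  have "v0 w / (v0 w - 2) = (2 * \<psi> w / (\<psi> w - 1)) / (2 / (\<psi> w - 1))"
    unfolding e using w by (simp add: v0_def)
  also have "\<dots> = \<psi> w" using s1 by simp
  finally show ?thesis by simp
qed

lemma v0_factors_nonzero: "v0 w + (2 - t) \<noteq> 0" "v0 w + t \<noteq> 0"
  using pb.F_v0[OF w(2)] pb.v0_nonzero[OF w(2)] w(1) by (auto simp: Fcub_def)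

lemma w_v0: "w * v0 w ^ 3 = (v0 w - 2) * (v0 w + (2 - t)) * (v0 w + t)"
  using pb.F_v0[OF w(2)] by (simp add: Fcub_def)

lemma Fv_qq: "v0 w * Fv t w (v0 w) = 2 * qq w"
proof -
  have "v0 w * Fv t w (v0 w) = 3 * v0 w ^ 3 - 3 * (w * v0 w ^ 3) - (4 - t * (2 - t)) * v0 w"
    by (simp add: Fv_def algebra_simps power2_eq_square power3_eq_cube)
  also have "\<dots> = 2 * qq w" unfolding w_v0 qq_def by (simp add: algebra_simps power3_eq_cube)
  finally show ?thesis .
qed

lemma qq_nonzero: "qq w \<noteq> 0"
  using Fv_qq pb.Fv_nonzero[OF w(2)] pb.v0_nonzero[OF w(2)] by auto

lemma w_deriv_v0: "w * deriv v0 w = v0 w * ((v0 w - 2) * (v0 w + (2 - t)) * (v0 w + t)) / (2 * qq w)"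
proof -
  have "w * deriv v0 w = v0 w * (w * v0 w ^ 3) / (v0 w * Fv t w (v0 w))"
    using pb.v0'_eq[OF w(2)] pb.v0_nonzero[OF w(2)] by simp
  then show ?thesis unfolding w_v0 Fv_qq .
qed

lemma deriv_psi: "(\<psi> has_field_derivative - 2 * deriv v0 w / (v0 w - 2)\<^sup>2) (at w)"
proof -
  have op: "open ({u. Re u < (1/2::real)} - {0})"
    by (intro open_Diff open_halfspace_Re_lt) auto
  have "((\<lambda>u. v0 u / (v0 u - 2)) has_field_derivative - 2 * deriv v0 w / (v0 w - 2)\<^sup>2) (at w)"
    using v0_neq_2 by (auto intro!: derivative_eq_intros pb.deriv_v0 w simp: field_simps power2_eq_square)
  then show ?thesis
  proof (rule has_field_derivative_transform_within_open[OF _ op])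
    show "v0 u / (v0 u - 2) = \<psi> u" if "u \<in> {u. Re u < 1/2} - {0}" for u
    proof -
      have s1: "\<psi> u - 1 \<noteq> 0" using psi_eq(2)[of u] that by simp
      have e: "v0 u - 2 = 2 / (\<psi> u - 1)" using that s1 by (simp add: v0_def field_simps)
      show ?thesis unfolding e using that s1 by (simp add: v0_def)
    qed
  qed (use w in auto)
qed

text \<open>\<open>D\<close> is the derivative of \<open>\<psi>\<close>. Since psi = v/(v - 2), each
  psi - c is a quotient of linear polynomials in v, and w v0' is rational in v on the cubic. Thus
  every w D/(psi - c) is rational in v alone, and the identities that follow become polynomial
  ones.\<close>

lemma log_derivs:
  defines "v \<equiv> v0 w" and "D \<equiv> - 2 * deriv v0 w / (v0 w - 2)\<^sup>2"
  shows "\<psi> w - of_real (theta1 \<theta>) \<noteq> 0" "\<psi> w - of_real (theta2 \<theta>) \<noteq> 0" "\<psi> w \<noteq> 0" "\<psi> w - 1 \<noteq> 0"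
      "\<psi> w - of_real (3 * theta1 \<theta> * theta2 \<theta>) \<noteq> 0"
    and "w * D / (\<psi> w - of_real (theta1 \<theta>)) = - (4 - t) * v * (v + t) / (2 * qq w)"
    and "w * D / (\<psi> w - of_real (theta2 \<theta>)) = - (2 + t) * v * (v + (2 - t)) / (2 * qq w)"
    and "w * D / \<psi> w = - (v + (2 - t)) * (v + t) / qq w"
    and "w * D / (\<psi> w - 1) = - v * (v + (2 - t)) * (v + t) / (2 * qq w)"
    and "w * D / (\<psi> w - of_real (3 * theta1 \<theta> * theta2 \<theta>))
       = - ((4 - t) * (2 + t)) * v * (v + (2 - t)) * (v + t) / (2 * (qq w)\<^sup>2)"
proof -
  define A where "A = v + (2 - t)"
  define B where "B = v + t"
  define d where "d = v - 2"
  define q where "q = qq w"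
  have nz: "v \<noteq> 0" "d \<noteq> 0" "A \<noteq> 0" "B \<noteq> 0" "q \<noteq> 0"
    using v0_neq_2 v0_factors_nonzero qq_nonzero pb.v0_nonzero[OF w(2)]
    by (auto simp: v_def d_def A_def B_def q_def)
  have psi: "\<psi> w = v / d" using psi_v0 by (simp add: v_def d_def)
  have wD: "w * D = - v * A * B / (d * q)"
  proof -
    have "w * D = - 2 * (w * deriv v0 w) / d\<^sup>2" by (simp add: D_def d_def v_def)
    also have "\<dots> = - v * A * B / (d * q)"
      unfolding w_deriv_v0 v_def[symmetric] A_def[symmetric] B_def[symmetric] d_def[symmetric] q_def[symmetric]
      using nz by (simp add: field_simps power2_eq_square)
    finally show ?thesis .
  qed
  have 1: "\<psi> w - of_real (theta1 \<theta>) = 2 * A / ((4 - t) * d)"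
  proof -
    have "\<psi> w - of_real (theta1 \<theta>) = ((4 - t) * v - (2 - t) * d) / ((4 - t) * d)"
      unfolding psi theta1_complex using nz t_nonzero by (simp add: diff_frac_eq mult.commute)
    also have "(4 - t) * v - (2 - t) * d = 2 * A" by (simp add: A_def d_def algebra_simps)
    finally show ?thesis .
  qed
  have 2: "\<psi> w - of_real (theta2 \<theta>) = 2 * B / ((2 + t) * d)"
  proof -
    have "\<psi> w - of_real (theta2 \<theta>) = ((2 + t) * v - t * d) / ((2 + t) * d)"
      unfolding psi theta2_complex using nz t_nonzero by (simp add: diff_frac_eq mult.commute)
    also have "(2 + t) * v - t * d = 2 * B" by (simp add: B_def d_def algebra_simps)
    finally show ?thesis .
  qed
  have 4: "\<psi> w - 1 = 2 / d" unfolding psi using nz by (simp add: field_simps) (simp add: d_def)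
  have 5: "\<psi> w - of_real (3 * theta1 \<theta> * theta2 \<theta>) = 2 * q / (((4 - t) * (2 + t)) * d)"
  proof -
    have "complex_of_real (3 * theta1 \<theta> * theta2 \<theta>) = 3 * ((2 - t) * t) / ((4 - t) * (2 + t))"
      by (simp add: theta1_complex theta2_complex)
    then have "\<psi> w - of_real (3 * theta1 \<theta> * theta2 \<theta>)
      = (((4 - t) * (2 + t)) * v - 3 * ((2 - t) * t) * d) / (((4 - t) * (2 + t)) * d)"
      unfolding psi using nz t_nonzero by (simp add: diff_frac_eq mult.commute)
    also have "((4 - t) * (2 + t)) * v - 3 * ((2 - t) * t) * d = 2 * q"
      by (simp add: q_def qq_def d_def v_def[symmetric] algebra_simps)
    finally show ?thesis .
  qed
  show "\<psi> w - of_real (theta1 \<theta>) \<noteq> 0" unfolding 1 using nz t_nonzero by simp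
  show "\<psi> w - of_real (theta2 \<theta>) \<noteq> 0" unfolding 2 using nz t_nonzero by simp
  show "\<psi> w \<noteq> 0" unfolding psi using nz by simp
  show "\<psi> w - 1 \<noteq> 0" unfolding 4 using nz by simp
  show "\<psi> w - of_real (3 * theta1 \<theta> * theta2 \<theta>) \<noteq> 0" unfolding 5 using nz t_nonzero by simp
  show "w * D / (\<psi> w - of_real (theta1 \<theta>)) = - (4 - t) * v * (v + t) / (2 * qq w)"
  proof -
    have "- v * A * B / (d * q) / (2 * A / (u * d)) = - u * v * B / (2 * q)" if "u \<noteq> 0" for u
      using nz that by (simp add: mult_ac)
    then show ?thesis unfolding 1 wD q_def[symmetric] B_def[symmetric] using t_nonzero(3) .
  qed
  show "w * D / (\<psi> w - of_real (theta2 \<theta>)) = - (2 + t) * v * (v + (2 - t)) / (2 * qq w)"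
  proof -
    have "- v * A * B / (d * q) / (2 * B / (u * d)) = - u * v * A / (2 * q)" if "u \<noteq> 0" for u
      using nz that by (simp add: mult_ac)
    then show ?thesis unfolding 2 wD q_def[symmetric] A_def[symmetric] using t_nonzero(4) .
  qed
  show "w * D / \<psi> w = - (v + (2 - t)) * (v + t) / qq w"
    unfolding psi wD q_def[symmetric] A_def[symmetric] B_def[symmetric] using nz by simp
  show "w * D / (\<psi> w - 1) = - v * (v + (2 - t)) * (v + t) / (2 * qq w)"
    unfolding 4 wD q_def[symmetric] A_def[symmetric] B_def[symmetric] using nz by simp
  show "w * D / (\<psi> w - of_real (3 * theta1 \<theta> * theta2 \<theta>))
       = - ((4 - t) * (2 + t)) * v * (v + (2 - t)) * (v + t) / (2 * (qq w)\<^sup>2)"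
  proof -
    have "- v * A * B / (d * q) / (2 * q / (u * d)) = - u * v * A * B / (2 * q\<^sup>2)" if "u \<noteq> 0" for u
      using nz that by (simp add: power2_eq_square mult_ac)
    moreover have "(4 - t) * (2 + t) \<noteq> 0" using t_nonzero by simp
    ultimately show ?thesis unfolding 5 wD q_def[symmetric] A_def[symmetric] B_def[symmetric] by blast
  qed
qed

text \<open>The left side is w d/dw of H_0(1/w). Together with the contribution 2 of a factor w^2 it
  matches w g0' = 2 - v0.\<close>

lemma exponent_identity:
  defines "D \<equiv> - 2 * deriv v0 w / (v0 w - 2)\<^sup>2"
  shows "(2 - t) * (w * D / (\<psi> w - of_real (theta1 \<theta>))) + t * (w * D / (\<psi> w - of_real (theta2 \<theta>))) = - v0 w"
proof -
  define v where "v = v0 w"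
  have "(2 - t) * (w * D / (\<psi> w - of_real (theta1 \<theta>))) + t * (w * D / (\<psi> w - of_real (theta2 \<theta>)))
      = (2 - t) * (- (4 - t) * v * (v + t) / (2 * qq w)) + t * (- (2 + t) * v * (v + (2 - t)) / (2 * qq w))"
    unfolding D_def log_derivs v_def ..
  also have "\<dots> = - v * ((2 - t) * (4 - t) * (v + t) + t * (2 + t) * (v + (2 - t))) / (2 * qq w)"
    by (simp add: add_divide_distrib diff_divide_distrib algebra_simps)
  also have "(2 - t) * (4 - t) * (v + t) + t * (2 + t) * (v + (2 - t)) = 2 * qq w"
    by (simp add: qq_def v_def[symmetric] algebra_simps)
  finally show ?thesis using qq_nonzero by (simp add: v_def)
qed

text \<open>The left side is w d/dw of the logarithm of the non-exponential factor: the lone a1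
  comes from z^(-alpha_1) = w^(alpha_1), the halved bracket from the square root. This is the link
  between the correction \<open>v1\<close> of the differential equation and the closed
  formula.\<close>

lemma prefactor_identity:
  defines "D \<equiv> - 2 * deriv v0 w / (v0 w - 2)\<^sup>2"
  shows "w * D / (\<psi> w - of_real (theta1 \<theta>)) + (a2 - a1 + 1) * (w * D / (\<psi> w - of_real (theta2 \<theta>)))
     + (2 * a1 - a2) * (w * D / \<psi> w) + a1
     - (2 * (w * D / \<psi> w) + w * D / (\<psi> w - 1) + w * D / (\<psi> w - of_real (3 * theta1 \<theta> * theta2 \<theta>))) / 2
     = - pb.v1 w"
proof -
  define v where "v = v0 w"
  define q where "q = qq w"
  define A where "A = v + (2 - t)"
  define B where "B = v + t"
  define d where "d = v - 2"
  have v0: "v \<noteq> 0" using pb.v0_nonzero[OF w(2)] by (simp add: v_def)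
  have q0: "q \<noteq> 0" using qq_nonzero by (simp add: q_def)
  have q: "q = (4 - t * (2 - t)) * v + 3 * (t * (2 - t))" by (simp add: q_def qq_def v_def)
  have wv: "w * v ^ 3 = d * A * B" using w_v0 by (simp add: v_def A_def B_def d_def)
  have wv2: "w * v\<^sup>2 = d * A * B / v"
    using wv v0 by (simp add: field_simps power2_eq_square power3_eq_cube)
  have one_w: "(1 - w) * v * v = ((4 - t * (2 - t)) * v + 2 * (t * (2 - t))) / v"
  proof -
    have "(1 - w) * v ^ 3 = v ^ 3 - d * A * B" by (simp add: algebra_simps wv)
    also have "\<dots> = (4 - t * (2 - t)) * v + 2 * (t * (2 - t))"
      by (simp add: A_def B_def d_def algebra_simps power3_eq_cube)
    finally show ?thesis using v0 by (simp add: field_simps power3_eq_cube)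
  qed
  have wD: "w * deriv v0 w = v * (d * A * B) / (2 * q)"
    using w_deriv_v0 by (simp add: v_def A_def B_def d_def q_def)
  have Fvq: "Fv t w v = 2 * q / v" using Fv_qq v0 by (simp add: v_def q_def field_simps)
  have "G1 t a1 a2 w v (w * deriv v0 w) = d * ((a1 + 1) * B + (a2 + 1) * A) - (a1 + a2) * (w * v\<^sup>2)
      - 3 * ((1 - w) * v * v) * (d * A * B) / (2 * q)"
    unfolding G1_def wD by (simp add: A_def B_def d_def mult_ac)
  then have g: "G1 t a1 a2 w v (w * deriv v0 w) = d * ((a1 + 1) * B + (a2 + 1) * A) - (a1 + a2) * (d * A * B / v)
      - 3 * (((4 - t * (2 - t)) * v + 2 * (t * (2 - t))) / v) * (d * A * B) / (2 * q)"
    unfolding wv2 one_w .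
  have "- pb.v1 w = G1 t a1 a2 w v (w * deriv v0 w) * v / (2 * q)"
    unfolding pb.v1_def Fvq v_def[symmetric] using v0 by simp
  then have rhs: "- pb.v1 w * (4 * q\<^sup>2) = 2 * q * (d * ((a1 + 1) * B + (a2 + 1) * A) * v - (a1 + a2) * (d * A * B))
      - 3 * ((4 - t * (2 - t)) * v + 2 * (t * (2 - t))) * (d * A * B)"
  proof -
    have "(X - Y * (c / v) - 3 * (r / v) * c / (2 * q)) * v / (2 * q) * (4 * q\<^sup>2)
        = 2 * q * (X * v - Y * c) - 3 * r * c" for X Y c r :: complex
      using v0 q0 by (simp add: field_simps power2_eq_square)
    moreover assume "- pb.v1 w = G1 t a1 a2 w v (w * deriv v0 w) * v / (2 * q)"
    ultimately show ?thesis unfolding g by (simp only:)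
  qed
  define L where "L = - (4 - t) * v * B / (2 * q) + (a2 - a1 + 1) * (- (2 + t) * v * A / (2 * q))
     + (2 * a1 - a2) * (- A * B / q) + a1
     - (2 * (- A * B / q) + - v * A * B / (2 * q) + - ((4 - t) * (2 + t)) * v * A * B / (2 * q\<^sup>2)) / 2"
  have lhs: "L * (4 * q\<^sup>2) = - 2 * (4 - t) * v * B * q - 2 * (a2 - a1 + 1) * (2 + t) * v * A * q
     - 4 * (2 * a1 - a2) * A * B * q + 4 * a1 * q\<^sup>2 + 4 * A * B * q + v * A * B * q + ((4 - t) * (2 + t)) * v * A * B"
    unfolding L_def using q0 by (simp add: field_simps power2_eq_square)
  \<comment> \<open>Both sides are affine in a1 and a2. After multiplication by 4 q^2 their
    coefficients are compared separately: \<open>c1\<close> for a1 and \<open>c2\<close> for a2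
    (each divided by 2q), \<open>c3\<close> for the rest.\<close>
  have c1: "(2 + t) * v * A - 4 * A * B + 2 * q = d * B * v - d * A * B"
    unfolding q A_def B_def d_def by (simp add: algebra_simps)
  have c2: "2 * A * B - (2 + t) * v * A = d * A * v - d * A * B"
    unfolding A_def B_def d_def by (simp add: algebra_simps)
  have c3: "q * (- 2 * (4 - t) * v * B - 2 * (2 + t) * v * A + 4 * A * B + v * A * B) + ((4 - t) * (2 + t)) * v * A * B
      = 2 * q * d * (A + B) * v - 3 * ((4 - t * (2 - t)) * v + 2 * (t * (2 - t))) * (d * A * B)"
    unfolding q A_def B_def d_def by (simp add: algebra_simps)
  have "L * (4 * q\<^sup>2) = 2 * q * (a1 * ((2 + t) * v * A - 4 * A * B + 2 * q) + a2 * (2 * A * B - (2 + t) * v * A))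
     + (q * (- 2 * (4 - t) * v * B - 2 * (2 + t) * v * A + 4 * A * B + v * A * B) + ((4 - t) * (2 + t)) * v * A * B)"
    unfolding lhs by (simp add: algebra_simps power2_eq_square)
  also have "\<dots> = - pb.v1 w * (4 * q\<^sup>2)"
  proof -
    have "2 * q * (a1 * (d * B * v - X) + a2 * (d * A * v - X)) + (2 * q * d * (A + B) * v - 3 * Z * X)
      = 2 * q * (d * ((a1 + 1) * B + (a2 + 1) * A) * v - (a1 + a2) * X) - 3 * Z * X" for X Z
      by (simp add: algebra_simps)
    then show ?thesis unfolding c1 c2 c3 rhs .
  qed
  finally have "L * (4 * q\<^sup>2) = - pb.v1 w * (4 * q\<^sup>2)" .
  moreover have "4 * q\<^sup>2 \<noteq> 0" using q0 by simp
  ultimately have "L = - pb.v1 w" by (metis mult_right_cancel)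
  then show ?thesis
    unfolding D_def log_derivs L_def v_def q_def A_def B_def .
qed

end

end

section \<open>Identification of the branches\<close>

lemma DERIV_quotient_exp_zero:
  fixes f g :: "complex \<Rightarrow> complex"
  assumes f: "(f has_field_derivative f') (at w)" and g: "(g has_field_derivative g') (at w)"
    and "w \<noteq> 0" "w * f' = (w * g') * f w"
  shows "((\<lambda>u. f u * exp (- g u)) has_field_derivative 0) (at w)"
proof -
  have "w * (f' - f w * g') = 0" using assms(4) by (simp add: algebra_simps)
  then have e: "f' - f w * g' = 0" using assms(3) by simp
  have "((\<lambda>u. f u * exp (- g u)) has_field_derivative (f' - f w * g') * exp (- g w)) (at w)"
    by (auto intro!: derivative_eq_intros f g simp: algebra_simps)
  then show ?thesis unfolding e by simp
qed

lemma Im_inverse_pos: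
  assumes "\<sigma> * Im w < 0"
  shows "\<sigma> * Im (1 / w) > 0"
proof -
  have "w \<noteq> 0" using assms by auto
  then have "(Re w)\<^sup>2 + (Im w)\<^sup>2 > 0" by (auto simp: complex_eq_iff sum_power2_gt_zero_iff)
  with assms have "\<sigma> * Im w / ((Re w)\<^sup>2 + (Im w)\<^sup>2) < 0" by (rule divide_neg_pos)
  then show ?thesis by (simp add: Im_divide)
qed

context jp_map
begin

text \<open>psi - c and 1/w lie in the same half-plane. The splitting separates the singular Ln
  (1/w) from a part that converges at w = 0.\<close>

lemma Ln_psi_minus:
  assumes w: "\<sigma> * Im w < 0"
  shows "Ln (\<psi> w - of_real c) = Ln ((\<psi> w - of_real c) * w) + Ln (1 / w)"
proof -
  have "\<sigma> * Im (\<psi> w - of_real c) > 0" using Im_phi[OF Im_inverse_pos[OF w]] by (simp add: \<psi>_def)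
  then have "Ln (\<psi> w - of_real c) - Ln (1 / w) = Ln ((\<psi> w - of_real c) / (1 / w))"
    by (rule Ln_diff_same_half_plane[OF _ Im_inverse_pos[OF w]])
  then show ?thesis by (simp add: algebra_simps)
qed

lemma psi_not_nonpos:
  assumes w: "\<sigma> * Im w < 0"
  shows "\<psi> w - of_real c \<notin> \<real>\<^sub>\<le>\<^sub>0"
  using Im_phi[OF Im_inverse_pos[OF w]] by (auto simp: \<psi>_def complex_nonpos_Reals_iff)

lemma psi_minus_tendsto: "((\<lambda>w. (\<psi> w - of_real c) * w) \<longlongrightarrow> of_real (1 / c0 \<theta>)) (at 0)"
proof -
  have "((\<lambda>w. w * \<phi> (1 / w) - of_real c * w) \<longlongrightarrow> 1 / of_real (c0 \<theta>) - of_real c * 0) (at 0)"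
    by (intro tendsto_intros phi_tendsto)
  then show ?thesis by (simp add: \<psi>_def algebra_simps)
qed

lemma Ln_psi_tendsto: "((\<lambda>w. Ln ((\<psi> w - of_real c) * w)) \<longlongrightarrow> of_real (- ln (c0 \<theta>))) (at 0)"
proof -
  have "isCont Ln (complex_of_real (1 / c0 \<theta>))"
    using c0_pos by (intro continuous_at_Ln) (simp add: complex_nonpos_Reals_iff)
  from isCont_tendsto_compose[OF this psi_minus_tendsto]
  have "((\<lambda>w. Ln ((\<psi> w - of_real c) * w)) \<longlongrightarrow> Ln (of_real (1 / c0 \<theta>))) (at 0)" .
  also have "Ln (complex_of_real (1 / c0 \<theta>)) = of_real (- ln (c0 \<theta>))"
    using c0_pos by (subst Ln_of_real) (simp_all add: ln_div)
  finally show ?thesis .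
qed

end

locale jp_half = jp_setup +
  fixes r \<sigma> :: real
  assumes r: "r > 0" and \<sigma>: "\<sigma> \<noteq> 0"
begin

text \<open>Inversion exchanges the half-planes, so z = 1/w satisfies sigma Im z > 0 here, and
  neither z nor psi - c for real c meets the cut of Ln.\<close>

definition H :: "complex set" where
  "H = {w. Re w < 1/16 \<and> norm w < r \<and> \<sigma> * Im w < 0}"

lemma H_eq: "H = {w. Re w < 1/16} \<inter> ball 0 r \<inter> {w. inner (\<i> * of_real \<sigma>) w < 0}"
  by (auto simp: H_def inner_complex_def)

lemma open_H: "open H"
  unfolding H_eq by (intro open_Int open_ball open_halfspace_Re_lt open_halfspace_lt)

lemma convex_H: "convex H"
  unfolding H_eq by (intro convex_Int convex_ball convex_halfspace_Re_lt convex_halfspace_lt)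

lemma H_D: "w \<noteq> 0" "Re w < 1/2" "Re w < 1" "\<sigma> * Im w < 0" if "w \<in> H"
  using that by (auto simp: H_def)

lemma at_0_within_H: "at 0 within H \<noteq> bot"
proof -
  have "0 islimpt H"
    unfolding islimpt_approachable
  proof (intro allI impI)
    fix e :: real assume e: "e > 0"
    define y where "y = min e r / 2"
    have y: "y > 0" "y < e" "y < r" using e r by (auto simp: y_def)
    let ?u = "- \<i> * of_real (sgn \<sigma> * y)"
    have "\<sigma> * sgn \<sigma> * y > 0" using y \<sigma> by (auto simp: sgn_if mult_neg_pos)
    then have "?u \<in> H" using y \<sigma> by (auto simp: H_def norm_mult abs_mult mult.assoc)
    moreover have "?u \<noteq> 0" using y \<sigma> by (auto simp: sgn_if)
    moreover have "dist ?u 0 < e" using y \<sigma> by (auto simp: norm_mult abs_mult sgn_if)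
    ultimately show "\<exists>x'\<in>H. x' \<noteq> 0 \<and> dist x' 0 < e" by blast
  qed
  then show ?thesis by (simp add: trivial_limit_within)
qed

text \<open>Equal logarithmic derivatives make f exp(-g) constant. The constant is found at the
  boundary point 0, where g is differentiable but f is known only through its limit from H.\<close>

lemma eq_exp_on_H:
  assumes "\<And>w. w \<in> H \<Longrightarrow> (f has_field_derivative f' w) (at w)"
    and "\<And>w. w \<in> H \<Longrightarrow> (g has_field_derivative g' w) (at w)"
    and "\<And>w. w \<in> H \<Longrightarrow> w * f' w = (w * g' w) * f w"
    and "(f \<longlongrightarrow> 1) (at 0 within H)" "(g has_field_derivative g0) (at 0)" "g 0 = 0"
    and "w \<in> H"
  shows "f w = exp (g w)"
proof -
  have "((\<lambda>u. exp (- g u)) \<longlongrightarrow> exp (- g 0)) (at 0 within H)"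
  proof (rule tendsto_within_subset)
    have "isCont g 0" using assms(5) by (rule DERIV_isCont)
    then show "((\<lambda>u. exp (- g u)) \<longlongrightarrow> exp (- g 0)) (at 0)" unfolding isCont_def by (intro tendsto_intros)
  qed simp
  from tendsto_mult[OF assms(4) this]
  have lim: "((\<lambda>u. f u * exp (- g u)) \<longlongrightarrow> 1) (at 0 within H)" by (simp add: assms(6))
  have "f w * exp (- g w) = 1"
    by (rule one_of_zero_derivative[OF convex_H open_H _ lim at_0_within_H assms(7)])
      (rule DERIV_quotient_exp_zero[OF assms(1,2) H_D(1) assms(3)])
  then show ?thesis by (simp add: exp_minus field_simps)
qed

definition D :: "complex \<Rightarrow> complex" where
  "D w = - 2 * deriv v0 w / (v0 w - 2)\<^sup>2"

lemma DERIV_psi: "w \<in> H \<Longrightarrow> (\<psi> has_field_derivative D w) (at w)"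
  unfolding D_def using deriv_psi H_D by blast

lemma DERIV_Ln_psi:
  assumes "w \<in> H"
  shows "((\<lambda>w. Ln (\<psi> w - of_real c)) has_field_derivative D w / (\<psi> w - of_real c)) (at w)"
  using psi_not_nonpos[OF H_D(4)[OF assms], of c]
  by (auto intro!: derivative_eq_intros DERIV_psi assms simp: field_simps)

text \<open>The constant C_0 is fixed by the limit at w = 0: the two logarithms contribute c0^(-2),
  and C - C_0 = 2 ln c0 cancels it.\<close>

lemma exp_H0tilde:
  assumes g: "\<And>w. w \<in> H \<Longrightarrow> (g has_field_derivative g' w) (at w)" "\<And>w. w \<in> H \<Longrightarrow> w * g' w = 2 - v0 w"
    "(g has_field_derivative g0') (at 0)" "g 0 = 0" and w: "w \<in> H"
  shows "exp (H0tilde \<theta> \<phi> (1 / w)) * w\<^sup>2 = exp (g w)"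
proof -
  define k where "k = complex_of_real (Cconst \<theta> - C0const \<theta>)"
  define E where "E = (\<lambda>w. (2 - t) * Ln (\<psi> w - of_real (theta1 \<theta>)) + t * Ln (\<psi> w - of_real (theta2 \<theta>)) + k)"
  define E' where "E' = (\<lambda>w. (2 - t) * (D w / (\<psi> w - of_real (theta1 \<theta>))) + t * (D w / (\<psi> w - of_real (theta2 \<theta>))))"
  have k: "k = of_real (2 * ln (c0 \<theta>))"
    using c0_pos by (simp add: k_def C0const_def ln_div)
  have E: "H0tilde \<theta> \<phi> (1 / w) = E w" for w
    by (simp add: H0tilde_def H0_def E_def k_def \<psi>_def)
  have "exp (E w) * w\<^sup>2 = exp (g w)"
  proof (rule eq_exp_on_H[where g = g and f = "\<lambda>w. exp (E w) * w\<^sup>2", OF _ g(1) _ _ g(3,4) w])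
    fix u assume u: "u \<in> H"
    have "(E has_field_derivative E' u) (at u)"
      using DERIV_add[OF DERIV_add[OF DERIV_cmult[OF DERIV_Ln_psi[OF u]] DERIV_cmult[OF DERIV_Ln_psi[OF u]]] DERIV_const[of k]]
      unfolding E_def E'_def by simp
    then show "((\<lambda>w. exp (E w) * w\<^sup>2) has_field_derivative (exp (E u) * E' u * u\<^sup>2 + exp (E u) * (2 * u))) (at u)"
      by (auto intro!: derivative_eq_intros)
    have "u * E' u = - v0 u"
      using exponent_identity[OF H_D(1,2)[OF u]] by (simp add: E'_def D_def algebra_simps)
    moreover have "u * (exp (E u) * E' u * u\<^sup>2 + exp (E u) * (2 * u)) = (u * E' u + 2) * (exp (E u) * u\<^sup>2)"
      by (simp add: algebra_simps power2_eq_square)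
    ultimately show "u * (exp (E u) * E' u * u\<^sup>2 + exp (E u) * (2 * u)) = u * g' u * (exp (E u) * u\<^sup>2)"
      using g(2)[OF u] by simp
  next
    \<comment> \<open>The coefficients 2 - theta and theta add up to 2, so the split-off logarithms
      give exp(2 Ln (1/w)) = w^(-2), absorbed by w^2.\<close>
    define F where "F = (\<lambda>w. exp ((2 - t) * Ln ((\<psi> w - of_real (theta1 \<theta>)) * w)
        + t * Ln ((\<psi> w - of_real (theta2 \<theta>)) * w) + k))"
    have "(F \<longlongrightarrow> exp ((2 - t) * of_real (- ln (c0 \<theta>)) + t * of_real (- ln (c0 \<theta>)) + k)) (at 0)"
      unfolding F_def by (intro tendsto_intros Ln_psi_tendsto)
    then have "(F \<longlongrightarrow> 1) (at 0)" by (simp add: k algebra_simps)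
    then have "(F \<longlongrightarrow> 1) (at 0 within H)" by (rule tendsto_within_subset) simp
    moreover have "eventually (\<lambda>w. w \<in> H) (at 0 within H)" by (simp add: eventually_at_filter)
    then have "eventually (\<lambda>w. F w = exp (E w) * w\<^sup>2) (at 0 within H)"
    proof eventually_elim
      case (elim w)
      have "exp (2 * Ln (1 / w)) = exp (Ln (1 / w)) ^ 2" by (metis exp_of_nat_mult of_nat_numeral)
      also have "\<dots> = (1 / w)\<^sup>2" using H_D(1)[OF elim] by simp
      finally have e2: "exp (2 * Ln (1 / w)) * w\<^sup>2 = 1" using H_D(1)[OF elim] by (simp add: power_divide)
      have "E w = (2 - t) * Ln ((\<psi> w - of_real (theta1 \<theta>)) * w)
        + t * Ln ((\<psi> w - of_real (theta2 \<theta>)) * w) + k + 2 * Ln (1 / w)"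
        unfolding E_def Ln_psi_minus[OF H_D(4)[OF elim]] by (simp add: algebra_simps)
      then have "exp (E w) = F w * exp (2 * Ln (1 / w))" by (simp only: F_def exp_add)
      then show ?case using e2 by (simp add: mult.assoc)
    qed
    ultimately show "((\<lambda>w. exp (E w) * w\<^sup>2) \<longlongrightarrow> 1) (at 0 within H)" by (rule Lim_transform_eventually)
  qed
  then show ?thesis by (simp add: E)
qed

end

section \<open>The branch of the square root at infinity\<close>

context jp_setup
begin

lemma S_square:
  assumes "w \<noteq> 0" "Re w < 1"
  shows "(S (1 / w))\<^sup>2 = Dpoly \<theta> (\<psi> w)"
  using sqrtD inverse_notin_cut01[OF assms] by (simp add: is_sqrtD_def \<psi>_def)

lemma holomorphic_S_inverse: "(\<lambda>w. S (1 / w)) holomorphic_on {w. Re w < 1} - {0}"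
proof -
  have "(S \<circ> (\<lambda>w. 1 / w)) holomorphic_on {w. Re w < 1} - {0}"
  proof (rule holomorphic_on_compose_gen[where t = "- cut01"])
    show "S holomorphic_on - cut01" using sqrtD by (simp add: is_sqrtD_def)
    show "(\<lambda>w. 1 / w) ` ({w. Re w < 1} - {0}) \<subseteq> - cut01"
      by (rule image_subsetI, rule inverse_notin_cut01) simp_all
    show "(\<lambda>w. 1 / w) holomorphic_on {w. Re w < 1} - {0}"
      by (intro holomorphic_on_divide holomorphic_on_const holomorphic_on_ident) simp
  qed
  then show ?thesis by (simp add: o_def)
qed

lemma S_tendsto: "((\<lambda>w. S (1 / w) * w\<^sup>2) \<longlongrightarrow> of_real ((1 / c0 \<theta>)\<^sup>2)) (at 0)"
proof -
  define K where "K = (1 / c0 \<theta>)\<^sup>2"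
  define \<tau> where "\<tau> = (\<lambda>w. S (1 / w) * w\<^sup>2)"
  have K: "K > 0" using c0_pos by (simp add: K_def)
  define c where "c = 3 * theta1 \<theta> * theta2 \<theta>"
  \<comment> \<open>\<open>Dpoly\<close> has degree 4, so each linear factor takes one w out of w^4
    = (w^2)^2.\<close>
  have "((\<lambda>w. ((\<psi> w - of_real 0) * w)\<^sup>2 * ((\<psi> w - of_real 1) * w) * ((\<psi> w - of_real c) * w))
      \<longlongrightarrow> (of_real (1 / c0 \<theta>))\<^sup>2 * of_real (1 / c0 \<theta>) * of_real (1 / c0 \<theta>)) (at 0)"
    by (intro tendsto_intros psi_minus_tendsto)
  moreover have "(of_real (1 / c0 \<theta>))\<^sup>2 * of_real (1 / c0 \<theta>) * of_real (1 / c0 \<theta>) = complex_of_real (K\<^sup>2)"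
    by (simp add: K_def power2_eq_square)
  moreover have "eventually (\<lambda>w :: complex. Re w < 1 \<and> w \<noteq> 0) (at 0)"
    unfolding eventually_at
  proof (rule exI[of _ 1], intro conjI ballI impI)
    fix w :: complex assume "w \<noteq> 0 \<and> dist w 0 < 1"
    then show "Re w < 1" "w \<noteq> 0" using complex_Re_le_cmod[of w] by auto
  qed simp
  then have "eventually (\<lambda>w. ((\<psi> w - of_real 0) * w)\<^sup>2 * ((\<psi> w - of_real 1) * w) * ((\<psi> w - of_real c) * w) = (\<tau> w)\<^sup>2) (at 0)"
  proof eventually_elim
    case (elim w)
    then show ?case using S_square[of w]
      by (simp add: \<tau>_def Dpoly_def c_def power_mult_distrib) (simp add: power2_eq_square power4_eq_xxxx)
  qed
  ultimately have lim: "((\<lambda>w. (\<tau> w)\<^sup>2) \<longlongrightarrow> of_real (K\<^sup>2)) (at 0)"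
    using Lim_transform_eventually by force
  have "eventually (\<lambda>w. dist ((\<tau> w)\<^sup>2) (of_real (K\<^sup>2)) < K\<^sup>2) (at 0)"
    using lim by (rule tendstoD) (use K in simp)
  then obtain \<rho>' where \<rho>': "\<rho>' > 0" "\<And>w. w \<noteq> 0 \<Longrightarrow> dist w 0 < \<rho>' \<Longrightarrow> dist ((\<tau> w)\<^sup>2) (of_real (K\<^sup>2)) < K\<^sup>2"
    unfolding eventually_at by auto
  define \<rho> where "\<rho> = min \<rho>' 1"
  define U where "U = ball (0::complex) \<rho> - {0}"
  have \<rho>: "\<rho> > 0" "\<rho> \<le> \<rho>'" "\<rho> \<le> 1" using \<rho>' by (auto simp: \<rho>_def)
  have U: "w \<noteq> 0" "Re w < 1" if "w \<in> U" for w
    using that \<rho> complex_Re_le_cmod[of w] by (auto simp: U_def)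
  have U_dist: "dist ((\<tau> w)\<^sup>2) (of_real (K\<^sup>2)) < K\<^sup>2" if "w \<in> U" for w
    by (rule \<rho>'(2)) (use that \<rho> in \<open>auto simp: U_def\<close>)
  \<comment> \<open>Only \<open>\<tau>\<^sup>2\<close> is known near 0; the sign of \<open>\<tau>\<close> is inherited from large positive \<open>z\<close>,
    since \<open>Re \<tau>\<close> cannot vanish on a punctured disc.\<close>
  have Re_nz: "Re (\<tau> w) \<noteq> 0" if "w \<in> U" for w
  proof
    assume "Re (\<tau> w) = 0"
    then have "Re ((\<tau> w)\<^sup>2 - of_real (K\<^sup>2)) = - (Im (\<tau> w))\<^sup>2 - K\<^sup>2" by (simp add: Re_power2)
    then have "\<bar>Re ((\<tau> w)\<^sup>2 - of_real (K\<^sup>2))\<bar> \<ge> K\<^sup>2" by simp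
    then show False using U_dist[OF that] abs_Re_le_cmod[of "(\<tau> w)\<^sup>2 - of_real (K\<^sup>2)"] by (simp add: dist_norm)
  qed
  have "continuous_on U \<tau>"
  proof -
    have "(\<lambda>w. S (1 / w)) holomorphic_on U"
      by (rule holomorphic_on_subset[OF holomorphic_S_inverse]) (use U in auto)
    then have "\<tau> holomorphic_on U" unfolding \<tau>_def by (intro holomorphic_intros)
    then show ?thesis by (rule holomorphic_on_imp_continuous_on)
  qed
  moreover have "connected U" unfolding U_def by (rule connected_punctured_ball) simp
  ultimately have cI: "connected ((\<lambda>w. Re (\<tau> w)) ` U)"
    by (intro connected_continuous_image continuous_intros)
  obtain u where u: "u \<in> U" "Re (\<tau> u) > 0"
  proof -
    have "eventually (\<lambda>x. S (complex_of_real x) \<in> \<real> \<and> 0 < Re (S (complex_of_real x))) at_top"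
      using sqrtD by (simp add: is_sqrtD_def)
    then obtain X where X: "\<And>x. x \<ge> X \<Longrightarrow> 0 < Re (S (complex_of_real x))"
      unfolding eventually_at_top_linorder by blast
    define x where "x = max X (1 / \<rho> + 1)"
    have x: "x \<ge> X" "x > 1 / \<rho>" "x > 0"
      using \<rho>(1) by (auto simp: x_def less_max_iff_disj intro!: add_pos_pos)
    have "of_real (1 / x) \<in> U" using x \<rho> by (auto simp: U_def norm_divide field_simps)
    moreover have "\<tau> (of_real (1 / x)) = of_real ((1 / x)\<^sup>2) * S (of_real x)"
      by (simp add: \<tau>_def)
    then have "Re (\<tau> (of_real (1 / x))) = (1 / x)\<^sup>2 * Re (S (of_real x))"
      by (simp only: Re_complex_of_real times_complex.sel Im_complex_of_real)
    then have "Re (\<tau> (of_real (1 / x))) > 0" using X[OF x(1)] x(3) by simp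
    ultimately show ?thesis by (rule that)
  qed
  have pos: "Re (\<tau> w) > 0" if w: "w \<in> U" for w
  proof (rule ccontr)
    assume "\<not> Re (\<tau> w) > 0"
    then have "0 \<in> (\<lambda>w. Re (\<tau> w)) ` U"
      using connected_contains_Icc[OF cI imageI[OF w] imageI[OF u(1)]] u(2) by force
    then show False using Re_nz by force
  qed
  \<comment> \<open>As Re tau > 0 near 0, tau is the principal root of its square, and continuity of
    \<open>csqrt\<close> carries the limit over.\<close>
  have "isCont csqrt (of_real (K\<^sup>2))"
    by (rule continuous_at_csqrt) (use K in \<open>simp add: complex_nonpos_Reals_iff del: of_real_power\<close>)
  from isCont_tendsto_compose[OF this lim]
  have "((\<lambda>w. csqrt ((\<tau> w)\<^sup>2)) \<longlongrightarrow> csqrt (of_real (K\<^sup>2))) (at 0)" .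
  also have "csqrt (of_real (K\<^sup>2)) = of_real K"
    using K by (intro csqrt_unique) auto
  finally have "((\<lambda>w. csqrt ((\<tau> w)\<^sup>2)) \<longlongrightarrow> of_real K) (at 0)" .
  moreover have "eventually (\<lambda>w. w \<in> U) (at 0)"
    unfolding eventually_at U_def using \<rho>(1) by (intro exI[of _ \<rho>]) auto
  then have "eventually (\<lambda>w. csqrt ((\<tau> w)\<^sup>2) = \<tau> w) (at 0)"
  proof eventually_elim
    case (elim w)
    show ?case by (rule csqrt_unique) (use pos[OF elim] in auto)
  qed
  ultimately have "(\<tau> \<longlongrightarrow> of_real K) (at 0)" by (rule Lim_transform_eventually)
  then show ?thesis unfolding \<tau>_def K_def .
qed

lemma S_inverse_nonzero:
  assumes "w \<noteq> 0" "Re w < 1/2"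
  shows "S (1 / w) \<noteq> 0"
  using S_square[of w] log_derivs(3-5)[OF assms] assms by (auto simp: Dpoly_def)

end

context jp_half
begin

text \<open>Differentiate S^2 = D(psi) and divide by 2 S, which is nonzero.\<close>

lemma DERIV_S:
  assumes w: "w \<in> H"
  shows "\<exists>s. ((\<lambda>w. S (1 / w)) has_field_derivative s) (at w) \<and>
    w * s = S (1 / w) * (2 * (w * D w / \<psi> w) + w * D w / (\<psi> w - 1) + w * D w / (\<psi> w - of_real (3 * theta1 \<theta> * theta2 \<theta>))) / 2"
proof -
  define c where "c = complex_of_real (3 * theta1 \<theta> * theta2 \<theta>)"
  define s where "s = deriv (\<lambda>w. S (1 / w)) w"
  have op: "open ({u. Re u < (1::real)} - {0})" by (intro open_Diff open_halfspace_Re_lt) auto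
  have ds: "((\<lambda>w. S (1 / w)) has_field_derivative s) (at w)"
    unfolding s_def by (rule holomorphic_derivI[OF holomorphic_S_inverse op]) (use H_D[OF w] in auto)
  have nz: "\<psi> w \<noteq> 0" "\<psi> w - 1 \<noteq> 0" "\<psi> w - c \<noteq> 0"
    using log_derivs(3-5)[OF H_D(1,2)[OF w]] by (simp_all add: c_def)
  define X where "X = D w * (2 * \<psi> w * (\<psi> w - 1) * (\<psi> w - c) + (\<psi> w)\<^sup>2 * (\<psi> w - c) + (\<psi> w)\<^sup>2 * (\<psi> w - 1))"
  have "((\<lambda>w. Dpoly \<theta> (\<psi> w)) has_field_derivative X) (at w)"
    unfolding Dpoly_def c_def[symmetric] X_def
    by (auto intro!: derivative_eq_intros DERIV_psi w simp: algebra_simps power2_eq_square)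
  then have "((\<lambda>w. (S (1 / w))\<^sup>2) has_field_derivative X) (at w)"
    by (rule has_field_derivative_transform_within_open[OF _ op]) (use H_D[OF w] S_square in auto)
  moreover have "((\<lambda>w. (S (1 / w))\<^sup>2) has_field_derivative 2 * S (1 / w) * s) (at w)"
    using ds by (auto intro!: derivative_eq_intros)
  ultimately have X: "2 * S (1 / w) * s = X" by (rule DERIV_unique[rotated])
  have "X = Dpoly \<theta> (\<psi> w) * (2 * (D w / \<psi> w) + D w / (\<psi> w - 1) + D w / (\<psi> w - c))"
  proof -
    have "d * (2 * p * q * r + p\<^sup>2 * r + p\<^sup>2 * q) = p\<^sup>2 * q * r * (2 * (d / p) + d / q + d / r)"
      if "p \<noteq> 0" "q \<noteq> 0" "r \<noteq> 0" for d p q r :: complex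
      using that by (simp add: field_simps power2_eq_square)
    from this[OF nz] show ?thesis by (simp add: X_def Dpoly_def c_def)
  qed
  also have "Dpoly \<theta> (\<psi> w) = (S (1 / w))\<^sup>2" using S_square H_D[OF w] by simp
  finally have "S (1 / w) * (2 * s) = S (1 / w) * (S (1 / w) * (2 * (D w / \<psi> w) + D w / (\<psi> w - 1) + D w / (\<psi> w - c)))"
    using X by (simp add: power2_eq_square mult_ac)
  then have "2 * s = S (1 / w) * (2 * (D w / \<psi> w) + D w / (\<psi> w - 1) + D w / (\<psi> w - c))"
    using S_inverse_nonzero[OF H_D(1,2)[OF w]] by (simp only: mult_cancel_left) simp
  then have "w * (2 * s) = S (1 / w) * (w * (2 * (D w / \<psi> w) + D w / (\<psi> w - 1) + D w / (\<psi> w - c)))"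
    by (simp only: mult.left_commute)
  also have "w * (2 * (D w / \<psi> w) + D w / (\<psi> w - 1) + D w / (\<psi> w - c))
      = 2 * (w * D w / \<psi> w) + w * D w / (\<psi> w - 1) + w * D w / (\<psi> w - c)"
    by (simp add: distrib_left mult.left_commute)
  finally have "w * s = S (1 / w) * (2 * (w * D w / \<psi> w) + w * D w / (\<psi> w - 1) + w * D w / (\<psi> w - c)) / 2"
    by (simp add: mult_ac)
  with ds show ?thesis unfolding c_def by blast
qed

text \<open>The constant c0^(alpha_1) is fixed by the limit 1 at w = 0: the linear factor, the
  powers and the square root contribute c0^(-1), c0^(-alpha_1 - 1) and c0^2.\<close>

lemma prefactor:
  assumes g: "\<And>w. w \<in> H \<Longrightarrow> (g has_field_derivative g' w) (at w)" "\<And>w. w \<in> H \<Longrightarrow> w * g' w = - pb.v1 w"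
    "(g has_field_derivative g0') (at 0)" "g 0 = 0" and w: "w \<in> H"
  shows "of_real (c0 \<theta> powr \<alpha>1) * (\<psi> w - of_real (theta1 \<theta>)) * powers_comb \<theta> \<alpha>1 \<alpha>2 \<phi> (1 / w) / S (1 / w) = exp (g w)"
proof -
  define k where "k = complex_of_real (c0 \<theta> powr \<alpha>1)"
  define E where "E = (\<lambda>w. (a2 - a1 + 1) * Ln (\<psi> w - of_real (theta2 \<theta>)) + (2 * a1 - a2) * Ln (\<psi> w - of_real 0) - a1 * Ln (1 / w))"
  define E' where "E' = (\<lambda>w. (a2 - a1 + 1) * (D w / (\<psi> w - of_real (theta2 \<theta>))) + (2 * a1 - a2) * (D w / (\<psi> w - of_real 0)) + a1 / w)"
  have pc: "powers_comb \<theta> \<alpha>1 \<alpha>2 \<phi> (1 / w) = exp (E w)" if "w \<in> H" for w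
  proof -
    have "\<psi> w \<noteq> 0" "\<psi> w - of_real (theta2 \<theta>) \<noteq> 0"
      using log_derivs(2,3)[OF H_D(1,2)[OF that]] by simp_all
    then show ?thesis using H_D(1)[OF that]
      by (simp add: powers_comb_def E_def powr_def \<psi>_def exp_add exp_diff)
  qed
  define f where "f = (\<lambda>w. k * (\<psi> w - of_real (theta1 \<theta>)) * exp (E w) / S (1 / w))"
  obtain s where s: "\<And>w. w \<in> H \<Longrightarrow> ((\<lambda>w. S (1 / w)) has_field_derivative s w) (at w)"
    "\<And>w. w \<in> H \<Longrightarrow> w * s w = S (1 / w) * (2 * (w * D w / \<psi> w) + w * D w / (\<psi> w - 1) + w * D w / (\<psi> w - of_real (3 * theta1 \<theta> * theta2 \<theta>))) / 2"
    using DERIV_S by metis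
  define f' where "f' = (\<lambda>w. ((k * D w * exp (E w) + k * (\<psi> w - of_real (theta1 \<theta>)) * (exp (E w) * E' w)) * S (1 / w)
      - k * (\<psi> w - of_real (theta1 \<theta>)) * exp (E w) * s w) / (S (1 / w) * S (1 / w)))"
  have "f w = exp (g w)"
  proof (rule eq_exp_on_H[where g = g and f = f and f' = f', OF _ g(1) _ _ g(3,4) w])
    fix u assume u: "u \<in> H"
    have u0: "u \<noteq> 0" using H_D(1)[OF u] .
    have S0: "S (1 / u) \<noteq> 0" using S_inverse_nonzero H_D u by blast
    have p1: "\<psi> u - of_real (theta1 \<theta>) \<noteq> 0" using log_derivs(1)[OF H_D(1,2)[OF u]] .
    have dLn: "((\<lambda>w. Ln (1 / w)) has_field_derivative - 1 / u) (at u)"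
    proof -
      have "1 / u \<notin> \<real>\<^sub>\<le>\<^sub>0"
        using Im_inverse_pos[OF H_D(4)[OF u]] by (auto simp: complex_nonpos_Reals_iff)
      then show ?thesis using u0 by (auto intro!: derivative_eq_intros simp: field_simps)
    qed
    have dE: "(E has_field_derivative E' u) (at u)"
      unfolding E_def
      by (rule DERIV_cong[OF DERIV_diff[OF DERIV_add[OF DERIV_cmult[OF DERIV_Ln_psi[OF u]] DERIV_cmult[OF DERIV_Ln_psi[OF u]]] DERIV_cmult[OF dLn]]])
        (simp add: E'_def)
    have dexp: "((\<lambda>w. exp (E w)) has_field_derivative exp (E u) * E' u) (at u)"
      using dE by (auto intro!: derivative_eq_intros)
    have "((\<lambda>w. k * (\<psi> w - of_real (theta1 \<theta>)) * exp (E w)) has_field_derivative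
        (k * D u * exp (E u) + k * (\<psi> u - of_real (theta1 \<theta>)) * (exp (E u) * E' u))) (at u)"
      by (rule DERIV_cong[OF DERIV_mult[OF DERIV_cmult[OF DERIV_diff[OF DERIV_psi[OF u] DERIV_const]] dexp]])
        (simp add: algebra_simps)
    from DERIV_divide[OF this s(1)[OF u] S0]
    show "(f has_field_derivative f' u) (at u)" unfolding f_def f'_def .
    have "u * f' u = f u * (u * D u / (\<psi> u - of_real (theta1 \<theta>)) + u * E' u - u * s u / S (1 / u))"
      unfolding f_def f'_def using S0 p1 by (simp add: field_simps)
    also have "u * D u / (\<psi> u - of_real (theta1 \<theta>)) + u * E' u - u * s u / S (1 / u) = - pb.v1 u"
    proof -
      have "u * E' u = (a2 - a1 + 1) * (u * D u / (\<psi> u - of_real (theta2 \<theta>))) + (2 * a1 - a2) * (u * D u / \<psi> u) + a1"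
        using u0 by (simp add: E'_def distrib_left mult.left_commute[of u])
      moreover have "u * s u / S (1 / u) = (2 * (u * D u / \<psi> u) + u * D u / (\<psi> u - 1) + u * D u / (\<psi> u - of_real (3 * theta1 \<theta> * theta2 \<theta>))) / 2"
        unfolding s(2)[OF u] using S0 by simp
      ultimately show ?thesis
        using prefactor_identity[OF H_D(1,2)[OF u]] unfolding D_def[symmetric] by (simp only: add.assoc)
    qed
    finally show "u * f' u = u * g' u * f u" using g(2)[OF u] by (simp add: mult.commute)
  next
    define F where "F = (\<lambda>w. k * ((\<psi> w - of_real (theta1 \<theta>)) * w) *
        exp ((a2 - a1 + 1) * Ln ((\<psi> w - of_real (theta2 \<theta>)) * w) + (2 * a1 - a2) * Ln ((\<psi> w - of_real 0) * w))
        / (S (1 / w) * w\<^sup>2))"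
    have "(F \<longlongrightarrow> k * of_real (1 / c0 \<theta>) * exp ((a2 - a1 + 1) * of_real (- ln (c0 \<theta>)) + (2 * a1 - a2) * of_real (- ln (c0 \<theta>)))
       / of_real ((1 / c0 \<theta>)\<^sup>2)) (at 0)"
      unfolding F_def by (intro tendsto_intros Ln_psi_tendsto psi_minus_tendsto S_tendsto) (use c0_pos in simp)
    also have "k * of_real (1 / c0 \<theta>) * exp ((a2 - a1 + 1) * of_real (- ln (c0 \<theta>)) + (2 * a1 - a2) * of_real (- ln (c0 \<theta>)))
       / of_real ((1 / c0 \<theta>)\<^sup>2) = 1"
    proof -
      have "(a2 - a1 + 1) * of_real (- ln (c0 \<theta>)) + (2 * a1 - a2) * of_real (- ln (c0 \<theta>))
          = of_real (- \<alpha>1 * ln (c0 \<theta>) - ln (c0 \<theta>))" by (simp add: algebra_simps)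
      then have "exp ((a2 - a1 + 1) * of_real (- ln (c0 \<theta>)) + (2 * a1 - a2) * of_real (- ln (c0 \<theta>)))
          = complex_of_real (exp (- \<alpha>1 * ln (c0 \<theta>) - ln (c0 \<theta>)))" by (simp only: exp_of_real)
      also have "exp (- \<alpha>1 * ln (c0 \<theta>) - ln (c0 \<theta>)) = 1 / (c0 \<theta> powr \<alpha>1 * c0 \<theta>)"
        using c0_pos by (simp add: exp_diff exp_minus powr_def field_simps)
      finally show ?thesis using c0_pos by (simp add: k_def power2_eq_square)
    qed
    finally have "(F \<longlongrightarrow> 1) (at 0 within H)" by (rule tendsto_within_subset) simp
    moreover have "eventually (\<lambda>w. w \<in> H) (at 0 within H)" by (simp add: eventually_at_filter)
    then have "eventually (\<lambda>w. F w = f w) (at 0 within H)"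
    proof eventually_elim
      case (elim w)
      have w0: "w \<noteq> 0" using H_D(1)[OF elim] .
      \<comment> \<open>The coefficients of Ln (1/w) sum to (alpha_2 - alpha_1 + 1) + (2 alpha_1 -
        alpha_2) - alpha_1 = 1.\<close>
      have "E w = ((a2 - a1 + 1) * Ln ((\<psi> w - of_real (theta2 \<theta>)) * w) + (2 * a1 - a2) * Ln ((\<psi> w - of_real 0) * w)) + Ln (1 / w)"
        unfolding E_def Ln_psi_minus[OF H_D(4)[OF elim]] by (simp add: algebra_simps)
      then have "exp (E w) = exp ((a2 - a1 + 1) * Ln ((\<psi> w - of_real (theta2 \<theta>)) * w) + (2 * a1 - a2) * Ln ((\<psi> w - of_real 0) * w)) * (1 / w)"
        using w0 by (simp only: exp_add) simp
      then have "exp ((a2 - a1 + 1) * Ln ((\<psi> w - of_real (theta2 \<theta>)) * w) + (2 * a1 - a2) * Ln ((\<psi> w - of_real 0) * w)) = exp (E w) * w"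
        using w0 by simp
      then show ?case using w0 unfolding F_def f_def by (simp add: power2_eq_square)
    qed
    ultimately show "(f \<longlongrightarrow> 1) (at 0 within H)" by (rule Lim_transform_eventually)
  qed
  then show ?thesis unfolding f_def k_def pc[OF w] .
qed

end

section \<open>Assembly of the asymptotic formula\<close>

context jp_setup
begin

text \<open>Inversion maps U into the single convex set T around w = 0, on which the expansion of Q
  holds with fixed constants; hence the uniformity in z.\<close>

lemma uniform_asymptotics:
  fixes r :: real
  assumes \<alpha>: "\<alpha>1 > -1" "\<alpha>2 > -1" "\<alpha>1 - \<alpha>2 \<notin> \<int>" and r: "r > 0"
  defines "U \<equiv> {z. Re z < 0 \<and> norm z > 1 / r}"
  shows "\<exists>(K::real) (N::nat). \<forall>(n::nat) (n1::nat) (n2::nat) (P::complex poly).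
       n \<ge> N \<longrightarrow> n1 + n2 = 2 * n \<longrightarrow> real n2 / real (n1 + n2) = \<theta> / 2 \<longrightarrow>
       is_JP_poly \<alpha>1 \<alpha>2 n1 n2 P \<longrightarrow>
       (\<forall>z\<in>U. \<exists>\<epsilon>::complex. norm \<epsilon> \<le> K / real n \<and>
          poly P z =
            of_real (4 powr \<alpha>1) * (\<phi> z - of_real (theta1 \<theta>))
              / of_real (((2 + \<theta>) * (4 - \<theta>)) powr \<alpha>1)
            * (across_neg (powers_comb \<theta> \<alpha>1 \<alpha>2 \<phi>) z / S z)
            * across_neg (\<lambda>w. exp (of_nat n * H0tilde \<theta> \<phi> w)) z
            * (1 + \<epsilon>))"
proof -
  define T where "T = {w. Re w < 1/16 \<and> norm w < r}"
  have T_eq: "T = ball 0 r \<inter> {w. Re w < 1/16}" by (auto simp: T_def)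
  have opT: "open T" unfolding T_eq by (intro open_Int open_ball open_halfspace_Re_lt)
  have cvT: "convex T" unfolding T_eq by (intro convex_Int convex_ball convex_halfspace_Re_lt)
  have T0: "0 \<in> T" using r by (simp add: T_def)
  have T_sub: "T \<subseteq> {w. Re w < 1/2}" by (auto simp: T_def)
  obtain g0 g0' where g0: "\<And>w. w \<in> T \<Longrightarrow> (g0 has_field_derivative g0' w) (at w)"
    "\<And>w. w \<in> T \<Longrightarrow> w * g0' w = - v0 w - (- v0 0)" "g0 0 = 0"
    using primitive_of_quotient[of "\<lambda>w. - v0 w" T] opT cvT T0 holomorphic_on_subset[OF holomorphic_v0 T_sub]
    by (auto intro!: holomorphic_intros)
  obtain g1 g1' where g1: "\<And>w. w \<in> T \<Longrightarrow> (g1 has_field_derivative g1' w) (at w)"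
    "\<And>w. w \<in> T \<Longrightarrow> w * g1' w = - pb.v1 w - (- pb.v1 0)" "g1 0 = 0"
    using primitive_of_quotient[of "\<lambda>w. - pb.v1 w" T] opT cvT T0 holomorphic_on_subset[OF pb.holomorphic_v1 T_sub]
    by (auto intro!: holomorphic_intros)
  have g0': "w * g0' w = 2 - v0 w" if "w \<in> T" for w using g0(2)[OF that] by (simp add: pb.v0_0)
  have g1': "w * g1' w = - pb.v1 w" if "w \<in> T" for w using g1(2)[OF that] by (simp add: pb.v1_0)
  obtain K N where KN: "K > 0" "N > 0" and main: "\<forall>n\<ge>N. \<forall>V V1 V2 Q Q'. riccati_sol t a1 a2 n V V1 V2 \<longrightarrow>
    (\<forall>w. Re w < 1/2 \<longrightarrow> (Q has_field_derivative Q' w) (at w) \<and> w * Q' w = of_nat n * (2 - V w) * Q w \<and> Q w \<noteq> 0) \<longrightarrow>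
    Q 0 = 1 \<longrightarrow>
    (\<forall>w\<in>T. \<exists>\<epsilon>. norm \<epsilon> \<le> K / real n \<and> Q w = exp (of_nat n * g0 w + g1 w) * (1 + \<epsilon>))"
    using pb.ratio_asymptotics[OF r, folded T_def, OF g0(1) g0' g0(3) g1(1) g1' g1(3)]
    by blast
  have U: "z \<noteq> 0" "1 / z \<in> T" "Re (1 / z) < 1" "Re (1 / z) < 1/2" "z \<in> - cut01" if "z \<in> U" for z
  proof -
    have z: "Re z < 0" "norm z > 1 / r" using that by (auto simp: U_def)
    show "z \<noteq> 0" using z by auto
    have "Re (1 / z) \<le> 0" using z by (simp add: Re_divide divide_nonpos_nonneg)
    moreover have "norm (1 / z) < r"
      using z r \<open>z \<noteq> 0\<close> by (simp add: norm_divide field_simps)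
    ultimately show "1 / z \<in> T" "Re (1 / z) < 1" "Re (1 / z) < 1/2" by (auto simp: T_def)
    show "z \<in> - cut01" using z by auto
  qed
  have opU: "open U"
  proof -
    have "U = {z. Re z < 0} \<inter> - cball 0 (1 / r)" by (auto simp: U_def)
    then show ?thesis by (simp add: open_Int open_halfspace_Re_lt open_Compl)
  qed
  define kk where "kk = complex_of_real (c0 \<theta> powr \<alpha>1)"
  have kk0: "kk \<noteq> 0" using c0_pos by (simp add: kk_def)
  have c0_powr: "complex_of_real (4 powr \<alpha>1) * X / complex_of_real (((2 + \<theta>) * (4 - \<theta>)) powr \<alpha>1) = kk * X" for X
  proof -
    have "c0 \<theta> powr \<alpha>1 = 4 powr \<alpha>1 / ((2 + \<theta>) * (4 - \<theta>)) powr \<alpha>1"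
      unfolding c0_def using \<theta> by (intro powr_divide)
    then show ?thesis by (simp add: kk_def)
  qed
  have phi_nz: "\<phi> z - of_real (theta1 \<theta>) \<noteq> 0" if "z \<in> U" for z using phi_eq(3)[OF U(5)[OF that]] by simp
  have S_nz: "S z \<noteq> 0" if "z \<in> U" for z using S_inverse_nonzero[of "1 / z"] U[OF that] by simp
  \<comment> \<open>The extension of \<open>powers_comb\<close> across the negative axis, obtained
    by solving the identity of \<open>hp.prefactor\<close> for the powers. Built from g1, S and phi,
    it is continuous there.\<close>
  define M where "M = (\<lambda>z. exp (g1 (1 / z)) * S z / (kk * (\<phi> z - of_real (theta1 \<theta>))))"
  have cont_inv: "continuous_on U (\<lambda>z. g (1 / z))" if "\<And>w. w \<in> T \<Longrightarrow> (g has_field_derivative g' w) (at w)" for g g'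
  proof (rule continuous_on_compose2[of T g U "\<lambda>z. 1 / z"])
    show "continuous_on T g" using that by (meson DERIV_isCont continuous_at_imp_continuous_on)
    show "continuous_on U (\<lambda>z. 1 / z)" using U(1) by (intro continuous_intros) auto
  qed (use U in auto)
  have contM: "continuous_on U M"
  proof -
    have "continuous_on U S"
      using sqrtD U(5) unfolding is_sqrtD_def by (meson holomorphic_on_imp_continuous_on continuous_on_subset subsetI)
    moreover have "continuous_on U \<phi>"
      using phi U(5) unfolding is_phi0_def by (meson holomorphic_on_imp_continuous_on continuous_on_subset subsetI)
    ultimately show ?thesis
      unfolding M_def using kk0 phi_nz by (intro continuous_intros cont_inv[OF g1(1)]) auto
  qed
  have half: "exp (H0tilde \<theta> \<phi> z) = z\<^sup>2 * exp (g0 (1 / z)) \<and> powers_comb \<theta> \<alpha>1 \<alpha>2 \<phi> z = M z"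
    if z: "z \<in> U" "z \<notin> \<real>\<^sub>\<le>\<^sub>0" for z
  proof -
    have Im: "Im z \<noteq> 0" using z by (auto simp: U_def complex_nonpos_Reals_iff)
    \<comment> \<open>Selects the half-plane containing z; g0 and g1 are common to both, so the two
      half-planes yield the same extension.\<close>
    define \<sigma> where "\<sigma> = Im z"
    interpret hp: jp_half \<theta> \<phi> \<alpha>1 \<alpha>2 S r \<sigma>
      by standard (use r Im in \<open>auto simp: \<sigma>_def\<close>)
    have HT: "hp.H \<subseteq> T" by (auto simp: hp.H_def T_def)
    have "\<sigma> * Im (1 / z) < 0"
    proof -
      have "(Re z)\<^sup>2 + (Im z)\<^sup>2 > 0" "Im z * Im z > 0"
        using Im by (simp_all add: sum_power2_gt_zero_iff flip: power2_eq_square)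
      then show ?thesis by (simp add: \<sigma>_def Im_divide divide_pos_pos)
    qed
    then have zH: "1 / z \<in> hp.H" using U(2)[OF z(1)] by (simp add: hp.H_def T_def)
    have "exp (H0tilde \<theta> \<phi> (1 / (1 / z))) * (1 / z)\<^sup>2 = exp (g0 (1 / z))"
      by (rule hp.exp_H0tilde[OF _ _ g0(1)[OF T0] g0(3) zH]) (use g0(1) g0' HT in auto)
    then have 1: "exp (H0tilde \<theta> \<phi> z) = z\<^sup>2 * exp (g0 (1 / z))"
      using U(1)[OF z(1)] by (simp add: field_simps)
    have "kk * (\<psi> (1 / z) - of_real (theta1 \<theta>)) * powers_comb \<theta> \<alpha>1 \<alpha>2 \<phi> (1 / (1 / z)) / S (1 / (1 / z)) = exp (g1 (1 / z))"
      unfolding kk_def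
      by (rule hp.prefactor[OF _ _ g1(1)[OF T0] g1(3) zH]) (use g1(1) g1' HT in auto)
    then have "powers_comb \<theta> \<alpha>1 \<alpha>2 \<phi> z = M z"
      using kk0 phi_nz[OF z(1)] S_nz[OF z(1)] by (simp add: M_def \<psi>_def field_simps)
    with 1 show ?thesis by blast
  qed
  have "\<exists>\<epsilon>::complex. norm \<epsilon> \<le> K / real n \<and>
          poly P z =
            of_real (4 powr \<alpha>1) * (\<phi> z - of_real (theta1 \<theta>))
              / of_real (((2 + \<theta>) * (4 - \<theta>)) powr \<alpha>1)
            * (across_neg (powers_comb \<theta> \<alpha>1 \<alpha>2 \<phi>) z / S z)
            * across_neg (\<lambda>w. exp (of_nat n * H0tilde \<theta> \<phi> w)) z
            * (1 + \<epsilon>)"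
    if n: "n \<ge> N" and n12: "n1 + n2 = 2 * n" "real n2 / real (n1 + n2) = \<theta> / 2"
      and JP: "is_JP_poly \<alpha>1 \<alpha>2 n1 n2 P" and z: "z \<in> U" for n n1 n2 P z
  proof -
    have n0: "n > 0" using n KN by simp
    obtain V V1 V2 Q Q' where sol: "riccati_sol t a1 a2 n V V1 V2"
      and Q: "\<And>w. Re w < 1/2 \<Longrightarrow> (Q has_field_derivative Q' w) (at w)"
        "\<And>w. Re w < 1/2 \<Longrightarrow> w * Q' w = of_nat n * (2 - V w) * Q w"
        "\<And>w. Re w < 1/2 \<Longrightarrow> Q w \<noteq> 0" "Q 0 = 1"
      and P: "\<And>z. z \<noteq> 0 \<Longrightarrow> poly P z = z ^ (2 * n) * Q (1 / z)"
      using JP_riccati[OF \<alpha> n12(1) n0 n12(2) JP] by metis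
    have "\<forall>w. Re w < 1/2 \<longrightarrow> (Q has_field_derivative Q' w) (at w) \<and> w * Q' w = of_nat n * (2 - V w) * Q w \<and> Q w \<noteq> 0"
      using Q(1-3) by blast
    with main n sol Q(4) have "\<forall>w\<in>T. \<exists>\<epsilon>. norm \<epsilon> \<le> K / real n \<and> Q w = exp (of_nat n * g0 w + g1 w) * (1 + \<epsilon>)"
      by blast
    from bspec[OF this U(2)[OF z]] obtain \<epsilon> where \<epsilon>: "norm \<epsilon> \<le> K / real n"
      "Q (1 / z) = exp (of_nat n * g0 (1 / z) + g1 (1 / z)) * (1 + \<epsilon>)" by blast
    have pc: "across_neg (powers_comb \<theta> \<alpha>1 \<alpha>2 \<phi>) z = M z"
      by (rule across_neg_eq[OF opU contM _ z]) (use half in blast)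
    have "across_neg (\<lambda>w. exp (of_nat n * H0tilde \<theta> \<phi> w)) z = (z\<^sup>2 * exp (g0 (1 / z))) ^ n"
    proof (rule across_neg_eq[OF opU _ _ z, of "\<lambda>z. (z\<^sup>2 * exp (g0 (1 / z))) ^ n"])
      show "continuous_on U (\<lambda>z. (z\<^sup>2 * exp (g0 (1 / z))) ^ n)"
        by (intro continuous_intros cont_inv[OF g0(1)])
      show "exp (of_nat n * H0tilde \<theta> \<phi> w) = (w\<^sup>2 * exp (g0 (1 / w))) ^ n"
        if "w \<in> U" "w \<notin> \<real>\<^sub>\<le>\<^sub>0" for w
        using half[OF that] by (simp add: exp_of_nat_mult)
    qed
    also have "\<dots> = z ^ (2 * n) * exp (of_nat n * g0 (1 / z))"
      by (simp add: power_mult_distrib power_mult exp_of_nat_mult)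
    finally have ex: "across_neg (\<lambda>w. exp (of_nat n * H0tilde \<theta> \<phi> w)) z = z ^ (2 * n) * exp (of_nat n * g0 (1 / z))" .
    have "poly P z = kk * (\<phi> z - of_real (theta1 \<theta>)) * (M z / S z) * (z ^ (2 * n) * exp (of_nat n * g0 (1 / z))) * (1 + \<epsilon>)"
      using kk0 phi_nz[OF z] S_nz[OF z] unfolding P[OF U(1)[OF z]] \<epsilon>(2) M_def exp_add by simp
    then show ?thesis unfolding pc ex c0_powr using \<epsilon>(1) by blast
  qed
  then show ?thesis by blast
qed

end

theorem theorem7p4:
  fixes \<alpha>1 \<alpha>2 \<theta> :: real and \<phi> S :: "complex \<Rightarrow> complex"
  assumes "\<alpha>1 > -1" and "\<alpha>2 > -1" and "\<alpha>1 - \<alpha>2 \<notin> \<int>"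
    and "0 < \<theta>" and "\<theta> < 1"
    and "is_phi0 \<theta> \<phi>" and "is_sqrtD \<theta> \<phi> S"
  shows "\<exists>D. open D \<and> complex_of_real (xstar \<theta>) \<in> D \<and> D \<subseteq> - cut01 \<and>
    (\<exists>(K::real) (N::nat). \<forall>(n::nat) (n1::nat) (n2::nat) (P::complex poly).
       n \<ge> N \<longrightarrow> n1 + n2 = 2 * n \<longrightarrow> real n2 / real (n1 + n2) = \<theta> / 2 \<longrightarrow>
       is_JP_poly \<alpha>1 \<alpha>2 n1 n2 P \<longrightarrow>
       (\<forall>z\<in>D. \<exists>\<epsilon>::complex. norm \<epsilon> \<le> K / real n \<and>
          poly P z =
            of_real (4 powr \<alpha>1) * (\<phi> z - of_real (theta1 \<theta>))
              / of_real (((2 + \<theta>) * (4 - \<theta>)) powr \<alpha>1)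
            * (across_neg (powers_comb \<theta> \<alpha>1 \<alpha>2 \<phi>) z / S z)
            * across_neg (\<lambda>w. exp (of_nat n * H0tilde \<theta> \<phi> w)) z
            * (1 + \<epsilon>)))"
proof -
  interpret jp_setup \<theta> \<phi> \<alpha>1 \<alpha>2 S by standard (use assms in auto)
  have x: "xstar \<theta> < 0" using assms(4,5) by (auto simp: xstar_def intro!: divide_pos_pos mult_pos_pos)
  \<comment> \<open>Makes 1/r half of the modulus of \<open>xstar \<theta>\<close>, which places
    that point inside \<open>D\<close>.\<close>
  define r where "r = 2 / \<bar>xstar \<theta>\<bar>"
  define D where "D = {z :: complex. Re z < 0 \<and> norm z > 1 / r}"
  have "D = {z. Re z < 0} \<inter> - cball 0 (1 / r)" by (auto simp: D_def)
  then have "open D" by (simp add: open_Int open_halfspace_Re_lt open_Compl)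
  moreover have "complex_of_real (xstar \<theta>) \<in> D" using x by (simp add: D_def r_def)
  moreover have "D \<subseteq> - cut01" by (auto simp: D_def)
  moreover have "r > 0" using x by (simp add: r_def)
  note uniform_asymptotics[OF assms(1-3) this, folded D_def]
  ultimately show ?thesis by blast
qed

end
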